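(* Fix $\tau>0$ and let $f^n_{\underline\omega}$ be the random dynamical system on $\mathbb T^2$ generated by the Pierrehumbert model with parameter $\tau$ (see context). Let $q,s>0$. There exist a function $D:\Omega\to[1,\infty)$ and a constant $\alpha>0$ such that $\mathbb E|D|^q<\infty$ and such that for all mean-free functions $\varphi,\psi\in H^s(\mathbb T^2)$, for $\mathbb P$-almost every $\underline\omega\in\Omega$ and all $n\in\mathbb N$, $$\left|\int_{\mathbb T^2}\varphi(x)\,\psi\circ f^n_{\underline\omega}(x)\,dx\right|\le D(\underline\omega)\,e^{-\alpha n}\,\|\varphi\|_{H^s}\|\psi\|_{H^s}.$$
   Context: $\mathbb T^2$ is the torus parametrized by $[0,2\pi)^2$ (coordinates modulo $2\pi$). For $\beta\in[0,2\pi)$ and $x=(x_1,x_2)\in\mathbb T^2$ define $f^H_\beta(x)=(x_1+\tau\sin(x_2-\beta),\,x_2)$ and $f^V_\beta(x)=(x_1,\,x_2+\tau\sin(x_1-\beta))$. For $\omega=(\omega^1,\omega^2)\in[0,2\pi)^2$ set $f_\omega=f^V_{\omega^2}\circ f^H_{\omega^1}$. Let $\Omega=([0,2\pi)^2)^{\mathbb N}$ with elements $\underline\omega=(\omega_1,\omega_2,\dots)$, equipped with the product probability $\mathbb P$ under which the $\omega_j$ are i.i.d. uniformly distributed on $[0,2\pi)^2$; $\mathbb E$ is expectation with respect to $\mathbb P$. Set $f^n_{\underline\omega}=f_{\omega_n}\circ\cdots\circ f_{\omega_1}$. Mean-free means $\int_{\mathbb T^2}\varphi\,dx=0$. $H^s$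 is the usual $L^2$-based Sobolev space. *)

theory Defs
  imports "HOL-Probability.Probability" "HOL-Library.Real_Mod"
begin

text \<open>
  The torus is represented by its fundamental domain \<open>[0, 2\<pi>)\<^sup>2\<close>; \<open>rmod\<close> reduces a real number
  to the representative in \<open>[0, 2\<pi>)\<close> of its class modulo \<open>2\<pi>\<close>.
\<close>

definition torus :: "(real \<times> real) set" where
  "torus = {0..<2*pi} \<times> {0..<2*pi}"

definition torus_measure :: "(real \<times> real) measure" where
  "torus_measure = lebesgue_on torus"

definition fH :: "real \<Rightarrow> real \<Rightarrow> real \<times> real \<Rightarrow> real \<times> real" where
  "fH \<tau> \<beta> x = ((fst x + \<tau> * sin (snd x - \<beta>)) rmod (2*pi), snd x)"

definition fV :: "real \<Rightarrow> real \<Rightarrow> real \<times> real \<Rightarrow> real \<times> real" where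
  "fV \<tau> \<beta> x = (fst x, (snd x + \<tau> * sin (fst x - \<beta>)) rmod (2*pi))"

definition pierrehumbert_map :: "real \<Rightarrow> real \<times> real \<Rightarrow> real \<times> real \<Rightarrow> real \<times> real" where
  "pierrehumbert_map \<tau> w = fV \<tau> (snd w) \<circ> fH \<tau> (fst w)"

text \<open>Phases are indexed from 1, so that the map applied at step \<open>n \<ge> 1\<close> uses \<open>\<omega> n\<close>.\<close>

primrec pierrehumbert_flow ::
  "real \<Rightarrow> (nat \<Rightarrow> real \<times> real) \<Rightarrow> nat \<Rightarrow> real \<times> real \<Rightarrow> real \<times> real" where
  "pierrehumbert_flow \<tau> \<omega> 0 = id"
| "pierrehumbert_flow \<tau> \<omega> (Suc n) = pierrehumbert_map \<tau> (\<omega> (Suc n)) \<circ> pierrehumbert_flow \<tau> \<omega> n"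

text \<open>
  The uniform distribution on \<open>[0, 2\<pi>)\<^sup>2\<close>. Lebesgue measure is restricted first so that the
  underlying space is \<open>[0, 2\<pi>)\<^sup>2\<close> and not the whole plane.
\<close>

definition phase_measure :: "(real \<times> real) measure" where
  "phase_measure = uniform_measure (restrict_space lborel ({0..<2*pi} \<times> {0..<2*pi}))
                                   ({0..<2*pi} \<times> {0..<2*pi})"

definition phase_seq_measure :: "(nat \<Rightarrow> real \<times> real) measure" where
  "phase_seq_measure = PiM {1..} (\<lambda>_. phase_measure)"

text \<open>
  Fourier coefficients with respect to the orthonormal basis \<open>(2\<pi>)\<^sup>-\<^sup>1 e\<^sup>i\<^sup>k\<^sup>\<cdot>\<^sup>x\<close> of \<open>L\<^sup>2(dx)\<close>, so that
  the Sobolev norm below with exponent \<open>0\<close> is exactly the \<open>L\<^sup>2(dx)\<close> norm. Functions are complex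
  valued, which includes the real valued ones.
\<close>

definition fourier_coeff :: "(real \<times> real \<Rightarrow> complex) \<Rightarrow> int \<times> int \<Rightarrow> complex" where
  "fourier_coeff \<phi> k = complex_of_real (1 / (2*pi)) *
     (LINT x|torus_measure. \<phi> x * cis (- (of_int (fst k) * fst x + of_int (snd k) * snd x)))"

definition sobolev_term :: "real \<Rightarrow> (real \<times> real \<Rightarrow> complex) \<Rightarrow> int \<times> int \<Rightarrow> real" where
  "sobolev_term s \<phi> k =
     (1 + (of_int (fst k))\<^sup>2 + (of_int (snd k))\<^sup>2) powr s * (cmod (fourier_coeff \<phi> k))\<^sup>2"

definition sobolev_space :: "real \<Rightarrow> (real \<times> real \<Rightarrow> complex) set" where
  "sobolev_space s = {\<phi>. \<phi> \<in> borel_measurable torus_measure \<and>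
      integrable torus_measure (\<lambda>x. (cmod (\<phi> x))\<^sup>2) \<and> sobolev_term s \<phi> summable_on UNIV}"

definition sobolev_norm :: "real \<Rightarrow> (real \<times> real \<Rightarrow> complex) \<Rightarrow> real" where
  "sobolev_norm s \<phi> = sqrt (\<Sum>\<^sub>\<infinity>k\<in>UNIV. sobolev_term s \<phi> k)"

definition mean_free :: "(real \<times> real \<Rightarrow> complex) \<Rightarrow> bool" where
  "mean_free \<phi> \<longleftrightarrow> (LINT x|torus_measure. \<phi> x) = 0"

end

theory Submission
  imports Defs
begin

text \<open>
  Since the phases are uniform, the random maps commute in law with translations, so the difference
  \<open>z = x - y\<close> of two trajectories is a Markov chain on the torus: \<open>z\<^sub>1\<close> is moved by
  \<open>2\<tau> sin(z\<^sub>2/2) cos \<theta>\<close> with a uniform angle \<open>\<theta>\<close>, and then \<open>z\<^sub>2\<close> by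
  \<open>2\<tau> sin(z\<^sub>1/2) cos \<theta>'\<close>. Its transition operator is a product of two self-adjoint averages
  over shears and contracts mean-free functions in \<open>L\<^sup>2\<close> by a factor \<open>r < 1\<close>. Indeed a
  function nearly preserved by both averages is nearly constant away from the origin, and near the
  origin its square would be a measure almost invariant under two transverse shears, which is
  excluded by a ping-pong argument with two cones.

  The gap bounds the second moments of the correlations of two Fourier modes by
  \<open>2 r\<^sup>n\<^sup>/\<^sup>2\<close>. Summing these moments with weights polynomial in the frequencies gives one random
  constant for all modes, and truncating Fourier series at a frequency \<open>N\<close> growing exponentially
  in \<open>n\<close> passes to Sobolev functions of any positive order.
\<close>

section \<open>The uniform measure on the circle\<close>

text \<open>The obstacle is the degeneracy at the diagonal: the amplitude
  \<open>2 \<tau> |sin(z/2)|\<close> of each shear vanishes at \<open>z = 0\<close>, where the two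
  trajectories coincide and stay together. The circle averages have no gap uniform over the slices,
  and the Dirac mass at the origin is invariant, so functions whose squares concentrate there must
  be ruled out quantitatively. The way out is scale invariance: the arc cut from a cone at height
  \<open>v\<close> has width proportional to \<open>|sin(v/2)|\<close>, just like the amplitude of
  the shear acting on that slice. Hence a number \<open>N\<close> of comparisons depending on \<tau>
  alone moves every such arc off itself, however close to the origin. Self-adjointness allows the
  losses of norm under the two averages to be added: averaging does not increase the loss, so the
  losses telescope over one step of the chain. Moments of every order are available because a
  correlation of two modes is bounded by 1, so that its p-th moment is at most the second one when
  \<open>p \<ge> 2\<close>. The price is a rate that shrinks with p, since a p-th root is taken at
  the end.\<close>

definition circ :: "real measure" where
  "circ = uniform_measure lborel {0..<2*pi}"

lemma sets_circ [simp, measurable_cong]: "sets circ = sets borel"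
  and space_circ [simp]: "space circ = UNIV"
  by (simp_all add: circ_def)

global_interpretation circ: prob_space circ
  unfolding circ_def by (intro prob_space_uniform_measure) auto

lemma nn_integral_circ:
  assumes [measurable]: "f \<in> borel_measurable borel"
  shows "(\<integral>\<^sup>+x. f x \<partial>circ) = (\<integral>\<^sup>+x. f x * indicator {0..<2*pi} x \<partial>lborel) / ennreal (2*pi)"
  unfolding circ_def by (subst nn_integral_uniform_measure) auto

lemma circ_density: "circ = density lborel (\<lambda>x. ennreal (indicator {0..<2*pi} x / (2*pi)))"
  unfolding circ_def uniform_measure_def
  by (intro arg_cong[where f = "density lborel"] ext)
     (auto split: split_indicator simp: divide_ennreal[symmetric])

lemma integral_circ:
  fixes f :: "real \<Rightarrow> real"
  assumes [measurable]: "f \<in> borel_measurable borel"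
  shows "(\<integral>x. f x \<partial>circ) = (\<integral>x. indicator {0..<2*pi} x * f x \<partial>lborel) / (2*pi)"
proof -
  have "(\<integral>x. f x \<partial>circ) = (\<integral>x. indicator {0..<2*pi} x / (2*pi) * f x \<partial>lborel)"
    unfolding circ_density by (subst integral_density) auto
  also have "\<dots> = (\<integral>x. indicator {0..<2*pi} x * f x \<partial>lborel) / (2*pi)"
    by (simp add: field_simps flip: integral_divide_zero)
  finally show ?thesis .
qed

lemma AE_circ: "AE x in circ. x \<in> {0..<2*pi}"
  unfolding circ_def by (rule AE_uniform_measureI) auto

lemma AE_circ_neq: "AE x in circ. x \<noteq> c"
  unfolding circ_def by (rule AE_uniform_measureI) (use AE_lborel_singleton[of c] in auto)

lemma periodic_shift_int:
  fixes h :: "real \<Rightarrow> 'a"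
  assumes "\<And>x. h (x + 2*pi) = h x"
  shows "h (x + of_int m * (2*pi)) = h x"
proof (induction m rule: int_induct[where k = 0])
  case (step1 i)
  have "h (x + of_int (i + 1) * (2*pi)) = h ((x + of_int i * (2*pi)) + 2*pi)"
    by (simp add: algebra_simps)
  with step1 assms show ?case by simp
next
  case (step2 i)
  have "h (x + of_int i * (2*pi)) = h ((x + of_int (i - 1) * (2*pi)) + 2*pi)"
    by (simp add: algebra_simps)
  with step2 assms show ?case by simp
qed simp

lemma periodic_rmod:
  fixes h :: "real \<Rightarrow> 'a"
  assumes "\<And>x. h (x + 2*pi) = h x"
  shows "h (x rmod (2*pi)) = h x"
proof -
  have "x = x rmod (2*pi) + of_int \<lfloor>x / (2*pi)\<rfloor> * (2*pi)"
    by (simp add: rmod_def)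
  then show ?thesis
    by (metis periodic_shift_int[of h, OF assms])
qed

text \<open>The shifted window \<open>[a, a + 2*pi)\<close> is cut at \<open>p + 2*pi\<close>, the
  next multiple of the period, and the piece beyond the cut moves back by one period to fill
  \<open>[p, a)\<close>.\<close>

lemma nn_integral_periodic_shift:
  fixes h :: "real \<Rightarrow> ennreal"
  assumes [measurable]: "h \<in> borel_measurable borel" and per: "\<And>x. h (x + 2*pi) = h x"
  shows "(\<integral>\<^sup>+x. h (x + a) * indicator {0..<2*pi} x \<partial>lborel)
       = (\<integral>\<^sup>+x. h x * indicator {0..<2*pi} x \<partial>lborel)"
proof -
  have shift: "(\<integral>\<^sup>+x. h x * indicator {c..<d} x \<partial>lborel)
      = (\<integral>\<^sup>+x. h (x + t) * indicator {c - t..<d - t} x \<partial>lborel)" for c d t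
    by (subst nn_integral_real_affine[where c = 1 and t = t])
       (auto intro!: nn_integral_cong simp: add_ac split: split_indicator)
  have split: "(\<integral>\<^sup>+x. h x * indicator {b..<c} x \<partial>lborel) + (\<integral>\<^sup>+x. h x * indicator {c..<d} x \<partial>lborel)
      = (\<integral>\<^sup>+x. h x * indicator {b..<d} x \<partial>lborel)" if "b \<le> c" "c \<le> d" for b c d
    using that by (subst nn_integral_add[symmetric]) (auto intro!: nn_integral_cong split: split_indicator)
  define m where "m = \<lfloor>a / (2*pi)\<rfloor>"
  define p where "p = of_int m * (2*pi)"
  have p: "p \<le> a" "a \<le> p + 2*pi"
    using floor_divide_lower[of "2*pi" a] floor_divide_upper[of "2*pi" a]
    by (auto simp: p_def m_def algebra_simps)
  have hp: "h (x + p) = h x" for x unfolding p_def by (rule periodic_shift_int) (rule per)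
  have "(\<integral>\<^sup>+x. h (x + a) * indicator {0..<2*pi} x \<partial>lborel)
      = (\<integral>\<^sup>+x. h x * indicator {a..<a + 2*pi} x \<partial>lborel)"
    by (subst shift[where t = a]) simp
  also have "\<dots> = (\<integral>\<^sup>+x. h x * indicator {a..<p + 2*pi} x \<partial>lborel)
      + (\<integral>\<^sup>+x. h x * indicator {p + 2*pi..<a + 2*pi} x \<partial>lborel)"
    using p by (intro split[symmetric]) auto
  also have "(\<integral>\<^sup>+x. h x * indicator {p + 2*pi..<a + 2*pi} x \<partial>lborel)
      = (\<integral>\<^sup>+x. h x * indicator {p..<a} x \<partial>lborel)"
    by (subst shift[where t = "2*pi"]) (simp add: per)
  also have "(\<integral>\<^sup>+x. h x * indicator {a..<p + 2*pi} x \<partial>lborel) + (\<integral>\<^sup>+x. h x * indicator {p..<a} x \<partial>lborel)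
      = (\<integral>\<^sup>+x. h x * indicator {p..<p + 2*pi} x \<partial>lborel)"
    using p by (subst add.commute, intro split) auto
  also have "\<dots> = (\<integral>\<^sup>+x. h x * indicator {0..<2*pi} x \<partial>lborel)"
    by (subst shift[where t = p]) (simp add: hp)
  finally show ?thesis .
qed

lemma rmod_measurable [measurable]: "(\<lambda>x. x rmod (2*pi)) \<in> borel_measurable borel"
  unfolding rmod_def by measurable

lemma distr_circ_rotate: "distr circ borel (\<lambda>x. (x + a) rmod (2*pi)) = circ"
proof (rule measure_eqI)
  fix A assume "A \<in> sets (distr circ borel (\<lambda>x. (x + a) rmod (2*pi)))"
  then have [measurable]: "A \<in> sets borel" by simp
  define h :: "real \<Rightarrow> ennreal" where "h x = indicator A (x rmod (2*pi))" for x
  have [measurable]: "h \<in> borel_measurable borel" unfolding h_def by measurable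
  have per: "h (x + 2*pi) = h x" for x
    using rmod_add[of x "2*pi" "2*pi"] by (simp add: h_def)
  have "emeasure (distr circ borel (\<lambda>x. (x + a) rmod (2*pi))) A
      = (\<integral>\<^sup>+x. indicator A x \<partial>distr circ borel (\<lambda>x. (x + a) rmod (2*pi)))"
    by simp
  also have "\<dots> = (\<integral>\<^sup>+x. h (x + a) \<partial>circ)"
    by (subst nn_integral_distr) (auto simp: h_def)
  also have "\<dots> = (\<integral>\<^sup>+x. h x \<partial>circ)"
    by (simp add: nn_integral_circ nn_integral_periodic_shift[where h = h, OF _ per])
  also have "\<dots> = (\<integral>\<^sup>+x. indicator A x \<partial>circ)"
    by (rule nn_integral_cong_AE) (use AE_circ in eventually_elim, auto simp: h_def)
  finally show "emeasure (distr circ borel (\<lambda>x. (x + a) rmod (2*pi))) A = emeasure circ A"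
    by simp
qed simp

lemma integral_circ_shift:
  fixes f :: "real \<Rightarrow> 'b::{banach, second_countable_topology}"
  assumes [measurable]: "f \<in> borel_measurable borel" and per: "\<And>x. f (x + 2*pi) = f x"
  shows "(\<integral>x. f (x + a) \<partial>circ) = (\<integral>x. f x \<partial>circ)"
proof -
  have "(\<integral>x. f x \<partial>circ) = (\<integral>x. f x \<partial>distr circ borel (\<lambda>x. (x + a) rmod (2*pi)))"
    by (simp add: distr_circ_rotate)
  also have "\<dots> = (\<integral>x. f ((x + a) rmod (2*pi)) \<partial>circ)"
    by (rule integral_distr) auto
  also have "\<dots> = (\<integral>x. f (x + a) \<partial>circ)"
    by (simp add: periodic_rmod[of f, OF per])
  finally show ?thesis by simp
qed

text \<open>On \<open>[pi, 2*pi]\<close> the cosine increases from -1 to 1 with derivative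
  \<open>- sin\<close> at most 1, so the law of \<open>cos b\<close> has density at least
  \<open>1 / (2*pi)\<close> on [-1, 1]. Averages over random angles thus control plain Lebesgue
  averages over displacements.\<close>

lemma circ_cos_substitution:
  fixes F :: "real \<Rightarrow> real"
  assumes [measurable]: "F \<in> borel_measurable borel" and nn: "\<And>x. 0 \<le> F x" and bd: "\<And>x. F x \<le> B"
  shows "(\<integral>x. indicator {-1..1} x * F x \<partial>lborel) \<le> 2*pi * (\<integral>b. F (cos b) \<partial>circ)"
proof -
  have "(\<integral>\<^sup>+x. ennreal (indicator {-1..1} x * F x) \<partial>lborel) = (\<integral>\<^sup>+x. ennreal (F x * indicator {cos pi..cos (2*pi)} x) \<partial>lborel)"
    by (simp add: mult.commute)
  also have "\<dots> = (\<integral>\<^sup>+x. ennreal (F (cos x) * (- sin x) * indicator {pi..2*pi} x) \<partial>lborel)"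
    by (rule nn_integral_substitution)
       (use sin_le_zero in \<open>force intro!: derivative_eq_intros continuous_intros
          simp: set_borel_measurable_def le_less\<close>)+
  also have "\<dots> \<le> (\<integral>\<^sup>+x. ennreal (F (cos x)) * indicator {0..<2*pi} x \<partial>lborel)"
  proof (rule nn_integral_mono_AE)
    show "AE x in lborel. ennreal (F (cos x) * (- sin x) * indicator {pi..2*pi} x)
        \<le> ennreal (F (cos x)) * indicator {0..<2*pi} x"
      \<comment> \<open>The half-open period omits \<open>2*pi\<close>, which the substitution
        interval contains.\<close>
      using AE_lborel_singleton[of "2*pi"]
    proof eventually_elim
      case (elim x)
      have "F (cos x) * (- sin x) \<le> F (cos x)"
        using mult_left_mono[of "- sin x" 1 "F (cos x)"] nn sin_ge_minus_one[of x] by simp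
      with elim show ?case
        by (auto split: split_indicator intro!: ennreal_leI order_trans[OF _ pi_ge_zero])
    qed
  qed
  also have "\<dots> = ennreal (2*pi) * (\<integral>\<^sup>+b. F (cos b) \<partial>circ)"
    by (subst nn_integral_circ) (auto simp: ennreal_times_divide[symmetric] ennreal_divide_times mult_divide_eq_ennreal mult.commute[of "ennreal (2*pi)"])
  also have "(\<integral>\<^sup>+b. F (cos b) \<partial>circ) = ennreal (\<integral>b. F (cos b) \<partial>circ)"
    using nn bd by (intro nn_integral_eq_integral circ.integrable_const_bound[of _ B]) auto
  finally have "(\<integral>\<^sup>+x. ennreal (indicator {-1..1} x * F x) \<partial>lborel) \<le> ennreal (2*pi * (\<integral>b. F (cos b) \<partial>circ))"
    using nn by (simp add: ennreal_mult integral_nonneg_AE)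
  then show ?thesis
    using nn by (subst integral_eq_nn_integral) (auto intro!: enn2real_leI mult_nonneg_nonneg integral_nonneg_AE)
qed

section \<open>Averaging over random rotations of the circle\<close>

lemma circ_integrable:
  fixes f :: "real \<Rightarrow> real"
  assumes "f \<in> borel_measurable borel" "\<And>x. \<bar>f x\<bar> \<le> B"
  shows "integrable circ f"
  using assms by (intro circ.integrable_const_bound[of _ B]) auto

lemma circ_integral_bounded:
  fixes f :: "real \<Rightarrow> real"
  assumes "f \<in> borel_measurable borel" "\<And>x. \<bar>f x\<bar> \<le> B"
  shows "\<bar>\<integral>x. f x \<partial>circ\<bar> \<le> B"
proof -
  have "\<bar>\<integral>x. f x \<partial>circ\<bar> \<le> (\<integral>x. \<bar>f x\<bar> \<partial>circ)"
    by (rule integral_abs_bound)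
  also have "\<dots> \<le> (\<integral>x. B \<partial>circ)"
    using circ_integrable[OF assms] assms(2) by (intro integral_mono) auto
  finally show ?thesis by (simp add: circ.prob_space[simplified])
qed

lemma circ_pair_swap:
  fixes F :: "real \<Rightarrow> real \<Rightarrow> real"
  assumes "(\<lambda>(x, y). F x y) \<in> borel_measurable (borel \<Otimes>\<^sub>M borel)" "\<And>x y. \<bar>F x y\<bar> \<le> B"
  shows "(\<integral>x. \<integral>y. F x y \<partial>circ \<partial>circ) = (\<integral>y. \<integral>x. F x y \<partial>circ \<partial>circ)"
proof -
  interpret P: pair_prob_space circ circ ..
  have [measurable]: "(\<lambda>(x, y). F x y) \<in> borel_measurable (circ \<Otimes>\<^sub>M circ)"
    using assms(1) by (simp cong: measurable_cong_sets sets_pair_measure_cong)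
  show ?thesis
    using assms(2) by (intro P.Fubini_integral[symmetric] P.P.integrable_const_bound[of _ B]) auto
qed

lemma sq_add_le: "(x + y)\<^sup>2 \<le> 2 * x\<^sup>2 + 2 * (y::real)\<^sup>2"
  using sum_squares_ge_zero[of "x - y" 0] by (simp add: power2_eq_square algebra_simps)

lemma abs_power2_le: "\<bar>x\<bar> \<le> B \<Longrightarrow> \<bar>x\<^sup>2\<bar> \<le> (B::real)\<^sup>2"
  using abs_le_square_iff[of x B] by (auto simp: abs_le_iff)

text \<open>Convolution with the arcsine law on \<open>[-a, a]\<close>, the distribution of
  \<open>a * cos b\<close> for a uniform angle. One coordinate of the difference chain is averaged
  in this way while the other is frozen.\<close>

definition cos_avg :: "real \<Rightarrow> (real \<Rightarrow> real) \<Rightarrow> real \<Rightarrow> real" where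
  "cos_avg a f u = (\<integral>b. f (u + a * cos b) \<partial>circ)"

text \<open>Boundedness settles integrability once and for all. \<open>B\<close> does not enter the
  estimates between \<open>modulus\<close>, \<open>cos_defect\<close> and energies, so the resulting
  gap is uniform in it.\<close>

locale circle_function =
  fixes f :: "real \<Rightarrow> real" and B :: real
  assumes meas [measurable]: "f \<in> borel_measurable borel"
    and per: "f (x + 2*pi) = f x"
    and bdd: "\<bar>f x\<bar> \<le> B"
begin

definition modulus :: "real \<Rightarrow> real" where
  "modulus s = (\<integral>u. (f (u + s) - f u)\<^sup>2 \<partial>circ)"

text \<open>For the self-adjoint contraction \<open>A = cos_avg a\<close> this is the quadratic form
  of \<open>1 - A^2\<close>; it measures how far \<open>f\<close> is from being invariant.\<close>

definition cos_defect :: "real \<Rightarrow> real" where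
  "cos_defect a = (\<integral>u. (f u)\<^sup>2 \<partial>circ) - (\<integral>u. (cos_avg a f u)\<^sup>2 \<partial>circ)"

lemma cos_avg_circle_function: "circle_function (cos_avg a f) B"
proof
  show "cos_avg a f \<in> borel_measurable borel" unfolding cos_avg_def by measurable
  show "cos_avg a f (x + 2*pi) = cos_avg a f x" for x
    unfolding cos_avg_def using per by (intro Bochner_Integration.integral_cong) (auto simp: add_ac, metis add.assoc add.commute per)
  show "\<bar>cos_avg a f x\<bar> \<le> B" for x
    unfolding cos_avg_def using bdd by (intro circ_integral_bounded) auto
qed

lemma diff_bdd: "\<bar>f x - f y\<bar> \<le> 2 * B"
  using bdd[of x] bdd[of y] by linarith

lemma shift_difference:
  "(\<integral>u. (f (u + s + r) - f (u + r))\<^sup>2 \<partial>circ) = modulus s"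
proof -
  have "(\<integral>u. (f ((u + r) + s) - f (u + r))\<^sup>2 \<partial>circ) = modulus s"
    unfolding modulus_def
  proof (rule integral_circ_shift[where f = "\<lambda>u. (f (u + s) - f u)\<^sup>2"])
    fix x show "(f (x + 2*pi + s) - f (x + 2*pi))\<^sup>2 = (f (x + s) - f x)\<^sup>2"
      using per[of "x + s"] per[of x] by (simp add: add_ac)
  qed measurable
  then show ?thesis by (simp add: add_ac)
qed

text \<open>Law of total variance: for fixed \<open>u\<close> the variance over \<open>b\<close> is
  the mean of the squares minus \<open>(cos_avg a f u)^2\<close>, and rotation invariance turns the
  mean of the squares over \<open>u\<close> into the energy of \<open>f\<close>.\<close>

lemma cos_defect_eq:
  "cos_defect a = (\<integral>b. \<integral>u. (f (u + a * cos b) - cos_avg a f u)\<^sup>2 \<partial>circ \<partial>circ)"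
proof -
  interpret m: circle_function "cos_avg a f" B by (rule cos_avg_circle_function)
  note [measurable] = m.meas
  have "(\<integral>b. \<integral>u. (f (u + a * cos b) - cos_avg a f u)\<^sup>2 \<partial>circ \<partial>circ)
      = (\<integral>u. \<integral>b. (f (u + a * cos b) - cos_avg a f u)\<^sup>2 \<partial>circ \<partial>circ)"
  proof (rule circ_pair_swap)
    show "\<bar>(f (u + a * cos b) - cos_avg a f u)\<^sup>2\<bar> \<le> (2*B)\<^sup>2" for u b
      using bdd[of "u + a * cos b"] m.bdd[of u] by (intro abs_power2_le) linarith
  qed measurable
  also have "\<dots> = (\<integral>u. (\<integral>b. (f (u + a * cos b))\<^sup>2 \<partial>circ) - (cos_avg a f u)\<^sup>2 \<partial>circ)"
  proof (intro Bochner_Integration.integral_cong refl)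
    fix u
    have i1: "integrable circ (\<lambda>b. (f (u + a * cos b))\<^sup>2)"
      using bdd by (intro circ_integrable[of _ "B\<^sup>2"] abs_power2_le) auto
    have i2: "integrable circ (\<lambda>b. f (u + a * cos b))"
      using bdd by (intro circ_integrable[of _ "B"]) auto
    have "(\<integral>b. (f (u + a * cos b) - cos_avg a f u)\<^sup>2 \<partial>circ)
      = (\<integral>b. (f (u + a * cos b))\<^sup>2 - 2 * cos_avg a f u * f (u + a * cos b) + (cos_avg a f u)\<^sup>2 \<partial>circ)"
      by (intro Bochner_Integration.integral_cong) (auto simp: power2_eq_square algebra_simps)
    also have "\<dots> = (\<integral>b. (f (u + a * cos b))\<^sup>2 \<partial>circ) - 2 * cos_avg a f u * cos_avg a f u + (cos_avg a f u)\<^sup>2"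
      using i1 i2 by (simp add: circ.prob_space[simplified] flip: cos_avg_def)
    finally show "(\<integral>b. (f (u + a * cos b) - cos_avg a f u)\<^sup>2 \<partial>circ)
      = (\<integral>b. (f (u + a * cos b))\<^sup>2 \<partial>circ) - (cos_avg a f u)\<^sup>2"
      by (simp add: power2_eq_square)
  qed
  also have "\<dots> = (\<integral>u. \<integral>b. (f (u + a * cos b))\<^sup>2 \<partial>circ \<partial>circ) - (\<integral>u. (cos_avg a f u)\<^sup>2 \<partial>circ)"
  proof (rule Bochner_Integration.integral_diff)
    show "integrable circ (\<lambda>u. \<integral>b. (f (u + a * cos b))\<^sup>2 \<partial>circ)"
      using bdd by (intro circ_integrable[of _ "B\<^sup>2"] circ_integral_bounded abs_power2_le) auto
    show "integrable circ (\<lambda>u. (cos_avg a f u)\<^sup>2)"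
      using m.bdd by (intro circ_integrable[of _ "B\<^sup>2"] abs_power2_le) auto
  qed
  also have "(\<integral>u. \<integral>b. (f (u + a * cos b))\<^sup>2 \<partial>circ \<partial>circ) = (\<integral>b. \<integral>u. (f (u + a * cos b))\<^sup>2 \<partial>circ \<partial>circ)"
    using bdd by (intro circ_pair_swap[of _ "B\<^sup>2"] abs_power2_le) auto
  also have "\<dots> = (\<integral>b. (\<integral>u. (f u)\<^sup>2 \<partial>circ) \<partial>circ)"
    by (intro Bochner_Integration.integral_cong refl integral_circ_shift[where f = "\<lambda>u. (f u)\<^sup>2"])
       (auto simp: per)
  finally show ?thesis by (simp add: cos_defect_def circ.prob_space[simplified])
qed

lemma cos_defect_nonneg: "0 \<le> cos_defect a"
  unfolding cos_defect_eq by simp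

text \<open>
  All \<open>f (u + a x)\<close> with \<open>x\<close> in \<open>[-1, 1]\<close> are close in mean to \<open>cos_avg a f u\<close>; compare the
  shifts by \<open>a x\<close> and \<open>a (x + t)\<close> and average over \<open>x\<close> in \<open>[-1, 0]\<close>.
\<close>

lemma modulus_le_cos_defect:
  assumes "0 \<le> t" "t \<le> 1"
  shows "modulus (a * t) \<le> 8 * pi * cos_defect a"
proof -
  interpret m: circle_function "cos_avg a f" B by (rule cos_avg_circle_function)
  note [measurable] = m.meas
  define W where "W x = (\<integral>u. (f (u + a * x) - cos_avg a f u)\<^sup>2 \<partial>circ)" for x
  have [measurable]: "W \<in> borel_measurable borel" unfolding W_def by measurable
  have bd: "\<bar>(f (u + r) - cos_avg a f u)\<^sup>2\<bar> \<le> (2*B)\<^sup>2" for u r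
    using bdd[of "u + r"] m.bdd[of u] by (intro abs_power2_le) linarith
  have Wnn: "0 \<le> W x" for x unfolding W_def by simp
  have Wbd: "\<bar>W x\<bar> \<le> (2*B)\<^sup>2" for x unfolding W_def using bd by (intro circ_integral_bounded) auto
  have D: "modulus (a * t) \<le> 2 * W (x + t) + 2 * W x" for x
  proof -
    have "modulus (a * t) = (\<integral>u. (f (u + a * t + a * x) - f (u + a * x))\<^sup>2 \<partial>circ)"
      by (rule shift_difference[symmetric])
    also have "\<dots> \<le> (\<integral>u. 2 * (f (u + a * (x + t)) - cos_avg a f u)\<^sup>2 + 2 * (f (u + a * x) - cos_avg a f u)\<^sup>2 \<partial>circ)"
    proof (rule integral_mono)
      show "integrable circ (\<lambda>u. (f (u + a * t + a * x) - f (u + a * x))\<^sup>2)"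
        using diff_bdd by (intro circ_integrable[of _ "(2*B)\<^sup>2"] abs_power2_le) auto
      show "integrable circ (\<lambda>u. 2 * (f (u + a * (x + t)) - cos_avg a f u)\<^sup>2 + 2 * (f (u + a * x) - cos_avg a f u)\<^sup>2)"
        using bd by (intro Bochner_Integration.integrable_add integrable_mult_right circ_integrable[of _ "(2*B)\<^sup>2"]) auto
      show "(f (u + a * t + a * x) - f (u + a * x))\<^sup>2
        \<le> 2 * (f (u + a * (x + t)) - cos_avg a f u)\<^sup>2 + 2 * (f (u + a * x) - cos_avg a f u)\<^sup>2" for u
        using sq_add_le[of "f (u + a * (x + t)) - cos_avg a f u" "- (f (u + a * x) - cos_avg a f u)"]
        by (simp add: distrib_left add.assoc add.commute[of "a * x"] power2_commute[of "cos_avg a f u"])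
    qed
    also have "\<dots> = 2 * W (x + t) + 2 * W x"
      unfolding W_def using bd
      by (subst Bochner_Integration.integral_add) (auto intro!: circ_integrable[of _ "(2*B)\<^sup>2"])
    finally show ?thesis .
  qed
  have ibd: "integrable lborel (\<lambda>x. indicator {c..d} x * g x)"
    if [measurable]: "g \<in> borel_measurable borel" and "\<And>x. \<bar>g x\<bar> \<le> (2*B)\<^sup>2" for c d and g :: "real \<Rightarrow> real"
  proof (rule Bochner_Integration.integrable_bound[of _ "\<lambda>x. indicator {c..d} x * (2*B)\<^sup>2"])
    show "integrable lborel (\<lambda>x. indicator {c..d} x * (2*B)\<^sup>2 :: real)"
      by (intro integrable_mult_left integrable_real_indicator) (auto simp: emeasure_lborel_Icc_eq)
  qed (use that in \<open>auto split: split_indicator\<close>)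
  have "modulus (a * t) = (\<integral>x. indicator {-1..0::real} x * modulus (a * t) \<partial>lborel)"
    by simp
  also have "\<dots> \<le> (\<integral>x. 2 * (indicator {-1..0} x * W (x + t)) + 2 * (indicator {-1..0} x * W x) \<partial>lborel)"
  proof (rule integral_mono)
    show "integrable lborel (\<lambda>x. indicator {-1..0::real} x * modulus (a * t))"
      by (intro integrable_mult_left integrable_real_indicator) (auto simp: emeasure_lborel_Icc_eq)
    show "integrable lborel (\<lambda>x. 2 * (indicator {-1..0} x * W (x + t)) + 2 * (indicator {-1..0} x * W x))"
      using Wbd by (intro Bochner_Integration.integrable_add integrable_mult_right ibd) auto
    show "indicator {-1..0} x * modulus (a * t) \<le> 2 * (indicator {-1..0} x * W (x + t)) + 2 * (indicator {-1..0} x * W x)" for x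
      using D[of x] by (auto split: split_indicator)
  qed
  also have "\<dots> = 2 * (\<integral>x. indicator {-1..0} x * W (x + t) \<partial>lborel) + 2 * (\<integral>x. indicator {-1..0} x * W x \<partial>lborel)"
    using Wbd by (subst Bochner_Integration.integral_add) (auto intro!: integrable_mult_right ibd simp del: power_mult_distrib)
  also have "(\<integral>x. indicator {-1..0} x * W (x + t) \<partial>lborel) = (\<integral>x. indicator {t-1..t} x * W x \<partial>lborel)"
    by (subst lborel_integral_real_affine[where c = 1 and t = t])
       (auto intro!: Bochner_Integration.integral_cong simp: add_ac split: split_indicator)
  \<comment> \<open>Since \<open>0 \<le> t \<le> 1\<close>, both windows \<open>[t - 1, t]\<close>
    and \<open>[-1, 0]\<close> lie in [-1, 1], where the law of the cosine dominates Lebesgue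
    measure. Each costs \<open>2 * (2 * pi)\<close> defects, which makes
    \<open>8 * pi\<close>.\<close>
  also have "\<dots> \<le> (\<integral>x. indicator {-1..1} x * W x \<partial>lborel)"
    using Wbd Wnn assms by (intro integral_mono ibd) (auto split: split_indicator)
  also have "(\<integral>x. indicator {-1..0} x * W x \<partial>lborel) \<le> (\<integral>x. indicator {-1..1} x * W x \<partial>lborel)"
    using Wbd Wnn by (intro integral_mono ibd) (auto split: split_indicator)
  also have "(\<integral>x. indicator {-1..1} x * W x \<partial>lborel) \<le> 2 * pi * (\<integral>b. W (cos b) \<partial>circ)"
    using Wnn Wbd by (intro circ_cos_substitution[of _ "(2*B)\<^sup>2"]) (auto simp: abs_le_iff)
  also have "(\<integral>b. W (cos b) \<partial>circ) = cos_defect a"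
    unfolding W_def cos_defect_eq ..
  finally show ?thesis by simp
qed

text \<open>A long shift telescopes into \<open>N\<close> short ones; Cauchy-Schwarz costs one
  factor \<open>N\<close>, and translation invariance gives \<open>N\<close> equal terms.\<close>

lemma modulus_scale: "modulus (real N * s) \<le> (real N)\<^sup>2 * modulus s"
proof -
  have bd: "\<bar>(f (u + x) - f (u + y))\<^sup>2\<bar> \<le> (2*B)\<^sup>2" for u x y
    by (rule abs_power2_le) (rule diff_bdd)
  have "modulus (real N * s) \<le> (\<integral>u. real N * (\<Sum>j<N. (f (u + s + real j * s) - f (u + real j * s))\<^sup>2) \<partial>circ)"
    unfolding modulus_def
  proof (rule integral_mono)
    show "integrable circ (\<lambda>u. (f (u + real N * s) - f u)\<^sup>2)"
      using bd[of _ _ 0] by (intro circ_integrable[of _ "(2*B)\<^sup>2"]) auto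
    show "integrable circ (\<lambda>u. real N * (\<Sum>j<N. (f (u + s + real j * s) - f (u + real j * s))\<^sup>2))"
      using bd by (intro integrable_mult_right Bochner_Integration.integrable_sum circ_integrable[of _ "(2*B)\<^sup>2"]) (auto simp: add.assoc)
    fix u
    have "f (u + real N * s) - f u = (\<Sum>j<N. f (u + s + real j * s) - f (u + real j * s))"
      using sum_lessThan_telescope[of "\<lambda>j. f (u + real j * s)" N] by (simp add: algebra_simps)
    then have "(f (u + real N * s) - f u)\<^sup>2 = (\<Sum>j<N. 1 * (f (u + s + real j * s) - f (u + real j * s)))\<^sup>2"
      by simp
    also have "\<dots> \<le> (\<Sum>j<N. 1\<^sup>2) * (\<Sum>j<N. (f (u + s + real j * s) - f (u + real j * s))\<^sup>2)"
      by (rule Cauchy_Schwarz_ineq_sum)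
    finally show "(f (u + real N * s) - f u)\<^sup>2 \<le> real N * (\<Sum>j<N. (f (u + s + real j * s) - f (u + real j * s))\<^sup>2)"
      by simp
  qed
  also have "\<dots> = real N * (\<Sum>j<N. (\<integral>u. (f (u + s + real j * s) - f (u + real j * s))\<^sup>2 \<partial>circ))"
    using bd by (simp, subst Bochner_Integration.integral_sum)
      (auto intro!: circ_integrable[of _ "(2*B)\<^sup>2"] simp: add.assoc)
  also have "\<dots> = (real N)\<^sup>2 * modulus s"
    by (simp add: shift_difference power2_eq_square[of "real N"])
  finally show ?thesis .
qed

text \<open>Displacements beyond the reach \<open>a\<close> of one average are cut into
  \<open>N\<close> pieces within reach, at the quadratic price of
  \<open>modulus_scale\<close>.\<close>

lemma modulus_le_cos_defect_scaled:
  assumes "0 \<le> y" "y \<le> real N"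
  shows "modulus (a * y) \<le> (real N)\<^sup>2 * (8 * pi * cos_defect a)"
proof (cases "N = 0")
  case True
  with assms have "y = 0" by simp
  with True show ?thesis by (simp add: modulus_def)
next
  case False
  have "modulus (real N * (a * (y / real N))) \<le> (real N)\<^sup>2 * modulus (a * (y / real N))"
    by (rule modulus_scale)
  also have "\<dots> \<le> (real N)\<^sup>2 * (8 * pi * cos_defect a)"
    using assms False by (intro mult_left_mono modulus_le_cos_defect) (auto simp: field_simps)
  finally show ?thesis using False by simp
qed

text \<open>After a rotation by \<open>u\<close> the double integral averages
  \<open>modulus y\<close> over all \<open>y\<close> in one period, and
  \<open>2 * pi \<le> a * N\<close> brings each of them within reach. A shear of amplitude bounded
  below therefore forces near constancy along the circle.\<close>

lemma oscillation_le_cos_defect: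
  assumes "0 < a" "2 * pi \<le> a * real N"
  shows "(\<integral>u. \<integral>y. (f y - f u)\<^sup>2 \<partial>circ \<partial>circ) \<le> (real N)\<^sup>2 * (8 * pi * cos_defect a)"
proof -
  have bd: "\<bar>(f x - f y)\<^sup>2\<bar> \<le> (2*B)\<^sup>2" for x y
    by (rule abs_power2_le) (rule diff_bdd)
  have "(\<integral>u. \<integral>y. (f y - f u)\<^sup>2 \<partial>circ \<partial>circ) = (\<integral>u. \<integral>y. (f (y + u) - f u)\<^sup>2 \<partial>circ \<partial>circ)"
  proof (rule Bochner_Integration.integral_cong[OF refl])
    fix u
    show "(\<integral>y. (f y - f u)\<^sup>2 \<partial>circ) = (\<integral>y. (f (y + u) - f u)\<^sup>2 \<partial>circ)"
      by (rule integral_circ_shift[where f = "\<lambda>y. (f y - f u)\<^sup>2", symmetric]) (auto simp: per)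
  qed
  also have "\<dots> = (\<integral>y. \<integral>u. (f (y + u) - f u)\<^sup>2 \<partial>circ \<partial>circ)"
    using bd by (intro circ_pair_swap[of _ "(2*B)\<^sup>2"]) auto
  also have "\<dots> = (\<integral>y. modulus y \<partial>circ)"
    unfolding modulus_def by (simp add: add.commute)
  also have "\<dots> \<le> (\<integral>y. (real N)\<^sup>2 * (8 * pi * cos_defect a) \<partial>circ)"
  proof (rule integral_mono_AE)
    show "integrable circ modulus"
      unfolding modulus_def using bd by (intro circ_integrable[of _ "(2*B)\<^sup>2"] circ_integral_bounded) auto
    show "AE y in circ. modulus y \<le> (real N)\<^sup>2 * (8 * pi * cos_defect a)"
      using AE_circ
    proof eventually_elim
      case (elim y)
      have "modulus (a * (y / a)) \<le> (real N)\<^sup>2 * (8 * pi * cos_defect a)"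
        using elim assms by (intro modulus_le_cos_defect_scaled) (auto simp: field_simps)
      then show ?case using assms by simp
    qed
  qed simp
  finally show ?thesis by (simp add: circ.prob_space[simplified])
qed

end

text \<open>Jordan's inequality: on \<open>[0, pi/2]\<close> the concave sine lies above its
  chord.\<close>

lemma sin_half_ge: "0 \<le> s \<Longrightarrow> s \<le> pi \<Longrightarrow> s / pi \<le> sin (s / 2)"
proof -
  assume s: "0 \<le> s" "s \<le> pi"
  have c: "concave_on {0..pi/2} sin"
    by (rule f''_le0_imp_concave[where f' = cos and f'' = "\<lambda>x. - sin x"])
       (auto intro!: derivative_eq_intros sin_ge_zero)
  have "(1 - s / pi) * sin 0 + (s / pi) * sin (pi/2) \<le> sin ((1 - s / pi) *\<^sub>R 0 + (s / pi) *\<^sub>R (pi/2))"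
    using s by (intro concave_onD[OF c]) auto
  then show ?thesis by simp
qed

text \<open>By Jordan's inequality the arc reaches at most \<open>pi * \<sigma>\<close> to each side
  of 0, so its length is below \<open>7 * \<sigma>\<close> because \<open>2 * pi < 7\<close>. The
  bound 1/50 keeps the shift \<open>s\<close> below \<open>pi\<close>, so the translates do not meet
  around the circle either. Arguing with the subtraction formula avoids choosing representatives
  modulo \<open>2 * pi\<close>.\<close>

lemma sin_small_disjoint:
  fixes \<sigma> s u :: real
  assumes "0 < \<sigma>" "\<sigma> \<le> 1/50" "7 * \<sigma> \<le> s" "s \<le> 14 * \<sigma>"
    and "\<bar>sin (u / 2)\<bar> \<le> \<sigma>" "\<bar>sin ((u + s) / 2)\<bar> \<le> \<sigma>"
  shows False
proof -
  have pi7: "7 / pi > 2" using pi_approx by (simp add: field_simps)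
  have "sin (s / 2) = sin ((u + s) / 2 - u / 2)" by (simp add: field_simps)
  also have "\<dots> = sin ((u + s) / 2) * cos (u / 2) - cos ((u + s) / 2) * sin (u / 2)"
    by (rule sin_diff)
  also have "\<dots> \<le> \<bar>sin ((u + s) / 2)\<bar> * \<bar>cos (u / 2)\<bar> + \<bar>cos ((u + s) / 2)\<bar> * \<bar>sin (u / 2)\<bar>"
    using abs_triangle_ineq4[of "sin ((u + s) / 2) * cos (u / 2)" "cos ((u + s) / 2) * sin (u / 2)"]
    by (simp add: abs_mult)
  also have "\<dots> \<le> \<sigma> * 1 + 1 * \<sigma>"
    using assms by (intro add_mono mult_mono) auto
  finally have "sin (s / 2) \<le> 2 * \<sigma>" by simp
  moreover have "2 * \<sigma> < 7 / pi * \<sigma>" using mult_strict_right_mono[OF pi7 assms(1)] by simp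
  moreover have "7 / pi * \<sigma> \<le> s / pi" using assms(3) pi_gt_zero by (simp add: divide_right_mono)
  moreover have "s / pi \<le> sin (s / 2)"
    using assms(1-4) pi_gt3 by (intro sin_half_ge) simp_all
  ultimately show False by linarith
qed

context circle_function
begin

text \<open>
  The arc and its translates by \<open>7 \<sigma>\<close> and \<open>14 \<sigma>\<close> are disjoint and carry almost the same mass,
  so the arc carries little more than a third.
\<close>

lemma small_arc_le_cos_defect:
  assumes \<sigma>: "0 < \<sigma>" "\<sigma> \<le> 1/50" and a: "0 < a" "7 * \<sigma> \<le> a * real N"
  shows "(\<integral>u. indicator {u. \<bar>sin (u/2)\<bar> \<le> \<sigma>} u * (f u)\<^sup>2 \<partial>circ)
    \<le> 9/25 * ((\<integral>u. (f u)\<^sup>2 \<partial>circ) + 64 * (real N)\<^sup>2 * (8 * pi * cos_defect a))"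
proof -
  define w :: "real \<Rightarrow> real" where "w = indicator {u. \<bar>sin (u/2)\<bar> \<le> \<sigma>}"
  define s where "s = 7 * \<sigma>"
  define M where "M = (real N)\<^sup>2 * (8 * pi * cos_defect a)"
  define S where "S r = (\<integral>u. w u * (f (u + r))\<^sup>2 \<partial>circ)" for r
  have [measurable]: "w \<in> borel_measurable borel" unfolding w_def by measurable
  have w01: "0 \<le> w u" "w u \<le> 1" for u by (auto simp: w_def)
  have wper: "w (u + 2*pi) = w u" for u by (simp add: w_def indicator_def add_divide_distrib)
  have bd: "\<bar>w v * (f (u + r))\<^sup>2\<bar> \<le> B\<^sup>2" for u v r
    using w01[of v] abs_power2_le[OF bdd[of "u + r"]] mult_mono[of "w v" 1 "(f (u + r))\<^sup>2" "B\<^sup>2"] by (simp add: abs_mult)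
  have M1: "modulus s \<le> M"
  proof -
    have "modulus (a * (s / a)) \<le> M"
      unfolding M_def using assms by (intro modulus_le_cos_defect_scaled) (auto simp: s_def field_simps)
    then show ?thesis using a by simp
  qed
  have M2: "modulus (2 * s) \<le> 4 * M" using modulus_scale[of 2 s] M1 by simp
  have Mnn: "0 \<le> M" unfolding M_def by (simp add: cos_defect_nonneg)
  have iw: "integrable circ (\<lambda>u. w u * (f (u + r))\<^sup>2)" for r
    using bd by (intro circ_integrable[of _ "B\<^sup>2"]) auto
  have id: "integrable circ (\<lambda>u. (f (u + r) - f u)\<^sup>2)" for r
    by (rule circ_integrable[OF _ abs_power2_le[OF diff_bdd]]) auto
  \<comment> \<open>Young's inequality \<open>y^2 \<le> (1 + \<epsilon>) x^2 + (1 + 1/\<epsilon>) (x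
    - y)^2\<close> with \<epsilon> = 1/8: up to the error, each translate carries at least 8/9 of
    the mass of the arc.\<close>
  have comp: "S 0 \<le> 9/8 * S r + 9 * modulus r" for r
  proof -
    have "S 0 \<le> (\<integral>u. 9/8 * (w u * (f (u + r))\<^sup>2) + 9 * (f (u + r) - f u)\<^sup>2 \<partial>circ)"
      unfolding S_def
    proof (rule integral_mono)
      show "integrable circ (\<lambda>u. w u * (f (u + 0))\<^sup>2)"
        by (rule iw)
      show "integrable circ (\<lambda>u. 9/8 * (w u * (f (u + r))\<^sup>2) + 9 * (f (u + r) - f u)\<^sup>2)"
        by (intro Bochner_Integration.integrable_add integrable_mult_right iw id)
      fix u
      have "(f u)\<^sup>2 \<le> 9/8 * (f (u + r))\<^sup>2 + 9 * (f (u + r) - f u)\<^sup>2"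
      proof -
        have "9/8 * x\<^sup>2 + 9 * (x - y)\<^sup>2 - y\<^sup>2 = (9 * x - 8 * y)\<^sup>2 / 8" for x y :: real
          by (simp add: power2_eq_square field_simps)
        from this[of "f (u + r)" "f u"] show ?thesis by (smt (verit) zero_le_power2 divide_nonneg_pos)
      qed
      moreover have "0 \<le> 9 * (f (u + r) - f u)\<^sup>2" by simp
      ultimately show "w u * (f (u + 0))\<^sup>2 \<le> 9/8 * (w u * (f (u + r))\<^sup>2) + 9 * (f (u + r) - f u)\<^sup>2"
        by (auto simp: w_def split: split_indicator)
    qed
    also have "\<dots> = 9/8 * S r + 9 * modulus r"
      unfolding S_def modulus_def by (subst Bochner_Integration.integral_add)
         (rule integrable_mult_right[OF iw] integrable_mult_right[OF id] | simp)+
    finally show ?thesis .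
  qed
  have shift: "S r = (\<integral>u. w (u - r) * (f u)\<^sup>2 \<partial>circ)" for r
    unfolding S_def using integral_circ_shift[where f = "\<lambda>u. w (u - r) * (f u)\<^sup>2" and a = r]
      wper[of "_ - r"] per by (simp add: algebra_simps)
  have disj: "w (u - 0) + w (u - s) + w (u - 2 * s) \<le> 1" for u
    using sin_small_disjoint[OF \<sigma>, of s "u - s"] sin_small_disjoint[OF \<sigma>, of s "u - 2 * s"]
      sin_small_disjoint[OF \<sigma>, of "2 * s" "u - 2 * s"] \<sigma>
    by (auto simp: w_def s_def indicator_def)
  have bd': "\<bar>w v * (f u)\<^sup>2\<bar> \<le> B\<^sup>2" for u v using bd[of v u 0] by simp
  have i: "integrable circ (\<lambda>u. w (u - r) * (f u)\<^sup>2)" for r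
    using bd' by (intro circ_integrable[of _ "B\<^sup>2"]) auto
  have "S 0 + S s + S (2 * s) = (\<integral>u. w (u - 0) * (f u)\<^sup>2 + w (u - s) * (f u)\<^sup>2 + w (u - 2 * s) * (f u)\<^sup>2 \<partial>circ)"
    unfolding shift using i[of 0] i[of s] i[of "2 * s"] by simp
  also have "\<dots> \<le> (\<integral>u. (f u)\<^sup>2 \<partial>circ)"
  proof (rule integral_mono)
    show "integrable circ (\<lambda>u. w (u - 0) * (f u)\<^sup>2 + w (u - s) * (f u)\<^sup>2 + w (u - 2 * s) * (f u)\<^sup>2)"
      using bd' by (intro Bochner_Integration.integrable_add; intro circ_integrable[of _ "B\<^sup>2"]) auto
    show "integrable circ (\<lambda>u. (f u)\<^sup>2)"
      using bdd by (intro circ_integrable[of _ "B\<^sup>2"] abs_power2_le) auto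
    show "w (u - 0) * (f u)\<^sup>2 + w (u - s) * (f u)\<^sup>2 + w (u - 2 * s) * (f u)\<^sup>2 \<le> (f u)\<^sup>2" for u
      using mult_right_mono[OF disj[of u], of "(f u)\<^sup>2"] by (simp add: algebra_simps)
  qed
  finally have "S 0 + S s + S (2 * s) \<le> (\<integral>u. (f u)\<^sup>2 \<partial>circ)" .
  \<comment> \<open>Inserting \<open>S r \<ge> 8/9 * S 0 - 8 * modulus r\<close> for both translates
    leaves \<open>25/9 * S 0\<close> on the left, whence 9/25; the errors \<open>8 * M\<close> and
    \<open>32 * M\<close> stay below \<open>64 * M\<close>.\<close>
  with comp[of s] comp[of "2 * s"] M1 M2 Mnn
  have "S 0 \<le> 9/25 * ((\<integral>u. (f u)\<^sup>2 \<partial>circ) + 64 * M)" by simp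
  then show ?thesis by (simp add: S_def M_def w_def mult.assoc)
qed

end

text \<open>The arcsine law is symmetric: moving the shift to the other factor replaces
  \<open>cos b\<close> by \<open>- cos b = cos (b + pi)\<close>, and a rotation of the angle removes
  the sign.\<close>

lemma cos_avg_adjoint:
  assumes "circle_function f B" "circle_function g C"
  shows "(\<integral>u. cos_avg a f u * g u \<partial>circ) = (\<integral>u. f u * cos_avg a g u \<partial>circ)"
proof -
  interpret f: circle_function f B by fact
  interpret g: circle_function g C by fact
  note [measurable] = f.meas g.meas
  have bd: "\<bar>f x * g y\<bar> \<le> B * C" for x y
    using f.bdd[of x] g.bdd[of y] by (auto simp: abs_mult intro!: mult_mono order_trans[OF _ f.bdd[of x]])
  have "(\<integral>u. cos_avg a f u * g u \<partial>circ) = (\<integral>u. \<integral>b. f (u + a * cos b) * g u \<partial>circ \<partial>circ)"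
    unfolding cos_avg_def by simp
  also have "\<dots> = (\<integral>b. \<integral>u. f (u + a * cos b) * g u \<partial>circ \<partial>circ)"
    using bd by (intro circ_pair_swap[of _ "B * C"]) auto
  also have "\<dots> = (\<integral>b. \<integral>u. f u * g (u - a * cos b) \<partial>circ \<partial>circ)"
  proof (rule Bochner_Integration.integral_cong[OF refl])
    fix b
    show "(\<integral>u. f (u + a * cos b) * g u \<partial>circ) = (\<integral>u. f u * g (u - a * cos b) \<partial>circ)"
      using integral_circ_shift[where f = "\<lambda>u. f u * g (u - a * cos b)" and a = "a * cos b"]
        f.per g.per[of "_ - a * cos b"] by (simp add: algebra_simps)
  qed
  also have "\<dots> = (\<integral>b. \<integral>u. f u * g (u + a * cos (b + pi)) \<partial>circ \<partial>circ)"
    by simp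
  also have "\<dots> = (\<integral>b. \<integral>u. f u * g (u + a * cos b) \<partial>circ \<partial>circ)"
    by (rule integral_circ_shift[where f = "\<lambda>b. \<integral>u. f u * g (u + a * cos b) \<partial>circ"]) auto
  also have "\<dots> = (\<integral>u. \<integral>b. f u * g (u + a * cos b) \<partial>circ \<partial>circ)"
    using bd by (intro circ_pair_swap[of _ "B * C"]) auto
  finally show ?thesis unfolding cos_avg_def by simp
qed

lemma (in circle_function) cos_avg_uminus: "cos_avg (- a) f u = cos_avg a f u"
proof -
  have "(\<integral>b. f (u + a * cos (b + pi)) \<partial>circ) = (\<integral>b. f (u + a * cos b) \<partial>circ)"
    by (rule integral_circ_shift[where f = "\<lambda>b. f (u + a * cos b)"]) auto
  then show ?thesis by (simp add: cos_avg_def)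
qed

text \<open>With \<open>A = cos_avg a\<close> self-adjoint,
  \<open>2 |A f|^2 = 2 <f, A^2 f> \<le> |f|^2 + |A^2 f|^2\<close>: the energies of the iterates form
  a convex sequence, so their decrements shrink. A defect measured after an average can thus be
  charged to the function before it.\<close>

lemma cos_defect_cos_avg_le:
  assumes "circle_function f B"
  shows "circle_function.cos_defect (cos_avg a f) a \<le> circle_function.cos_defect f a"
proof -
  interpret f: circle_function f B by fact
  interpret m: circle_function "cos_avg a f" B by (rule f.cos_avg_circle_function)
  interpret mm: circle_function "cos_avg a (cos_avg a f)" B by (rule m.cos_avg_circle_function)
  note [measurable] = f.meas m.meas mm.meas
  have i: "integrable circ (\<lambda>u. (f u)\<^sup>2)" "integrable circ (\<lambda>u. (cos_avg a (cos_avg a f) u)\<^sup>2)"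
    using f.bdd mm.bdd by (auto intro!: circ_integrable[of _ "B\<^sup>2"] abs_power2_le simp del: abs_power2)
  have "2 * (\<integral>u. (cos_avg a f u)\<^sup>2 \<partial>circ) = (\<integral>u. 2 * (f u * cos_avg a (cos_avg a f) u) \<partial>circ)"
    using cos_avg_adjoint[OF f.circle_function_axioms m.circle_function_axioms, of a]
    by (simp add: power2_eq_square)
  also have "\<dots> \<le> (\<integral>u. (f u)\<^sup>2 + (cos_avg a (cos_avg a f) u)\<^sup>2 \<partial>circ)"
  proof (rule integral_mono)
    have "\<bar>f u * cos_avg a (cos_avg a f) u\<bar> \<le> B * B" for u
      using f.bdd[of u] mm.bdd[of u] by (auto simp: abs_mult intro!: mult_mono order_trans[OF _ f.bdd[of u]])
    then show "integrable circ (\<lambda>u. 2 * (f u * cos_avg a (cos_avg a f) u))"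
      by (intro integrable_mult_right circ_integrable) auto
    show "2 * (f u * cos_avg a (cos_avg a f) u) \<le> (f u)\<^sup>2 + (cos_avg a (cos_avg a f) u)\<^sup>2" for u
      using sum_squares_bound[of "f u" "cos_avg a (cos_avg a f) u"] by (simp add: mult.assoc)
  qed (use i in auto)
  also have "\<dots> = (\<integral>u. (f u)\<^sup>2 \<partial>circ) + (\<integral>u. (cos_avg a (cos_avg a f) u)\<^sup>2 \<partial>circ)"
    using i by simp
  finally show ?thesis by (simp add: f.cos_defect_def m.cos_defect_def)
qed

section \<open>Random shears of the torus\<close>

lemma Cauchy_Schwarz_integral:
  fixes f g :: "'a \<Rightarrow> real"
  assumes [measurable]: "f \<in> borel_measurable M" "g \<in> borel_measurable M"
    and f: "integrable M (\<lambda>x. (f x)\<^sup>2)" and g: "integrable M (\<lambda>x. (g x)\<^sup>2)"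
  shows "integrable M (\<lambda>x. f x * g x)"
    and "(\<integral>x. f x * g x \<partial>M)\<^sup>2 \<le> (\<integral>x. (f x)\<^sup>2 \<partial>M) * (\<integral>x. (g x)\<^sup>2 \<partial>M)"
proof -
  show fg: "integrable M (\<lambda>x. f x * g x)"
  proof (rule Bochner_Integration.integrable_bound[of _ "\<lambda>x. (f x)\<^sup>2 + (g x)\<^sup>2"])
    show "AE x in M. norm (f x * g x) \<le> norm ((f x)\<^sup>2 + (g x)\<^sup>2)"
    proof (rule AE_I2)
      fix x
      have "2 * (\<bar>f x\<bar> * \<bar>g x\<bar>) \<le> (f x)\<^sup>2 + (g x)\<^sup>2"
        using sum_squares_bound[of "\<bar>f x\<bar>" "\<bar>g x\<bar>"] by simp
      then show "norm (f x * g x) \<le> norm ((f x)\<^sup>2 + (g x)\<^sup>2)"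
        using mult_nonneg_nonneg[OF abs_ge_zero[of "f x"] abs_ge_zero[of "g x"]]
        unfolding real_norm_def abs_mult by linarith
    qed
  qed (use f g in auto)
  define a b c where "a = (\<integral>x. (f x)\<^sup>2 \<partial>M)" and "b = (\<integral>x. (g x)\<^sup>2 \<partial>M)" and "c = (\<integral>x. f x * g x \<partial>M)"
  have "0 \<le> (\<integral>x. (a * g x - c * f x)\<^sup>2 \<partial>M)" by simp
  also have "\<dots> = (\<integral>x. a\<^sup>2 * (g x)\<^sup>2 - 2 * a * c * (f x * g x) + c\<^sup>2 * (f x)\<^sup>2 \<partial>M)"
    by (intro Bochner_Integration.integral_cong) (auto simp: power2_eq_square algebra_simps)
  also have "\<dots> = a\<^sup>2 * b - 2 * a * c * c + c\<^sup>2 * a"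
    using f g fg by (simp add: a_def b_def c_def)
  also have "\<dots> = a * (a * b - c\<^sup>2)" by (simp add: power2_eq_square algebra_simps)
  finally have *: "0 \<le> a * (a * b - c\<^sup>2)" .
  show "c\<^sup>2 \<le> a * b"
  proof (cases "a = 0")
    case True
    then have "AE x in M. (f x)\<^sup>2 = 0"
      unfolding a_def using integral_nonneg_eq_0_iff_AE[OF f] by simp
    then have "c = (\<integral>x. 0 \<partial>M)"
      unfolding c_def by (intro integral_cong_AE) auto
    with True show ?thesis by simp
  next
    case False
    then have "0 < a" unfolding a_def by (simp add: order_less_le)
    with * show ?thesis by (simp add: zero_le_mult_iff)
  qed
qed

lemma jensen_sq_circ:
  fixes f :: "real \<Rightarrow> real"
  assumes [measurable]: "f \<in> borel_measurable borel" and bd: "\<And>x. \<bar>f x\<bar> \<le> B"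
  shows "(\<integral>x. f x \<partial>circ)\<^sup>2 \<le> (\<integral>x. (f x)\<^sup>2 \<partial>circ)"
proof -
  have "integrable circ (\<lambda>x. (f x)\<^sup>2)"
    by (rule circ_integrable[OF _ abs_power2_le[OF bd]]) measurable
  from Cauchy_Schwarz_integral(2)[of f circ "\<lambda>_. 1", OF _ _ this]
  show ?thesis by (simp add: circ.prob_space[simplified])
qed

text \<open>
  \<open>sin (v / 2)\<close> is only \<open>4\<pi>\<close>-periodic; the absolute value descends to the circle and is
  harmless because the average \<open>cos_avg a\<close> is even in \<open>a\<close>.
\<close>

definition half_sin :: "real \<Rightarrow> real" where
  "half_sin v = \<bar>sin (v / 2)\<bar>"

lemma half_sin_periodic: "half_sin (v + 2*pi) = half_sin v"
  by (simp add: half_sin_def add_divide_distrib)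

lemma half_sin_measurable [measurable]: "half_sin \<in> borel_measurable borel"
  unfolding half_sin_def by measurable

lemma AE_half_sin_pos: "AE v in circ. 0 < half_sin v"
  using AE_circ AE_circ_neq[of 0]
proof eventually_elim
  case (elim v)
  then have "0 < sin (v / 2)" by (intro sin_gt_zero) auto
  then show ?case by (simp add: half_sin_def)
qed

text \<open>
  The threshold \<open>1/50\<close> makes the mass fractions found below for the far region and the two cones
  add up to \<open>2 (1/25) / (49/50)\<^sup>2 + 2 (9/25) < 1\<close>.
\<close>

definition far :: "real \<Rightarrow> real" where
  "far = indicator {v. 1/50 \<le> half_sin v}"

lemma far_measurable [measurable]: "far \<in> borel_measurable borel"
  unfolding far_def by measurable

lemma far_bounds: "0 \<le> far v" "far v \<le> 1" "\<bar>far v\<bar> \<le> 1" "(far v)\<^sup>2 = far v"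
  by (auto simp: far_def split: split_indicator)

text \<open>By Jordan's inequality \<open>half_sin v < 1/50\<close> confines \<open>v\<close> to
  within \<open>pi/50\<close> of 0 or \<open>2 * pi\<close>; these arcs make up the share
  \<open>(pi/25) / (2*pi)\<close> of the circle.\<close>

lemma integral_far_ge: "49/50 \<le> (\<integral>v. far v \<partial>circ)"
proof -
  have i: "integrable circ far" using far_bounds by (intro circ_integrable[of _ 1]) auto
  have "1 - (\<integral>v. far v \<partial>circ) = (\<integral>v. 1 - far v \<partial>circ)"
    using i by (simp add: circ.prob_space[simplified])
  also have "\<dots> = (\<integral>v. indicator {0..<2*pi} v * (1 - far v) \<partial>lborel) / (2*pi)"
    by (rule integral_circ) measurable
  also have "\<dots> \<le> (\<integral>v. indicator {0..pi/50} v + indicator {2*pi - pi/50..2*pi} v \<partial>lborel) / (2*pi)"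
  proof (intro divide_right_mono integral_mono)
    fix v :: real
    show "indicator {0..<2*pi} v * (1 - far v) \<le> indicator {0..pi/50} v + indicator {2*pi - pi/50..2*pi} v"
    proof (cases "v \<in> {0..<2*pi} \<and> half_sin v < 1/50")
      case True
      then have v: "0 \<le> v" "v < 2 * pi" "sin (v / 2) < 1/50" by (auto simp: half_sin_def)
      show ?thesis
      proof (cases "v \<le> pi")
        case True
        with v sin_half_ge[of v] have "v / pi \<le> 1/50" by linarith
        with v have "v \<in> {0..pi/50}" by (simp add: field_simps)
        then show ?thesis using far_bounds[of v] by (auto split: split_indicator)
      next
        case False
        have "sin ((2*pi - v) / 2) = sin (v / 2)"
          using sin_pi_minus[of "v/2"] by (simp add: diff_divide_distrib)
        with v False sin_half_ge[of "2*pi - v"] have "(2*pi - v) / pi \<le> 1/50" by linarith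
        with v have "v \<in> {2*pi - pi/50..2*pi}" by (simp add: field_simps)
        then show ?thesis using far_bounds[of v] by (auto split: split_indicator)
      qed
    qed (auto simp: far_def split: split_indicator)
  next
    show "integrable lborel (\<lambda>v. indicator {0..<2*pi} v * (1 - far v))"
      by (rule Bochner_Integration.integrable_bound[of _ "indicator {0..<2*pi} :: real \<Rightarrow> real"])
         (use far_bounds in \<open>auto split: split_indicator simp: abs_le_iff intro!: integrable_real_indicator\<close>)
  qed (auto intro!: Bochner_Integration.integrable_add integrable_real_indicator simp: emeasure_lborel_Icc_eq)
  also have "(\<integral>v. indicator {0..pi/50} v + indicator {2*pi - pi/50..2*pi} v \<partial>lborel) = pi/25"
    by (subst Bochner_Integration.integral_add)
       (auto intro!: integrable_real_indicator simp: emeasure_lborel_Icc_eq)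
  finally show ?thesis by simp
qed

text \<open>The part of the cone \<open>|u| \<le> |v|\<close> near the origin, with sizes measured
  by \<open>half_sin\<close>. Slices with \<open>half_sin v = 0\<close> are left out: the shear is
  trivial there, and the arc argument needs a positive width.\<close>

definition near_cone :: "real \<Rightarrow> real \<Rightarrow> real" where
  "near_cone u v = indicator {v. 0 < half_sin v \<and> half_sin v \<le> 1/50} v * indicator {u. half_sin u \<le> half_sin v} u"

lemma near_cone_measurable [measurable]: "(\<lambda>(u, v). near_cone u v) \<in> borel_measurable (borel \<Otimes>\<^sub>M borel)"
  unfolding near_cone_def indicator_def by measurable

lemma near_cone_bounds: "0 \<le> near_cone u v" "near_cone u v \<le> 1"
  by (auto simp: near_cone_def split: split_indicator)

locale torus_function =
  fixes h :: "real \<Rightarrow> real \<Rightarrow> real" and B :: real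
  assumes meas2: "(\<lambda>(u, v). h u v) \<in> borel_measurable (borel \<Otimes>\<^sub>M borel)"
    and per1: "h (u + 2*pi) v = h u v" and per2: "h u (v + 2*pi) = h u v"
    and bdd2: "\<bar>h u v\<bar> \<le> B"
begin

lemma swap: "torus_function (\<lambda>u v. h v u) B"
proof
  note [measurable] = meas2
  show "(\<lambda>(u, v). h v u) \<in> borel_measurable (borel \<Otimes>\<^sub>M borel)" by measurable
qed (auto simp: per1 per2 bdd2)

lemma slice: "circle_function (\<lambda>u. h u v) B"
proof
  note [measurable] = meas2
  show "(\<lambda>u. h u v) \<in> borel_measurable borel" by measurable
qed (auto simp: per1 bdd2)

end

definition energy :: "(real \<Rightarrow> real \<Rightarrow> real) \<Rightarrow> real" where
  "energy h = (\<integral>v. \<integral>u. (h u v)\<^sup>2 \<partial>circ \<partial>circ)"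

text \<open>Only the first argument moves, by an amplitude depending on the second. The shear in the
  other direction is this operator conjugated with the exchange of arguments, hence the recurring
  swapped functions.\<close>

definition shear_avg :: "real \<Rightarrow> (real \<Rightarrow> real \<Rightarrow> real) \<Rightarrow> real \<Rightarrow> real \<Rightarrow> real" where
  "shear_avg \<tau> h u v = cos_avg (2 * \<tau> * half_sin v) (\<lambda>u. h u v) u"

definition shear_defect :: "real \<Rightarrow> (real \<Rightarrow> real \<Rightarrow> real) \<Rightarrow> real" where
  "shear_defect \<tau> h = energy h - energy (shear_avg \<tau> h)"

context torus_function
begin

lemma sq_bdd: "\<bar>(h u v)\<^sup>2\<bar> \<le> B\<^sup>2" by (rule abs_power2_le[OF bdd2])

lemma diff_sq_bdd: "\<bar>(h u v - h u' v')\<^sup>2\<bar> \<le> (2*B)\<^sup>2"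
  using bdd2[of u v] bdd2[of u' v'] by (intro abs_power2_le) linarith

lemma energy_swap: "energy (\<lambda>u v. h v u) = energy h"
proof -
  note [measurable] = meas2
  show ?thesis unfolding energy_def using sq_bdd by (intro circ_pair_swap[of _ "B\<^sup>2"]) auto
qed

lemma shear_avg_torus_function: "torus_function (shear_avg \<tau> h) B"
proof
  note [measurable] = meas2
  show "(\<lambda>(u, v). shear_avg \<tau> h u v) \<in> borel_measurable (borel \<Otimes>\<^sub>M borel)"
    unfolding shear_avg_def cos_avg_def by measurable
  fix u v
  interpret s: circle_function "\<lambda>u. h u v" B by (rule slice)
  interpret m: circle_function "cos_avg (2 * \<tau> * half_sin v) (\<lambda>u. h u v)" B by (rule s.cos_avg_circle_function)
  show "shear_avg \<tau> h (u + 2*pi) v = shear_avg \<tau> h u v" "\<bar>shear_avg \<tau> h u v\<bar> \<le> B"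
    unfolding shear_avg_def by (rule m.per m.bdd)+
  show "shear_avg \<tau> h u (v + 2*pi) = shear_avg \<tau> h u v"
    unfolding shear_avg_def by (simp add: half_sin_periodic per2)
qed

lemma integrable_slice_energy: "integrable circ (\<lambda>v. \<integral>u. (h u v)\<^sup>2 \<partial>circ)"
proof -
  note [measurable] = meas2
  show ?thesis using sq_bdd by (intro circ_integrable[of _ "B\<^sup>2"] circ_integral_bounded) auto
qed

lemma shear_defect_eq:
  "shear_defect \<tau> h = (\<integral>v. circle_function.cos_defect (\<lambda>u. h u v) (2 * \<tau> * half_sin v) \<partial>circ)"
  and integrable_cos_defect:
  "integrable circ (\<lambda>v. circle_function.cos_defect (\<lambda>u. h u v) (2 * \<tau> * half_sin v))"
proof -
  interpret A: torus_function "shear_avg \<tau> h" B by (rule shear_avg_torus_function)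
  have eq: "circle_function.cos_defect (\<lambda>u. h u v) (2 * \<tau> * half_sin v)
     = (\<integral>u. (h u v)\<^sup>2 \<partial>circ) - (\<integral>u. (shear_avg \<tau> h u v)\<^sup>2 \<partial>circ)" for v
    unfolding circle_function.cos_defect_def[OF slice] shear_avg_def ..
  show "shear_defect \<tau> h = (\<integral>v. circle_function.cos_defect (\<lambda>u. h u v) (2 * \<tau> * half_sin v) \<partial>circ)"
    unfolding shear_defect_def energy_def eq
    by (rule Bochner_Integration.integral_diff[symmetric, OF integrable_slice_energy A.integrable_slice_energy])
  show "integrable circ (\<lambda>v. circle_function.cos_defect (\<lambda>u. h u v) (2 * \<tau> * half_sin v))"
    unfolding eq by (rule Bochner_Integration.integrable_diff[OF integrable_slice_energy A.integrable_slice_energy])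
qed

lemma shear_defect_nonneg: "0 \<le> shear_defect \<tau> h"
  unfolding shear_defect_eq
  by (intro integral_nonneg_AE AE_I2) (rule circle_function.cos_defect_nonneg[OF slice])

text \<open>On a far slice the amplitude \<open>2 * \<tau> * half_sin v\<close> is at least
  \<open>\<tau> / 25\<close>, so \<open>50 * pi \<le> \<tau> * real N\<close> says that
  \<open>N\<close> amplitudes go once around the circle.\<close>

lemma far_oscillation_le:
  assumes "0 < \<tau>" "50 * pi \<le> \<tau> * real N"
  shows "(\<integral>v. far v * (\<integral>u. \<integral>y. (h y v - h u v)\<^sup>2 \<partial>circ \<partial>circ) \<partial>circ)
    \<le> (real N)\<^sup>2 * 8 * pi * shear_defect \<tau> h"
proof -
  note [measurable] = meas2
  have bd: "\<bar>\<integral>u. \<integral>y. (h y v - h u v)\<^sup>2 \<partial>circ \<partial>circ\<bar> \<le> (2*B)\<^sup>2" for v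
    using diff_sq_bdd by (intro circ_integral_bounded) auto
  have "(\<integral>v. far v * (\<integral>u. \<integral>y. (h y v - h u v)\<^sup>2 \<partial>circ \<partial>circ) \<partial>circ)
    \<le> (\<integral>v. (real N)\<^sup>2 * 8 * pi * circle_function.cos_defect (\<lambda>u. h u v) (2 * \<tau> * half_sin v) \<partial>circ)"
  proof (rule integral_mono)
    have "\<bar>far v * (\<integral>u. \<integral>y. (h y v - h u v)\<^sup>2 \<partial>circ \<partial>circ)\<bar> \<le> 1 * (2*B)\<^sup>2" for v
      unfolding abs_mult using far_bounds bd[of v] by (intro mult_mono) auto
    then show "integrable circ (\<lambda>v. far v * (\<integral>u. \<integral>y. (h y v - h u v)\<^sup>2 \<partial>circ \<partial>circ))"
      by (intro circ_integrable[of _ "1 * (2*B)\<^sup>2"]) auto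
    show "integrable circ (\<lambda>v. (real N)\<^sup>2 * 8 * pi * circle_function.cos_defect (\<lambda>u. h u v) (2 * \<tau> * half_sin v))"
      by (intro integrable_mult_right integrable_cos_defect)
    fix v
    interpret s: circle_function "\<lambda>u. h u v" B by (rule slice)
    show "far v * (\<integral>u. \<integral>y. (h y v - h u v)\<^sup>2 \<partial>circ \<partial>circ)
      \<le> (real N)\<^sup>2 * 8 * pi * s.cos_defect (2 * \<tau> * half_sin v)"
    proof (cases "1/50 \<le> half_sin v")
      case True
      have "2 * pi \<le> 2 * (1/50) * (\<tau> * real N)" using assms by simp
      also have "\<dots> \<le> 2 * half_sin v * (\<tau> * real N)"
        using True assms by (intro mult_right_mono) auto
      finally have "(\<integral>u. \<integral>y. (h y v - h u v)\<^sup>2 \<partial>circ \<partial>circ) \<le> (real N)\<^sup>2 * (8 * pi * s.cos_defect (2 * \<tau> * half_sin v))"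
        using True assms by (intro s.oscillation_le_cos_defect) (auto simp: mult_ac)
      with True show ?thesis by (simp add: far_def mult.assoc)
    qed (auto simp: far_def s.cos_defect_nonneg)
  qed
  also have "\<dots> = (real N)\<^sup>2 * 8 * pi * shear_defect \<tau> h"
    unfolding shear_defect_eq by simp
  finally show ?thesis .
qed

lemma near_cone_sq_bdd: "\<bar>near_cone u v * (h u v)\<^sup>2\<bar> \<le> B\<^sup>2"
  using near_cone_bounds[of u v] sq_bdd[of u v] mult_mono[of "near_cone u v" 1 "(h u v)\<^sup>2" "B\<^sup>2"]
  by (simp add: abs_mult)

text \<open>At height \<open>v\<close> the arc and the shear amplitude are both proportional to
  \<open>half_sin v\<close>, so the requirement \<open>7 * \<sigma> \<le> a * real N\<close> loses
  its scale and one \<open>N\<close> serves every slice.\<close>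

lemma near_cone_energy_le:
  assumes "0 < \<tau>" "50 * pi \<le> \<tau> * real N"
  shows "(\<integral>v. \<integral>u. near_cone u v * (h u v)\<^sup>2 \<partial>circ \<partial>circ)
    \<le> 9/25 * (energy h + 64 * ((real N)\<^sup>2 * 8 * pi * shear_defect \<tau> h))"
proof -
  note [measurable] = meas2
  have "(\<integral>v. \<integral>u. near_cone u v * (h u v)\<^sup>2 \<partial>circ \<partial>circ)
    \<le> (\<integral>v. 9/25 * ((\<integral>u. (h u v)\<^sup>2 \<partial>circ) + (64 * (real N)\<^sup>2 * 8 * pi) * circle_function.cos_defect (\<lambda>u. h u v) (2 * \<tau> * half_sin v)) \<partial>circ)"
  proof (rule integral_mono)
    show "integrable circ (\<lambda>v. \<integral>u. near_cone u v * (h u v)\<^sup>2 \<partial>circ)"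
      using near_cone_sq_bdd by (intro circ_integrable[of _ "B\<^sup>2"] circ_integral_bounded) auto
    show "integrable circ (\<lambda>v. 9/25 * ((\<integral>u. (h u v)\<^sup>2 \<partial>circ) + (64 * (real N)\<^sup>2 * 8 * pi) * circle_function.cos_defect (\<lambda>u. h u v) (2 * \<tau> * half_sin v)))"
      by (intro integrable_mult_right Bochner_Integration.integrable_add integrable_slice_energy integrable_cos_defect)
    fix v
    interpret s: circle_function "\<lambda>u. h u v" B by (rule slice)
    show "(\<integral>u. near_cone u v * (h u v)\<^sup>2 \<partial>circ)
      \<le> 9/25 * ((\<integral>u. (h u v)\<^sup>2 \<partial>circ) + (64 * (real N)\<^sup>2 * 8 * pi) * s.cos_defect (2 * \<tau> * half_sin v))"
    proof (cases "0 < half_sin v \<and> half_sin v \<le> 1/50")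
      case True
      have "7 * half_sin v \<le> (2 * (50 * 3)) * half_sin v" using True by simp
      also have "\<dots> \<le> (2 * (\<tau> * real N)) * half_sin v"
        using assms(2) pi_gt3 True by (intro mult_right_mono) auto
      finally have "7 * half_sin v \<le> 2 * \<tau> * half_sin v * real N" by (simp add: mult_ac)
      with True assms s.small_arc_le_cos_defect[of "half_sin v" "2 * \<tau> * half_sin v" N]
      show ?thesis by (simp add: near_cone_def half_sin_def mult.assoc)
    next
      case False
      then show ?thesis using s.cos_defect_nonneg by (simp add: near_cone_def)
    qed
  qed
  also have "\<dots> = 9/25 * (energy h + (64 * (real N)\<^sup>2 * 8 * pi) * shear_defect \<tau> h)"
    unfolding energy_def shear_defect_eq using integrable_slice_energy integrable_cos_defect
    by (subst integral_mult_right_zero, subst Bochner_Integration.integral_add) auto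
  finally show ?thesis by (simp add: mult.assoc)
qed

end

section \<open>The spectral gap\<close>

context torus_function
begin

text \<open>\<open>h u v\<close> is compared with the means \<open>m y\<close> over the lines with
  far first coordinate \<open>y\<close>. Going from \<open>(u, v)\<close> to \<open>(y, v)\<close>
  and then along the line over \<open>y\<close> costs one oscillation per leg, and only the second
  leg needs \<open>y\<close> to be far. What remains, the integral of \<open>m\<close> over far
  \<open>y\<close>, is small because \<open>m\<close> has mean 0.\<close>

lemma pointwise_far_bound:
  assumes mean: "(\<integral>v. \<integral>u. h u v \<partial>circ \<partial>circ) = 0"
  defines "p \<equiv> \<integral>u. far u \<partial>circ"
  shows "p\<^sup>2 * (h u v)\<^sup>2 \<le> 4 * (\<integral>y. (h y v - h u v)\<^sup>2 \<partial>circ)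
    + 4 * (\<integral>y. far y * (\<integral>x. (h y v - h y x)\<^sup>2 \<partial>circ) \<partial>circ) + 2 * (1 - p) * energy h"
proof -
  note [measurable] = meas2
  have farmul: "\<bar>far y * r\<bar> \<le> K" if "\<bar>r\<bar> \<le> K" for y r K
    using far_bounds[of y] mult_mono[of "far y" 1 "\<bar>r\<bar>" K] that by (simp add: abs_mult)
  define m where "m y = (\<integral>x. h y x \<partial>circ)" for y
  have [measurable]: "m \<in> borel_measurable borel" unfolding m_def by measurable
  have mbd: "\<bar>m y\<bar> \<le> B" for y unfolding m_def using bdd2 by (intro circ_integral_bounded) auto
  have im: "integrable circ m" using mbd by (intro circ_integrable) auto
  have ifm: "integrable circ (\<lambda>y. far y * m y)" using farmul[OF mbd] by (intro circ_integrable) auto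
  have ifar: "integrable circ far" using far_bounds by (intro circ_integrable[of _ 1]) auto
  have m0: "(\<integral>y. m y \<partial>circ) = 0"
    unfolding m_def using mean circ_pair_swap[of h B] bdd2 by simp
  have msq: "(\<integral>y. (m y)\<^sup>2 \<partial>circ) \<le> energy h"
  proof -
    have "(\<integral>y. (m y)\<^sup>2 \<partial>circ) \<le> (\<integral>y. \<integral>x. (h y x)\<^sup>2 \<partial>circ \<partial>circ)"
    proof (rule integral_mono)
      show "integrable circ (\<lambda>y. (m y)\<^sup>2)" by (rule circ_integrable[OF _ abs_power2_le[OF mbd]]) measurable
      show "integrable circ (\<lambda>y. \<integral>x. (h y x)\<^sup>2 \<partial>circ)"
        using sq_bdd by (intro circ_integrable[of _ "B\<^sup>2"] circ_integral_bounded) auto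
      show "(m y)\<^sup>2 \<le> (\<integral>x. (h y x)\<^sup>2 \<partial>circ)" for y
        unfolding m_def by (rule jensen_sq_circ[OF _ bdd2]) measurable
    qed
    also have "\<dots> = energy h" using energy_swap by (simp add: energy_def)
    finally show ?thesis .
  qed
  define G where "G = (\<integral>y. far y * (\<integral>x. (h u v - h y x)\<^sup>2 \<partial>circ) \<partial>circ)"
  have i1: "integrable circ (\<lambda>x. h y x)" for y using bdd2 by (intro circ_integrable) auto
  have kb: "\<bar>h u v - m y\<bar> \<le> 2 * B" for y using bdd2[of u v] mbd[of y] by linarith
  have Gb: "\<bar>\<integral>x. (h u v - h y x)\<^sup>2 \<partial>circ\<bar> \<le> (2*B)\<^sup>2" for y
    using diff_sq_bdd by (intro circ_integral_bounded) auto
  have X: "(\<integral>y. far y * (h u v - m y) \<partial>circ)\<^sup>2 \<le> G"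
  proof -
    have "(\<integral>y. far y * (h u v - m y) \<partial>circ)\<^sup>2 \<le> (\<integral>y. (far y * (h u v - m y))\<^sup>2 \<partial>circ)"
      by (rule jensen_sq_circ[OF _ farmul[OF kb]]) measurable
    also have "\<dots> \<le> G"
      unfolding G_def
    proof (rule integral_mono)
      show "integrable circ (\<lambda>y. (far y * (h u v - m y))\<^sup>2)"
        by (rule circ_integrable[OF _ abs_power2_le[OF farmul[OF kb]]]) measurable
      show "integrable circ (\<lambda>y. far y * (\<integral>x. (h u v - h y x)\<^sup>2 \<partial>circ))"
        by (rule circ_integrable[OF _ farmul[OF Gb]]) measurable
      fix y
      have "(h u v - m y)\<^sup>2 = (\<integral>x. h u v - h y x \<partial>circ)\<^sup>2"
        unfolding m_def using i1 by (simp add: circ.prob_space[simplified])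
      also have "\<dots> \<le> (\<integral>x. (h u v - h y x)\<^sup>2 \<partial>circ)"
      proof (rule jensen_sq_circ)
        show "\<bar>h u v - h y x\<bar> \<le> 2 * B" for x using bdd2[of u v] bdd2[of y x] by linarith
      qed measurable
      finally show "(far y * (h u v - m y))\<^sup>2 \<le> far y * (\<integral>x. (h u v - h y x)\<^sup>2 \<partial>circ)"
        using far_bounds[of y] by (simp add: power_mult_distrib mult_left_mono)
    qed
    finally show ?thesis .
  qed
  \<comment> \<open>Mean zero turns the integral over far \<open>y\<close> into minus the one over
    the small complement, where Cauchy-Schwarz gains the factor \<open>1 - p\<close>.\<close>
  have Y: "(\<integral>y. far y * m y \<partial>circ)\<^sup>2 \<le> (1 - p) * energy h"
  proof -
    have fb: "\<bar>1 - far y\<bar> \<le> 1" for y using far_bounds[of y] by auto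
    have "(\<integral>y. far y * m y \<partial>circ) = - (\<integral>y. (1 - far y) * m y \<partial>circ)"
      using im ifm m0 by (simp add: left_diff_distrib)
    then have "(\<integral>y. far y * m y \<partial>circ)\<^sup>2 = (\<integral>y. (1 - far y) * m y \<partial>circ)\<^sup>2" by simp
    also have "\<dots> \<le> (\<integral>y. (1 - far y)\<^sup>2 \<partial>circ) * (\<integral>y. (m y)\<^sup>2 \<partial>circ)"
      by (intro Cauchy_Schwarz_integral(2) circ_integrable[OF _ abs_power2_le[OF mbd]] circ_integrable[OF _ abs_power2_le[OF fb]]) measurable
    also have "(\<integral>y. (1 - far y)\<^sup>2 \<partial>circ) = (\<integral>y. 1 - far y \<partial>circ)"
      by (intro Bochner_Integration.integral_cong) (auto simp: far_def split: split_indicator)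
    also have "\<dots> = 1 - p" using ifar by (simp add: p_def circ.prob_space[simplified])
    also have "(1 - p) * (\<integral>y. (m y)\<^sup>2 \<partial>circ) \<le> (1 - p) * energy h"
    proof (intro mult_left_mono msq)
      have "p \<le> (\<integral>y. 1 \<partial>circ)" unfolding p_def using ifar far_bounds by (intro integral_mono) auto
      then show "0 \<le> 1 - p" by (simp add: circ.prob_space[simplified])
    qed
    finally show ?thesis .
  qed
  have "p * h u v = (\<integral>y. far y * (h u v - m y) \<partial>circ) + (\<integral>y. far y * m y \<partial>circ)"
    using ifm ifar by (simp add: right_diff_distrib p_def)
  then have "p\<^sup>2 * (h u v)\<^sup>2 = ((\<integral>y. far y * (h u v - m y) \<partial>circ) + (\<integral>y. far y * m y \<partial>circ))\<^sup>2"
    by (simp flip: power_mult_distrib)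
  also have "\<dots> \<le> 2 * G + 2 * ((1 - p) * energy h)"
    using sq_add_le[of "\<integral>y. far y * (h u v - m y) \<partial>circ" "\<integral>y. far y * m y \<partial>circ"] X Y by linarith
  finally have main: "p\<^sup>2 * (h u v)\<^sup>2 \<le> 2 * G + 2 * ((1 - p) * energy h)" .
  have Rb: "\<bar>\<integral>x. (h y v - h y x)\<^sup>2 \<partial>circ\<bar> \<le> (2*B)\<^sup>2" for y
    using diff_sq_bdd by (intro circ_integral_bounded) auto
  \<comment> \<open>The corner \<open>(y, v)\<close> splits the displacement into one leg along each
    coordinate.\<close>
  have "G \<le> (\<integral>y. 2 * (h y v - h u v)\<^sup>2 + 2 * (far y * (\<integral>x. (h y v - h y x)\<^sup>2 \<partial>circ)) \<partial>circ)"
    unfolding G_def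
  proof (rule integral_mono)
    show "integrable circ (\<lambda>y. far y * (\<integral>x. (h u v - h y x)\<^sup>2 \<partial>circ))"
      by (rule circ_integrable[OF _ farmul[OF Gb]]) measurable
    show "integrable circ (\<lambda>y. 2 * (h y v - h u v)\<^sup>2 + 2 * (far y * (\<integral>x. (h y v - h y x)\<^sup>2 \<partial>circ)))"
      by (intro Bochner_Integration.integrable_add integrable_mult_right circ_integrable[OF _ diff_sq_bdd] circ_integrable[OF _ farmul[OF Rb]]) measurable
    fix y
    have "(\<integral>x. (h u v - h y x)\<^sup>2 \<partial>circ) \<le> (\<integral>x. 2 * (h y v - h u v)\<^sup>2 + 2 * (h y v - h y x)\<^sup>2 \<partial>circ)"
    proof (rule integral_mono)
      show "integrable circ (\<lambda>x. (h u v - h y x)\<^sup>2)"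
        by (rule circ_integrable[OF _ diff_sq_bdd]) measurable
      show "integrable circ (\<lambda>x. 2 * (h y v - h u v)\<^sup>2 + 2 * (h y v - h y x)\<^sup>2)"
        by (intro Bochner_Integration.integrable_add integrable_mult_right circ_integrable[OF _ diff_sq_bdd]) measurable
      show "(h u v - h y x)\<^sup>2 \<le> 2 * (h y v - h u v)\<^sup>2 + 2 * (h y v - h y x)\<^sup>2" for x
        using sq_add_le[of "h u v - h y v" "h y v - h y x"] power2_commute[of "h u v" "h y v"] by simp
    qed
    also have "\<dots> = 2 * (h y v - h u v)\<^sup>2 + 2 * (\<integral>x. (h y v - h y x)\<^sup>2 \<partial>circ)"
    proof -
      have "integrable circ (\<lambda>x. (h y v - h y x)\<^sup>2)"
        by (rule circ_integrable[OF _ diff_sq_bdd]) measurable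
      then show ?thesis by (simp add: circ.prob_space[simplified])
    qed
    finally have *: "(\<integral>x. (h u v - h y x)\<^sup>2 \<partial>circ) \<le> 2 * (h y v - h u v)\<^sup>2 + 2 * (\<integral>x. (h y v - h y x)\<^sup>2 \<partial>circ)" .
    then show "far y * (\<integral>x. (h u v - h y x)\<^sup>2 \<partial>circ)
      \<le> 2 * (h y v - h u v)\<^sup>2 + 2 * (far y * (\<integral>x. (h y v - h y x)\<^sup>2 \<partial>circ))"
      by (auto simp: far_def split: split_indicator)
  qed
  also have "\<dots> = 2 * (\<integral>y. (h y v - h u v)\<^sup>2 \<partial>circ) + 2 * (\<integral>y. far y * (\<integral>x. (h y v - h y x)\<^sup>2 \<partial>circ) \<partial>circ)"
  proof -
    have "integrable circ (\<lambda>y. (h y v - h u v)\<^sup>2)"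
      by (rule circ_integrable[OF _ diff_sq_bdd]) measurable
    moreover have "integrable circ (\<lambda>y. far y * (\<integral>x. (h y v - h y x)\<^sup>2 \<partial>circ))"
      by (rule circ_integrable[OF _ farmul[OF Rb]]) measurable
    ultimately show ?thesis by simp
  qed
  finally show ?thesis using main by (simp add: algebra_simps)
qed

text \<open>The pointwise bound is integrated over \<open>u\<close> and over far \<open>v\<close>.
  Now the first leg runs along a far slice as well, and each leg is paid for by the defect of its
  own shear. The last term comes from \<open>2 * (1 - 49/50) = 1/25\<close>.\<close>

lemma far_energy_le:
  assumes mean: "(\<integral>v. \<integral>u. h u v \<partial>circ \<partial>circ) = 0"
    and \<tau>: "0 < \<tau>" "50 * pi \<le> \<tau> * real N"
  defines "K \<equiv> (real N)\<^sup>2 * 8 * pi"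
  shows "(49/50)\<^sup>2 * (\<integral>v. far v * (\<integral>u. (h u v)\<^sup>2 \<partial>circ) \<partial>circ)
    \<le> 4 * K * (shear_defect \<tau> h + shear_defect \<tau> (\<lambda>u v. h v u)) + 1/25 * energy h"
proof -
  note [measurable] = meas2
  interpret sw: torus_function "\<lambda>u v. h v u" B by (rule swap)
  have farmul: "\<bar>far y * r\<bar> \<le> C" if "\<bar>r\<bar> \<le> C" for y r C
    using far_bounds[of y] mult_mono[of "far y" 1 "\<bar>r\<bar>" C] that by (simp add: abs_mult)
  define p where "p = (\<integral>u. far u \<partial>circ)"
  define R where "R v = (\<integral>y. far y * (\<integral>x. (h y v - h y x)\<^sup>2 \<partial>circ) \<partial>circ)" for v
  have [measurable]: "R \<in> borel_measurable borel" unfolding R_def by measurable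
  have p49: "49/50 \<le> p" unfolding p_def by (rule integral_far_ge)
  have E0: "0 \<le> energy h" unfolding energy_def by (intro integral_nonneg_AE AE_I2) auto
  have bd1: "\<bar>\<integral>x. (h y v - h y x)\<^sup>2 \<partial>circ\<bar> \<le> (2*B)\<^sup>2" for y v
    by (rule circ_integral_bounded[OF _ diff_sq_bdd]) measurable
  have Rbd: "\<bar>R v\<bar> \<le> (2*B)\<^sup>2" for v
    unfolding R_def by (rule circ_integral_bounded[OF _ farmul[OF bd1]]) measurable
  have Rnn: "0 \<le> R v" for v
    unfolding R_def using far_bounds by (intro integral_nonneg_AE AE_I2 mult_nonneg_nonneg) auto
  have bd2: "\<bar>\<integral>u. \<integral>y. (h y v - h u v)\<^sup>2 \<partial>circ \<partial>circ\<bar> \<le> (2*B)\<^sup>2" for v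
    by (rule circ_integral_bounded[OF _ circ_integral_bounded[OF _ diff_sq_bdd]]) measurable
  have bdE: "\<bar>\<integral>u. (h u v)\<^sup>2 \<partial>circ\<bar> \<le> B\<^sup>2" for v
    by (rule circ_integral_bounded[OF _ sq_bdd]) measurable
  have slice_le: "p\<^sup>2 * (\<integral>u. (h u v)\<^sup>2 \<partial>circ)
     \<le> 4 * (\<integral>u. \<integral>y. (h y v - h u v)\<^sup>2 \<partial>circ \<partial>circ) + 4 * R v + 2 * (1 - p) * energy h" for v
  proof -
    have "(\<integral>u. p\<^sup>2 * (h u v)\<^sup>2 \<partial>circ) \<le> (\<integral>u. 4 * (\<integral>y. (h y v - h u v)\<^sup>2 \<partial>circ) + (4 * R v + 2 * (1 - p) * energy h) \<partial>circ)"
    proof (rule integral_mono)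
      show "integrable circ (\<lambda>u. p\<^sup>2 * (h u v)\<^sup>2)"
        by (rule integrable_mult_right, rule circ_integrable[OF _ sq_bdd]) measurable
      show "integrable circ (\<lambda>u. 4 * (\<integral>y. (h y v - h u v)\<^sup>2 \<partial>circ) + (4 * R v + 2 * (1 - p) * energy h))"
        by (intro Bochner_Integration.integrable_add integrable_mult_right circ_integrable[OF _ circ_integral_bounded[OF _ diff_sq_bdd]] circ.integrable_const) measurable
      show "p\<^sup>2 * (h u v)\<^sup>2 \<le> 4 * (\<integral>y. (h y v - h u v)\<^sup>2 \<partial>circ) + (4 * R v + 2 * (1 - p) * energy h)" for u
        using pointwise_far_bound[OF mean, of u v] by (simp add: p_def R_def)
    qed
    also have "\<dots> = 4 * (\<integral>u. \<integral>y. (h y v - h u v)\<^sup>2 \<partial>circ \<partial>circ) + (4 * R v + 2 * (1 - p) * energy h)"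
    proof -
      have "integrable circ (\<lambda>u. \<integral>y. (h y v - h u v)\<^sup>2 \<partial>circ)"
        by (rule circ_integrable[OF _ circ_integral_bounded[OF _ diff_sq_bdd]]) measurable
      then show ?thesis by (simp add: circ.prob_space[simplified])
    qed
    finally show ?thesis by simp
  qed
  have iF: "integrable circ (\<lambda>v. far v * (\<integral>u. (h u v)\<^sup>2 \<partial>circ))"
    by (rule circ_integrable[OF _ farmul[OF bdE]]) measurable
  have iO: "integrable circ (\<lambda>v. far v * (\<integral>u. \<integral>y. (h y v - h u v)\<^sup>2 \<partial>circ \<partial>circ))"
    by (rule circ_integrable[OF _ farmul[OF bd2]]) measurable
  have iR: "integrable circ R" by (rule circ_integrable[OF _ Rbd]) measurable
  have "p\<^sup>2 * (\<integral>v. far v * (\<integral>u. (h u v)\<^sup>2 \<partial>circ) \<partial>circ) = (\<integral>v. p\<^sup>2 * (far v * (\<integral>u. (h u v)\<^sup>2 \<partial>circ)) \<partial>circ)"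
    by simp
  also have "\<dots> \<le> (\<integral>v. 4 * (far v * (\<integral>u. \<integral>y. (h y v - h u v)\<^sup>2 \<partial>circ \<partial>circ)) + 4 * R v + 1/25 * energy h \<partial>circ)"
  proof (rule integral_mono)
    show "integrable circ (\<lambda>v. p\<^sup>2 * (far v * (\<integral>u. (h u v)\<^sup>2 \<partial>circ)))"
      by (intro integrable_mult_right iF)
    show "integrable circ (\<lambda>v. 4 * (far v * (\<integral>u. \<integral>y. (h y v - h u v)\<^sup>2 \<partial>circ \<partial>circ)) + 4 * R v + 1/25 * energy h)"
      by (intro Bochner_Integration.integrable_add integrable_mult_right iO iR circ.integrable_const)
    fix v
    have "2 * (1 - p) * energy h \<le> 1/25 * energy h"
      using p49 E0 by (intro mult_right_mono) auto
    with slice_le[of v] Rnn[of v] E0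
    show "p\<^sup>2 * (far v * (\<integral>u. (h u v)\<^sup>2 \<partial>circ)) \<le> 4 * (far v * (\<integral>u. \<integral>y. (h y v - h u v)\<^sup>2 \<partial>circ \<partial>circ)) + 4 * R v + 1/25 * energy h"
      by (auto simp: far_def split: split_indicator)
  qed
  also have "\<dots> = 4 * (\<integral>v. far v * (\<integral>u. \<integral>y. (h y v - h u v)\<^sup>2 \<partial>circ \<partial>circ) \<partial>circ) + 4 * (\<integral>v. R v \<partial>circ) + 1/25 * energy h"
    using iO iR by (simp add: circ.prob_space[simplified])
  \<comment> \<open>Exchanging the integrals exhibits this as the far oscillation of the swapped
    function, with \<open>y\<close> labelling the far lines.\<close>
  also have "(\<integral>v. R v \<partial>circ) = (\<integral>y. \<integral>v. far y * (\<integral>x. (h y v - h y x)\<^sup>2 \<partial>circ) \<partial>circ \<partial>circ)"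
    unfolding R_def by (rule circ_pair_swap[OF _ farmul[OF bd1]]) measurable
  also have "\<dots> = (\<integral>y. far y * (\<integral>x. \<integral>v. (h y v - h y x)\<^sup>2 \<partial>circ \<partial>circ) \<partial>circ)"
  proof (rule Bochner_Integration.integral_cong[OF refl])
    fix y
    have "(\<integral>v. \<integral>x. (h y v - h y x)\<^sup>2 \<partial>circ \<partial>circ) = (\<integral>x. \<integral>v. (h y v - h y x)\<^sup>2 \<partial>circ \<partial>circ)"
      by (rule circ_pair_swap[OF _ diff_sq_bdd]) measurable
    then show "(\<integral>v. far y * (\<integral>x. (h y v - h y x)\<^sup>2 \<partial>circ) \<partial>circ) = far y * (\<integral>x. \<integral>v. (h y v - h y x)\<^sup>2 \<partial>circ \<partial>circ)"
      by simp
  qed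
  also have "\<dots> \<le> K * shear_defect \<tau> (\<lambda>u v. h v u)"
    unfolding K_def by (rule sw.far_oscillation_le[OF \<tau>])
  also have "(\<integral>v. far v * (\<integral>u. \<integral>y. (h y v - h u v)\<^sup>2 \<partial>circ \<partial>circ) \<partial>circ) \<le> K * shear_defect \<tau> h"
    unfolding K_def by (rule far_oscillation_le[OF \<tau>])
  finally have *: "p\<^sup>2 * (\<integral>v. far v * (\<integral>u. (h u v)\<^sup>2 \<partial>circ) \<partial>circ)
    \<le> 4 * (K * shear_defect \<tau> h) + 4 * (K * shear_defect \<tau> (\<lambda>u v. h v u)) + 1/25 * energy h" by simp
  have "(49/50)\<^sup>2 * (\<integral>v. far v * (\<integral>u. (h u v)\<^sup>2 \<partial>circ) \<partial>circ) \<le> p\<^sup>2 * (\<integral>v. far v * (\<integral>u. (h u v)\<^sup>2 \<partial>circ) \<partial>circ)"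
    using p49 far_bounds by (intro mult_right_mono power_mono integral_nonneg_AE AE_I2 mult_nonneg_nonneg) auto
  with * show ?thesis by (simp add: algebra_simps)
qed

end

text \<open>
  The uncertainty principle behind the spectral gap. Where one coordinate is away from \<open>0\<close>, near
  invariance under both shears makes \<open>h\<close> nearly constant, hence small because its mean vanishes;
  near the origin \<open>h\<^sup>2\<close> would have to be a measure that both shears nearly preserve, which
  the two cones \<open>|u| \<le> |v|\<close> and \<open>|v| \<le> |u|\<close> exclude.
\<close>

lemma energy_le_shear_defects:
  assumes "torus_function h B" and mean: "(\<integral>v. \<integral>u. h u v \<partial>circ \<partial>circ) = 0"
    and \<tau>: "0 < \<tau>" "50 * pi \<le> \<tau> * real N"
  defines "K \<equiv> (real N)\<^sup>2 * 8 * pi"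
  shows "energy h \<le> 200 * K * (shear_defect \<tau> h + shear_defect \<tau> (\<lambda>u v. h v u))"
proof -
  interpret torus_function h B by fact
  interpret sw: torus_function "\<lambda>u v. h v u" B by (rule swap)
  note [measurable] = meas2
  define d where "d = shear_defect \<tau> h + shear_defect \<tau> (\<lambda>u v. h v u)"
  have farmul: "\<bar>far y * r\<bar> \<le> C" if "\<bar>r\<bar> \<le> C" for y r C
    using far_bounds[of y] mult_mono[of "far y" 1 "\<bar>r\<bar>" C] that by (simp add: abs_mult)
  have smean: "(\<integral>v. \<integral>u. h v u \<partial>circ \<partial>circ) = 0"
    using mean circ_pair_swap[of h B, OF meas2 bdd2] by simp
  have int1: "integrable circ (\<lambda>u. F u v)" if [measurable]: "(\<lambda>(u,v). F u v) \<in> borel_measurable (borel \<Otimes>\<^sub>M borel)" and "\<And>u v. \<bar>F u v\<bar> \<le> B\<^sup>2"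
    for F :: "real \<Rightarrow> real \<Rightarrow> real" and v
    by (rule circ_integrable[OF _ that(2)]) measurable
  have int2: "integrable circ (\<lambda>v. \<integral>u. F u v \<partial>circ)" if [measurable]: "(\<lambda>(u,v). F u v) \<in> borel_measurable (borel \<Otimes>\<^sub>M borel)" and "\<And>u v. \<bar>F u v\<bar> \<le> B\<^sup>2"
    for F :: "real \<Rightarrow> real \<Rightarrow> real"
    by (rule circ_integrable[OF _ circ_integral_bounded[OF _ that(2)]]) measurable
  define F1 F2 F3 F4 where "F1 u v = far v * (h u v)\<^sup>2" and "F2 u v = far u * (h u v)\<^sup>2"
    and "F3 u v = near_cone u v * (h u v)\<^sup>2" and "F4 u v = near_cone v u * (h u v)\<^sup>2" for u v
  have M [measurable]: "(\<lambda>(u,v). F1 u v) \<in> borel_measurable (borel \<Otimes>\<^sub>M borel)" "(\<lambda>(u,v). F2 u v) \<in> borel_measurable (borel \<Otimes>\<^sub>M borel)"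
    "(\<lambda>(u,v). F3 u v) \<in> borel_measurable (borel \<Otimes>\<^sub>M borel)" "(\<lambda>(u,v). F4 u v) \<in> borel_measurable (borel \<Otimes>\<^sub>M borel)"
    unfolding F1_def F2_def F3_def F4_def by measurable
  have Bd: "\<bar>F1 u v\<bar> \<le> B\<^sup>2" "\<bar>F2 u v\<bar> \<le> B\<^sup>2" "\<bar>F3 u v\<bar> \<le> B\<^sup>2" "\<bar>F4 u v\<bar> \<le> B\<^sup>2" for u v
    unfolding F1_def F2_def F3_def F4_def
    using farmul[OF sq_bdd] near_cone_sq_bdd sw.near_cone_sq_bdd by auto
  note i1 = int1[OF M(1) Bd(1)] int1[OF M(2) Bd(2)] int1[OF M(3) Bd(3)] int1[OF M(4) Bd(4)]
  note i2 = int2[OF M(1) Bd(1)] int2[OF M(2) Bd(2)] int2[OF M(3) Bd(3)] int2[OF M(4) Bd(4)]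
  have "energy h \<le> (\<integral>v. (\<integral>u. F1 u v \<partial>circ) + (\<integral>u. F2 u v \<partial>circ) + (\<integral>u. F3 u v \<partial>circ) + (\<integral>u. F4 u v \<partial>circ) \<partial>circ)"
    unfolding energy_def
  proof (rule integral_mono_AE)
    show "integrable circ (\<lambda>v. \<integral>u. (h u v)\<^sup>2 \<partial>circ)" by (rule integrable_slice_energy)
    show "integrable circ (\<lambda>v. (\<integral>u. F1 u v \<partial>circ) + (\<integral>u. F2 u v \<partial>circ) + (\<integral>u. F3 u v \<partial>circ) + (\<integral>u. F4 u v \<partial>circ))"
      by (intro Bochner_Integration.integrable_add i2)
    show "AE v in circ. (\<integral>u. (h u v)\<^sup>2 \<partial>circ) \<le> (\<integral>u. F1 u v \<partial>circ) + (\<integral>u. F2 u v \<partial>circ) + (\<integral>u. F3 u v \<partial>circ) + (\<integral>u. F4 u v \<partial>circ)"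
      using AE_half_sin_pos
    proof eventually_elim
      case (elim v)
      have "(\<integral>u. (h u v)\<^sup>2 \<partial>circ) \<le> (\<integral>u. F1 u v + F2 u v + F3 u v + F4 u v \<partial>circ)"
      proof (rule integral_mono)
        show "integrable circ (\<lambda>u. (h u v)\<^sup>2)" by (rule circ_integrable[OF _ sq_bdd]) measurable
        show "integrable circ (\<lambda>u. F1 u v + F2 u v + F3 u v + F4 u v)"
          by (intro Bochner_Integration.integrable_add i1)
        fix u
        \<comment> \<open>Off the far regions the larger of \<open>half_sin u\<close> and
          \<open>half_sin v\<close> decides which cone contains the point; it is positive because
          \<open>half_sin v\<close> is.\<close>
        have "1 \<le> far v + far u + near_cone u v + near_cone v u"
        proof (cases "half_sin u \<le> half_sin v")
          case True
          with elim show ?thesis using far_bounds[of u] near_cone_bounds[of v u]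
            by (auto simp: far_def near_cone_def split: split_indicator)
        next
          case False
          with elim show ?thesis using far_bounds[of v] near_cone_bounds[of u v]
            by (auto simp: far_def near_cone_def split: split_indicator)
        qed
        from mult_right_mono[OF this, of "(h u v)\<^sup>2"]
        show "(h u v)\<^sup>2 \<le> F1 u v + F2 u v + F3 u v + F4 u v"
          by (simp add: F1_def F2_def F3_def F4_def algebra_simps)
      qed
      also have "\<dots> = (\<integral>u. F1 u v \<partial>circ) + (\<integral>u. F2 u v \<partial>circ) + (\<integral>u. F3 u v \<partial>circ) + (\<integral>u. F4 u v \<partial>circ)"
        using i1 by simp
      finally show ?case .
    qed
  qed
  also have "\<dots> = (\<integral>v. \<integral>u. F1 u v \<partial>circ \<partial>circ) + (\<integral>v. \<integral>u. F2 u v \<partial>circ \<partial>circ)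
      + (\<integral>v. \<integral>u. F3 u v \<partial>circ \<partial>circ) + (\<integral>v. \<integral>u. F4 u v \<partial>circ \<partial>circ)"
    using i2 by simp
  also have "(\<integral>v. \<integral>u. F2 u v \<partial>circ \<partial>circ) = (\<integral>v. \<integral>u. F2 v u \<partial>circ \<partial>circ)"
    by (rule circ_pair_swap[OF _ Bd(2)]) measurable
  also have "(\<integral>v. \<integral>u. F4 u v \<partial>circ \<partial>circ) = (\<integral>v. \<integral>u. F4 v u \<partial>circ \<partial>circ)"
    by (rule circ_pair_swap[OF _ Bd(4)]) measurable
  finally have "energy h \<le> (\<integral>v. \<integral>u. F1 u v \<partial>circ \<partial>circ) + (\<integral>v. \<integral>u. F2 v u \<partial>circ \<partial>circ)
      + (\<integral>v. \<integral>u. F3 u v \<partial>circ \<partial>circ) + (\<integral>v. \<integral>u. F4 v u \<partial>circ \<partial>circ)" .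
  moreover have "(49/50)\<^sup>2 * (\<integral>v. \<integral>u. F1 u v \<partial>circ \<partial>circ) \<le> 4 * (K * d) + 1/25 * energy h"
    using far_energy_le[OF mean \<tau>] by (simp add: F1_def K_def d_def mult.assoc)
  moreover have "(49/50)\<^sup>2 * (\<integral>v. \<integral>u. F2 v u \<partial>circ \<partial>circ) \<le> 4 * (K * d) + 1/25 * energy h"
    using sw.far_energy_le[OF smean \<tau>] energy_swap by (simp add: F2_def K_def d_def mult.assoc add.commute)
  moreover have "(\<integral>v. \<integral>u. F3 u v \<partial>circ \<partial>circ) \<le> 9/25 * (energy h + 64 * (K * shear_defect \<tau> h))"
    using near_cone_energy_le[OF \<tau>] by (simp add: F3_def K_def)
  moreover have "(\<integral>v. \<integral>u. F4 v u \<partial>circ \<partial>circ) \<le> 9/25 * (energy h + 64 * (K * shear_defect \<tau> (\<lambda>u v. h v u)))"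
    using sw.near_cone_energy_le[OF \<tau>] energy_swap by (simp add: F4_def K_def)
  moreover have "K * d = K * shear_defect \<tau> h + K * shear_defect \<tau> (\<lambda>u v. h v u)" by (simp add: d_def distrib_left)
  moreover have "0 \<le> K * shear_defect \<tau> h" "0 \<le> K * shear_defect \<tau> (\<lambda>u v. h v u)"
    using shear_defect_nonneg sw.shear_defect_nonneg by (auto simp: K_def)
  \<comment> \<open>The energy coefficients on the right sum to
    \<open>2 * (1/25) / (49/50)^2 + 18/25\<close>, about 0.803, and those of \<open>K * d\<close> to
    about 31.4; 31.4 / 0.197 is below 200.\<close>
  ultimately have "energy h \<le> 200 * (K * d)"
    by (simp add: power2_eq_square)
  then show ?thesis by (simp add: d_def mult.assoc)
qed

text \<open>The transition operator of the difference of two trajectories.\<close>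

definition step_avg :: "real \<Rightarrow> (real \<Rightarrow> real \<Rightarrow> real) \<Rightarrow> real \<Rightarrow> real \<Rightarrow> real" where
  "step_avg \<tau> g = shear_avg \<tau> (\<lambda>u v. shear_avg \<tau> (\<lambda>v u. g u v) v u)"

lemma integral_cos_avg:
  assumes "circle_function f B"
  shows "(\<integral>u. cos_avg a f u \<partial>circ) = (\<integral>u. f u \<partial>circ)"
proof -
  have "circle_function (\<lambda>_. 1) 1" by standard auto
  from cos_avg_adjoint[OF assms this, of a] show ?thesis
    by (simp add: cos_avg_def circ.prob_space[simplified])
qed

lemma (in torus_function) integral_shear_avg:
  "(\<integral>v. \<integral>u. shear_avg \<tau> h u v \<partial>circ \<partial>circ) = (\<integral>v. \<integral>u. h u v \<partial>circ \<partial>circ)"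
  unfolding shear_avg_def by (simp add: integral_cos_avg[OF slice])

lemma (in torus_function) shear_defect_shear_avg_le:
  "shear_defect \<tau> (shear_avg \<tau> h) \<le> shear_defect \<tau> h"
proof -
  interpret A: torus_function "shear_avg \<tau> h" B by (rule shear_avg_torus_function)
  show ?thesis
    unfolding shear_defect_eq A.shear_defect_eq
    by (intro integral_mono integrable_cos_defect A.integrable_cos_defect)
       (simp add: shear_avg_def cos_defect_cos_avg_le[OF slice])
qed

lemma (in torus_function) step_avg_torus_function: "torus_function (step_avg \<tau> h) B"
  unfolding step_avg_def
  by (rule torus_function.shear_avg_torus_function[OF torus_function.swap
        [OF torus_function.shear_avg_torus_function[OF swap]]])

lemma (in torus_function) integral_swap:
  "(\<integral>v. \<integral>u. h v u \<partial>circ \<partial>circ) = (\<integral>v. \<integral>u. h u v \<partial>circ \<partial>circ)"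
  by (rule circ_pair_swap[OF meas2 bdd2])

lemma (in torus_function) integral_step_avg:
  "(\<integral>v. \<integral>u. step_avg \<tau> h u v \<partial>circ \<partial>circ) = (\<integral>v. \<integral>u. h u v \<partial>circ \<partial>circ)"
proof -
  interpret s: torus_function "\<lambda>v u. h u v" B by (rule swap)
  interpret A: torus_function "shear_avg \<tau> (\<lambda>v u. h u v)" B by (rule s.shear_avg_torus_function)
  interpret S: torus_function "\<lambda>u v. shear_avg \<tau> (\<lambda>v u. h u v) v u" B by (rule A.swap)
  show ?thesis
    unfolding step_avg_def S.integral_shear_avg using A.integral_swap s.integral_shear_avg integral_swap by simp
qed

text \<open>Let \<open>h\<close> be the result of the first half step. Its defect under the second
  shear is \<open>energy h - energy (step_avg \<tau> g)\<close>, and its defect under the first is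
  at most that of \<open>g\<close>, namely \<open>energy g - energy h\<close>. The sum telescopes to
  the loss of the whole step, and \<open>energy (step_avg \<tau> g) \<le> energy h\<close> turns the
  bound by \<open>C\<close> into the factor \<open>C / (1 + C)\<close>.\<close>

lemma energy_step_avg_le:
  assumes "0 < \<tau>"
  obtains r where "0 < r" "r < 1"
    "\<And>g B. torus_function g B \<Longrightarrow> (\<integral>v. \<integral>u. g u v \<partial>circ \<partial>circ) = 0 \<Longrightarrow> energy (step_avg \<tau> g) \<le> r * energy g"
proof -
  obtain N :: nat where "50 * pi / \<tau> \<le> real N" using real_arch_simple by blast
  then have N: "50 * pi \<le> \<tau> * real N" using assms by (simp add: field_simps)
  define C where "C = 200 * ((real N)\<^sup>2 * 8 * pi)"
  have "N \<noteq> 0" using N pi_gt_zero by (intro notI) simp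
  then have C: "0 < C" by (simp add: C_def)
  have "energy (step_avg \<tau> g) \<le> C / (1 + C) * energy g"
    if "torus_function g B" and mean: "(\<integral>v. \<integral>u. g u v \<partial>circ \<partial>circ) = 0" for g B
  proof -
    interpret torus_function g B by fact
    interpret s: torus_function "\<lambda>v u. g u v" B by (rule swap)
    interpret A: torus_function "shear_avg \<tau> (\<lambda>v u. g u v)" B by (rule s.shear_avg_torus_function)
    define h where "h = (\<lambda>u v. shear_avg \<tau> (\<lambda>v u. g u v) v u)"
    interpret h: torus_function h B unfolding h_def by (rule A.swap)
    have "(\<integral>v. \<integral>u. h u v \<partial>circ \<partial>circ) = 0"
      unfolding h_def using A.integral_swap s.integral_shear_avg integral_swap mean by simp
    from energy_le_shear_defects[OF h.torus_function_axioms this assms N]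
    have "energy h \<le> C * (shear_defect \<tau> h + shear_defect \<tau> (\<lambda>u v. h v u))" by (simp add: C_def)
    also have "shear_defect \<tau> (\<lambda>u v. h v u) \<le> shear_defect \<tau> (\<lambda>v u. g u v)"
      unfolding h_def by (rule s.shear_defect_shear_avg_le)
    also have "\<dots> = energy g - energy h"
      unfolding shear_defect_def h_def using energy_swap A.energy_swap by simp
    also have "shear_defect \<tau> h = energy h - energy (step_avg \<tau> g)"
      unfolding shear_defect_def step_avg_def h_def ..
    finally have "energy h \<le> C * (energy g - energy (step_avg \<tau> g))" using C by simp
    moreover have "energy (step_avg \<tau> g) \<le> energy h"
      using h.shear_defect_nonneg[of \<tau>] unfolding shear_defect_def step_avg_def h_def by simp
    ultimately have "(1 + C) * energy (step_avg \<tau> g) \<le> C * energy g" by (simp add: algebra_simps)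
    then show ?thesis using C by (simp add: field_simps)
  qed
  then show thesis using C by (intro that[of "C / (1 + C)"]) (auto simp: field_simps)
qed

section \<open>Two-point motion\<close>

text \<open>Normalised Lebesgue measure as a product over Borel sets of the plane, so that iterated
  integrals and rotations act coordinatewise; \<open>torus_measure\<close> is completed, lives on
  the subspace and has mass \<open>4 * pi^2\<close>.\<close>

definition torus_prob :: "(real \<times> real) measure" where
  "torus_prob = circ \<Otimes>\<^sub>M circ"

lemma sets_torus_prob [simp, measurable_cong]: "sets torus_prob = sets borel"
  and space_torus_prob [simp]: "space torus_prob = UNIV"
proof -
  have "sets torus_prob = sets (borel \<Otimes>\<^sub>M borel :: (real \<times> real) measure)"
    unfolding torus_prob_def by (intro sets_pair_measure_cong) auto
  then show "sets torus_prob = sets borel" by (simp only: borel_prod)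
  show "space torus_prob = UNIV" by (simp add: torus_prob_def space_pair_measure)
qed

global_interpretation circ_pair: pair_prob_space circ circ ..

global_interpretation torus_prob: prob_space torus_prob
  unfolding torus_prob_def by (rule circ_pair.prob_space_axioms)

lemma torus_integrable:
  fixes f :: "real \<times> real \<Rightarrow> 'b::{banach, second_countable_topology}"
  assumes "f \<in> borel_measurable borel" "\<And>x. norm (f x) \<le> B"
  shows "integrable torus_prob f"
  using assms by (intro torus_prob.integrable_const_bound[of _ B]) auto

lemma torus_prob_iterated:
  fixes f :: "real \<times> real \<Rightarrow> 'b::{banach, second_countable_topology}"
  assumes "f \<in> borel_measurable borel" "\<And>x. norm (f x) \<le> B"
  shows "(\<integral>x. f x \<partial>torus_prob) = (\<integral>u. \<integral>v. f (u, v) \<partial>circ \<partial>circ)"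
    and "(\<integral>x. f x \<partial>torus_prob) = (\<integral>v. \<integral>u. f (u, v) \<partial>circ \<partial>circ)"
proof -
  have i: "integrable (circ \<Otimes>\<^sub>M circ) (\<lambda>(u, v). f (u, v))"
    using torus_integrable[OF assms] by (simp add: torus_prob_def)
  show "(\<integral>x. f x \<partial>torus_prob) = (\<integral>u. \<integral>v. f (u, v) \<partial>circ \<partial>circ)"
    using circ_pair.integral_fst[OF i] by (simp add: torus_prob_def)
  show "(\<integral>x. f x \<partial>torus_prob) = (\<integral>v. \<integral>u. f (u, v) \<partial>circ \<partial>circ)"
    using circ_pair.integral_snd[OF i] by (simp add: torus_prob_def)
qed

lemma torus_borel [measurable]: "torus \<in> sets borel"
proof -
  have "torus \<in> sets (borel \<Otimes>\<^sub>M borel)" unfolding torus_def by (intro pair_measureI) auto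
  then show ?thesis by (simp only: borel_prod)
qed

lemma fst_snd_measurable [measurable (raw)]:
  fixes f :: "'a \<Rightarrow> real \<times> real"
  assumes "f \<in> borel_measurable M"
  shows "(\<lambda>x. fst (f x)) \<in> borel_measurable M" "(\<lambda>x. snd (f x)) \<in> borel_measurable M"
  using assms by (auto intro: borel_measurable_continuous_on[OF continuous_on_fst[OF continuous_on_id]]
      borel_measurable_continuous_on[OF continuous_on_snd[OF continuous_on_id]])

lemma torus_prob_density:
  "torus_prob = density lborel (\<lambda>x. ennreal (indicator torus x / (4 * pi\<^sup>2)))"
proof -
  have "torus_prob = density (lborel \<Otimes>\<^sub>M lborel) (\<lambda>(x, y).
      ennreal (indicator {0..<2*pi} x / (2*pi)) * ennreal (indicator {0..<2*pi} y / (2*pi)))"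
    unfolding torus_prob_def circ_density
    by (rule pair_measure_density)
       (use circ.sigma_finite_measure_axioms in \<open>auto simp: circ_density lborel.sigma_finite_measure_axioms\<close>)
  also have "\<dots> = density lborel (\<lambda>x. ennreal (indicator torus x / (4 * pi\<^sup>2)))"
    unfolding lborel_prod
    by (intro arg_cong[where f = "density lborel"] ext)
       (auto simp: torus_def ennreal_mult[symmetric] power2_eq_square split: split_indicator prod.splits)
  finally show ?thesis .
qed

text \<open>The area is recovered from the total mass 1 of the product density.\<close>

lemma emeasure_torus: "emeasure lborel torus = ennreal (4 * pi\<^sup>2)"
proof -
  have "ennreal 1 = (\<integral>\<^sup>+x. ennreal (1 / (4 * pi\<^sup>2)) * indicator torus x \<partial>lborel)"
    using torus_prob.emeasure_space_1 unfolding torus_prob_density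
    by (subst (asm) emeasure_density) (auto simp: ennreal_indicator[symmetric] ennreal_mult[symmetric] intro!: nn_integral_cong arg_cong[where f = ennreal])
  also have "\<dots> = ennreal (1 / (4 * pi\<^sup>2)) * emeasure lborel torus"
    by (rule nn_integral_cmult_indicator) simp
  finally have "ennreal (4 * pi\<^sup>2) * 1 = ennreal (4 * pi\<^sup>2) * (ennreal (1 / (4 * pi\<^sup>2)) * emeasure lborel torus)"
    by simp
  also have "\<dots> = emeasure lborel torus"
    by (simp add: mult.assoc[symmetric] ennreal_mult[symmetric])
  finally show ?thesis by simp
qed

section \<open>The law of the phases\<close>

lemma space_phase_measure: "space phase_measure = torus"
  by (simp add: phase_measure_def torus_def space_restrict_space)

lemma prob_space_phase_measure: "prob_space phase_measure"
  unfolding phase_measure_def torus_def[symmetric]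
  by (rule prob_space_uniform_measure) (auto simp: emeasure_restrict_space emeasure_torus)

lemma phase_measure_id: "(\<lambda>x. x) \<in> phase_measure \<rightarrow>\<^sub>M borel"
  unfolding phase_measure_def by (simp add: uniform_measure_def measurable_restrict_space1)

text \<open>Pushing forward along the inclusion of the subspace \<open>[0, 2*pi)^2\<close> turns
  integrals over a phase into iterated integrals over two independent circle angles.\<close>

lemma distr_phase_measure: "distr phase_measure borel (\<lambda>x. x) = torus_prob"
proof (rule measure_eqI)
  fix A assume "A \<in> sets (distr phase_measure borel (\<lambda>x. x))"
  then have [measurable]: "A \<in> sets borel" by simp
  have s: "A \<inter> torus \<in> sets (restrict_space lborel torus)"
    by (auto simp: sets_restrict_space)
  have "emeasure (distr phase_measure borel (\<lambda>x. x)) A = emeasure phase_measure (A \<inter> torus)"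
    using phase_measure_id by (subst emeasure_distr) (auto simp: space_phase_measure)
  also have "\<dots> = emeasure (restrict_space lborel torus) (torus \<inter> (A \<inter> torus)) / emeasure (restrict_space lborel torus) torus"
    unfolding phase_measure_def torus_def[symmetric] using s
    by (intro emeasure_uniform_measure) (auto simp: sets_restrict_space)
  also have "\<dots> = emeasure lborel (A \<inter> torus) / ennreal (4 * pi\<^sup>2)"
    by (simp add: emeasure_restrict_space emeasure_torus Int_commute Int_left_commute)
  also have "\<dots> = (\<integral>\<^sup>+x. ennreal (1 / (4 * pi\<^sup>2)) * indicator (A \<inter> torus) x \<partial>lborel)"
    by (subst nn_integral_cmult_indicator) (auto simp: divide_ennreal_def mult.commute inverse_ennreal inverse_eq_divide)
  also have "\<dots> = (\<integral>\<^sup>+x. ennreal (indicator torus x / (4 * pi\<^sup>2)) * indicator A x \<partial>lborel)"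
    by (intro nn_integral_cong) (auto split: split_indicator)
  also have "\<dots> = emeasure torus_prob A"
    unfolding torus_prob_density by (subst emeasure_density) auto
  finally show "emeasure (distr phase_measure borel (\<lambda>x. x)) A = emeasure torus_prob A" .
qed simp

lemma integral_phase_measure:
  fixes f :: "real \<times> real \<Rightarrow> 'b::{banach, second_countable_topology}"
  assumes "f \<in> borel_measurable borel"
  shows "(\<integral>x. f x \<partial>phase_measure) = (\<integral>x. f x \<partial>torus_prob)"
proof -
  have "(\<integral>x. f x \<partial>distr phase_measure borel (\<lambda>x. x)) = (\<integral>x. f x \<partial>phase_measure)"
    by (rule integral_distr[OF phase_measure_id assms])
  then show ?thesis unfolding distr_phase_measure by simp
qed

lemma integral_torus_measure:
  fixes f :: "real \<times> real \<Rightarrow> complex"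
  assumes [measurable]: "f \<in> borel_measurable borel"
  shows "(\<integral>x. f x \<partial>torus_measure) = 4 * pi\<^sup>2 * (\<integral>x. f x \<partial>torus_prob)"
proof -
  have "(\<integral>x. f x \<partial>torus_measure) = (\<integral>x. indicator torus x *\<^sub>R f x \<partial>completion lborel)"
    unfolding torus_measure_def by (rule integral_restrict_space) auto
  also have "\<dots> = (\<integral>x. indicator torus x *\<^sub>R f x \<partial>lborel)"
    by (rule integral_completion) measurable
  also have "\<dots> = (\<integral>x. (4 * pi\<^sup>2) *\<^sub>R ((indicator torus x / (4 * pi\<^sup>2)) *\<^sub>R f x) \<partial>lborel)"
    by (intro Bochner_Integration.integral_cong) auto
  also have "\<dots> = (4 * pi\<^sup>2) *\<^sub>R (\<integral>x. (indicator torus x / (4 * pi\<^sup>2)) *\<^sub>R f x \<partial>lborel)"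
    by (rule integral_scaleR_right) 
  also have "(\<integral>x. (indicator torus x / (4 * pi\<^sup>2)) *\<^sub>R f x \<partial>lborel) = (\<integral>x. f x \<partial>torus_prob)"
    unfolding torus_prob_density by (rule integral_density[symmetric]) auto
  finally show ?thesis by (simp add: scaleR_conv_of_real)
qed

lemma AE_torus_prob_iff:
  assumes [measurable]: "{x. \<not> P x} \<in> sets borel"
  shows "(AE x in torus_prob. P x) \<longleftrightarrow> (AE x in lborel. x \<in> torus \<longrightarrow> P x)"
  unfolding torus_prob_density
  by (subst AE_density) (auto intro!: AE_cong split: split_indicator simp: ennreal_zero_less_divide)

text \<open>The maps on the universal cover, where differences of trajectories make sense.\<close>

definition lift_map :: "real \<Rightarrow> real \<times> real \<Rightarrow> real \<times> real \<Rightarrow> real \<times> real" where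
  "lift_map \<tau> w x = (fst x + \<tau> * sin (snd x - fst w),
     snd x + \<tau> * sin (fst x + \<tau> * sin (snd x - fst w) - snd w))"

primrec lift_flow :: "real \<Rightarrow> (nat \<Rightarrow> real \<times> real) \<Rightarrow> nat \<Rightarrow> real \<times> real \<Rightarrow> real \<times> real" where
  "lift_flow \<tau> \<omega> 0 x = x"
| "lift_flow \<tau> \<omega> (Suc n) x = lift_map \<tau> (\<omega> (Suc n)) (lift_flow \<tau> \<omega> n x)"

definition torus_cong :: "real \<times> real \<Rightarrow> real \<times> real \<Rightarrow> bool" where
  "torus_cong x y \<longleftrightarrow> [fst x = fst y] (rmod (2*pi)) \<and> [snd x = snd y] (rmod (2*pi))"

lemma pierrehumbert_map_cong:
  assumes "torus_cong x y"
  shows "torus_cong (pierrehumbert_map \<tau> w x) (lift_map \<tau> w y)"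
proof -
  from assms have 1: "[fst x = fst y] (rmod (2*pi))" and 2: "[snd x = snd y] (rmod (2*pi))"
    by (auto simp: torus_cong_def)
  have "sin (snd x - fst w) = sin (snd y - fst w)"
    by (rule sin_rcong) (use 2 in simp)
  then have 3: "[(fst x + \<tau> * sin (snd x - fst w)) rmod (2*pi) = fst y + \<tau> * sin (snd y - fst w)] (rmod (2*pi))"
    using 1 by (intro rcong_rmod_left) simp
  then have "sin ((fst x + \<tau> * sin (snd x - fst w)) rmod (2*pi) - snd w) = sin (fst y + \<tau> * sin (snd y - fst w) - snd w)"
    by (intro sin_rcong) (simp only: rcong_diff_right_cancel)
  then have "[(snd x + \<tau> * sin ((fst x + \<tau> * sin (snd x - fst w)) rmod (2*pi) - snd w)) rmod (2*pi)
      = snd y + \<tau> * sin (fst y + \<tau> * sin (snd y - fst w) - snd w)] (rmod (2*pi))"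
    using 2 by (intro rcong_rmod_left) simp
  with 3 show ?thesis
    by (simp add: torus_cong_def pierrehumbert_map_def fV_def fH_def lift_map_def)
qed

lemma pierrehumbert_flow_cong: "torus_cong (pierrehumbert_flow \<tau> \<omega> n x) (lift_flow \<tau> \<omega> n x)"
proof (induction n)
  case (Suc n)
  then show ?case by (simp add: pierrehumbert_map_cong)
qed (simp add: torus_cong_def)

lemma lift_map_measurable [measurable]:
  "(\<lambda>(w, x). lift_map \<tau> w x) \<in> borel_measurable (borel \<Otimes>\<^sub>M borel)"
  unfolding lift_map_def case_prod_beta by (rule borel_measurable_Pair) measurable

text \<open>The index set is left open because expectations are computed on the finite product over
  \<open>{1..n}\<close>, while the phases live on the product over \<open>{1..}\<close>.\<close>

lemma lift_flow_measurable:
  assumes "{1..n} \<subseteq> J"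
  shows "(\<lambda>(\<omega>, x). lift_flow \<tau> \<omega> n x) \<in> borel_measurable (PiM J (\<lambda>_. phase_measure) \<Otimes>\<^sub>M borel)"
  using assms
proof (induction n)
  case (Suc n)
  have "{1..n} \<subseteq> J" using Suc.prems by auto
  from Suc.IH[OF this] have [measurable]: "(\<lambda>p. lift_flow \<tau> (fst p) n (snd p)) \<in> borel_measurable (PiM J (\<lambda>_. phase_measure) \<Otimes>\<^sub>M borel)"
    by (simp add: case_prod_beta)
  have "Suc n \<in> J" using Suc.prems by auto
  then have [measurable]: "(\<lambda>p. fst p (Suc n)) \<in> borel_measurable (PiM J (\<lambda>_. phase_measure) \<Otimes>\<^sub>M borel)"
    by (intro measurable_compose[OF _ phase_measure_id] measurable_compose[OF measurable_fst] measurable_component_singleton)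
  have "(\<lambda>p. lift_map \<tau> (fst p (Suc n)) (lift_flow \<tau> (fst p) n (snd p))) \<in> borel_measurable (PiM J (\<lambda>_. phase_measure) \<Otimes>\<^sub>M borel)"
    by measurable
  then show ?case by (simp add: case_prod_beta)
next
  case 0
  have "(\<lambda>(\<omega>, x). lift_flow \<tau> \<omega> 0 x) = snd" by auto
  then show ?case by simp
qed

lemma lift_flow_depends:
  assumes "\<And>i. 1 \<le> i \<Longrightarrow> i \<le> n \<Longrightarrow> \<omega> i = \<omega>' i"
  shows "lift_flow \<tau> \<omega> n x = lift_flow \<tau> \<omega>' n x"
  using assms by (induction n) auto

text \<open>Sum-to-product writes the difference of sines as \<open>2 * sin ((p - q) / 2)\<close>
  times a cosine of \<open>b\<close> with some offset. The uniform phase absorbs the offset, so only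
  \<open>p - q\<close> survives, and evenness in the amplitude permits the absolute value.\<close>

lemma (in circle_function) integral_sin_difference:
  "(\<integral>b. f (z + \<tau> * (sin (p - b) - sin (q - b))) \<partial>circ) = cos_avg (2 * \<tau> * half_sin (p - q)) f z"
proof -
  have eq: "z + \<tau> * (sin (p - b) - sin (q - b)) = z + 2 * \<tau> * sin ((p - q) / 2) * cos (b + (- (p + q) / 2))" for b
  proof -
    have "sin (p - b) - sin (q - b) = 2 * sin ((p - q) / 2) * cos ((p + q) / 2 - b)"
      using sin_diff_sin[of "p - b" "q - b"] by (simp add: field_simps)
    also have "cos ((p + q) / 2 - b) = cos (b + (- (p + q) / 2))"
    proof -
      have "(p + q) / 2 - b = - (b + (- (p + q) / 2))" by (simp add: field_simps)
      then show ?thesis by (simp only: cos_minus)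
    qed
    finally show ?thesis by simp
  qed
  have "(\<integral>b. f (z + \<tau> * (sin (p - b) - sin (q - b))) \<partial>circ) = cos_avg (2 * \<tau> * sin ((p - q) / 2)) f z"
    unfolding eq cos_avg_def
    by (rule integral_circ_shift[where f = "\<lambda>b. f (z + 2 * \<tau> * sin ((p - q) / 2) * cos b)"]) auto
  also have "\<dots> = cos_avg (2 * \<tau> * half_sin (p - q)) f z"
    using cos_avg_uminus[of "2 * \<tau> * sin ((p - q) / 2)" z] by (auto simp: half_sin_def abs_if)
  finally show ?thesis .
qed

text \<open>Both points see the same phases. Integrating the second phase for a fixed first one
  leaves a function of the differences only, to which the same identity applies for the first phase;
  hence the difference is itself a Markov chain.\<close>

lemma (in torus_function) step_avg_transition:
  "(\<integral>w. h (fst (lift_map \<tau> w x) - fst (lift_map \<tau> w y)) (snd (lift_map \<tau> w x) - snd (lift_map \<tau> w y)) \<partial>torus_prob)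
    = step_avg \<tau> h (fst x - fst y) (snd x - snd y)"
proof -
  note [measurable] = meas2
  define H where "H = (\<lambda>u v. shear_avg \<tau> (\<lambda>v u. h u v) v u)"
  interpret H: torus_function H B unfolding H_def
    by (rule torus_function.swap[OF torus_function.shear_avg_torus_function[OF swap]])
  let ?X = "\<lambda>b. fst x + \<tau> * sin (snd x - b)" and ?Y = "\<lambda>b. fst y + \<tau> * sin (snd y - b)"
  have "(\<integral>w. h (fst (lift_map \<tau> w x) - fst (lift_map \<tau> w y)) (snd (lift_map \<tau> w x) - snd (lift_map \<tau> w y)) \<partial>torus_prob)
    = (\<integral>b. \<integral>c. h (?X b - ?Y b) (snd x - snd y + \<tau> * (sin (?X b - c) - sin (?Y b - c))) \<partial>circ \<partial>circ)"
    by (subst torus_prob_iterated(1)[where B = B])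
       (auto simp: bdd2 lift_map_def algebra_simps)
  also have "\<dots> = (\<integral>b. H (?X b - ?Y b) (snd x - snd y) \<partial>circ)"
    unfolding H_def shear_avg_def
    by (rule Bochner_Integration.integral_cong[OF refl])
       (rule circle_function.integral_sin_difference[OF torus_function.slice[OF swap]])
  also have "\<dots> = (\<integral>b. H (fst x - fst y + \<tau> * (sin (snd x - b) - sin (snd y - b))) (snd x - snd y) \<partial>circ)"
    by (simp add: algebra_simps)
  also have "\<dots> = step_avg \<tau> h (fst x - fst y) (snd x - snd y)"
    unfolding step_avg_def H_def[symmetric] shear_avg_def[of \<tau> H]
    by (rule circle_function.integral_sin_difference[OF H.slice])
  finally show ?thesis .
qed

lemma step_avg_power_torus_function:
  "torus_function h B \<Longrightarrow> torus_function ((step_avg \<tau> ^^ n) h) B"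
  by (induction n) (auto intro: torus_function.step_avg_torus_function)

text \<open>The phase \<open>Suc n\<close> belongs to the map applied last. Integrating it first
  replaces the observable \<open>h\<close> by \<open>step_avg \<tau> h\<close> and keeps the
  starting points, which is why the induction generalises over \<open>h\<close>.\<close>

lemma integral_flow_difference:
  assumes "torus_function h B"
  shows "(\<integral>\<omega>. h (fst (lift_flow \<tau> \<omega> n x) - fst (lift_flow \<tau> \<omega> n y)) (snd (lift_flow \<tau> \<omega> n x) - snd (lift_flow \<tau> \<omega> n y))
      \<partial>PiM {1..n} (\<lambda>_. phase_measure))
    = (step_avg \<tau> ^^ n) h (fst x - fst y) (snd x - snd y)"
  using assms
proof (induction n arbitrary: h)
  case 0
  interpret product_prob_space "\<lambda>_. phase_measure" "{1..0::nat}"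
    by (intro product_prob_spaceI prob_space_phase_measure)
  show ?case using P.prob_space by simp
next
  case (Suc n)
  interpret torus_function h B by fact
  note [measurable] = meas2
  interpret product_prob_space "\<lambda>_. phase_measure" "{1..Suc n}"
    by (intro product_prob_spaceI prob_space_phase_measure)
  interpret n: product_prob_space "\<lambda>_. phase_measure" "{1..n}"
    by (intro product_prob_spaceI prob_space_phase_measure)
  have meas: "(\<lambda>\<omega>. lift_flow \<tau> \<omega> m z) \<in> borel_measurable (PiM {1..m} (\<lambda>_. phase_measure))" for m z
    using measurable_compose[OF _ lift_flow_measurable[OF order_refl], of "\<lambda>\<omega>. (\<omega>, z)"] by simp
  note [measurable] = meas
  let ?F = "\<lambda>p q. h (fst p - fst q) (snd p - snd q)"
  have F: "(\<lambda>\<omega>. ?F (p \<omega>) (q \<omega>)) \<in> borel_measurable M"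
    if [measurable]: "p \<in> borel_measurable M" "q \<in> borel_measurable M" for p q and M :: "'z measure"
    by measurable
  have ins: "{1..Suc n} = insert (Suc n) {1..n}" by auto
  have "(\<integral>\<omega>. ?F (lift_flow \<tau> \<omega> (Suc n) x) (lift_flow \<tau> \<omega> (Suc n) y) \<partial>PiM {1..Suc n} (\<lambda>_. phase_measure))
    = (\<integral>\<omega>. \<integral>w. ?F (lift_flow \<tau> (fun_upd \<omega> (Suc n) w) (Suc n) x) (lift_flow \<tau> (fun_upd \<omega> (Suc n) w) (Suc n) y) \<partial>phase_measure \<partial>PiM {1..n} (\<lambda>_. phase_measure))"
    unfolding ins
  proof (rule product_integral_insert)
    have "integrable (PiM {1..Suc n} (\<lambda>_. phase_measure)) (\<lambda>\<omega>. ?F (lift_flow \<tau> \<omega> (Suc n) x) (lift_flow \<tau> \<omega> (Suc n) y))"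
    proof (rule P.integrable_const_bound[of _ B])
      show "(\<lambda>\<omega>. ?F (lift_flow \<tau> \<omega> (Suc n) x) (lift_flow \<tau> \<omega> (Suc n) y)) \<in> borel_measurable (PiM {1..Suc n} (\<lambda>_. phase_measure))"
        by (rule F[OF meas meas])
    qed (simp add: bdd2)
    then show "integrable (PiM (insert (Suc n) {1..n}) (\<lambda>_. phase_measure)) (\<lambda>\<omega>. ?F (lift_flow \<tau> \<omega> (Suc n) x) (lift_flow \<tau> \<omega> (Suc n) y))"
      unfolding ins .
  qed auto
  also have "\<dots> = (\<integral>\<omega>. step_avg \<tau> h (fst (lift_flow \<tau> \<omega> n x) - fst (lift_flow \<tau> \<omega> n y)) (snd (lift_flow \<tau> \<omega> n x) - snd (lift_flow \<tau> \<omega> n y))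
      \<partial>PiM {1..n} (\<lambda>_. phase_measure))"
  proof (rule Bochner_Integration.integral_cong[OF refl])
    fix \<omega>
    have eq: "lift_flow \<tau> (fun_upd \<omega> (Suc n) w) (Suc n) z = lift_map \<tau> w (lift_flow \<tau> \<omega> n z)" for w z
      using lift_flow_depends[of n "fun_upd \<omega> (Suc n) w" \<omega>] by simp
    show "(\<integral>w. ?F (lift_flow \<tau> (fun_upd \<omega> (Suc n) w) (Suc n) x) (lift_flow \<tau> (fun_upd \<omega> (Suc n) w) (Suc n) y) \<partial>phase_measure)
      = step_avg \<tau> h (fst (lift_flow \<tau> \<omega> n x) - fst (lift_flow \<tau> \<omega> n y)) (snd (lift_flow \<tau> \<omega> n x) - snd (lift_flow \<tau> \<omega> n y))"
      unfolding eq step_avg_transition[symmetric]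
      by (rule integral_phase_measure) measurable
  qed
  also have "\<dots> = (step_avg \<tau> ^^ n) (step_avg \<tau> h) (fst x - fst y) (snd x - snd y)"
    by (rule Suc.IH[OF step_avg_torus_function])
  finally show ?case by (simp only: funpow_Suc_right o_apply)
qed

section \<open>Second moments of mode correlations\<close>

definition trig :: "int \<times> int \<Rightarrow> real \<times> real \<Rightarrow> complex" where
  "trig k x = cis (of_int (fst k) * fst x + of_int (snd k) * snd x)"

text \<open>Taken along the lifted flow, where differences of trajectories are literal differences;
  by periodicity of \<open>trig\<close> the value is the same for the torus flow.\<close>

definition correlation :: "real \<Rightarrow> (nat \<Rightarrow> real \<times> real) \<Rightarrow> nat \<Rightarrow> int \<times> int \<Rightarrow> int \<times> int \<Rightarrow> complex" where
  "correlation \<tau> \<omega> n l k = (\<integral>x. trig l x * trig k (lift_flow \<tau> \<omega> n x) \<partial>torus_prob)"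

lemma trig_measurable [measurable]: "trig k \<in> borel_measurable borel"
  unfolding trig_def cis_conv_exp
  by (intro borel_measurable_continuous_onI continuous_intros)

lemma norm_trig [simp]: "norm (trig k x) = 1"
  by (simp add: trig_def)

lemma prob_Fubini_bounded:
  fixes f :: "'a \<Rightarrow> 'b \<Rightarrow> real"
  assumes "prob_space M" "prob_space N"
    and "(\<lambda>(x, y). f x y) \<in> borel_measurable (M \<Otimes>\<^sub>M N)" "\<And>x y. \<bar>f x y\<bar> \<le> B"
  shows "(\<integral>x. \<integral>y. f x y \<partial>N \<partial>M) = (\<integral>y. \<integral>x. f x y \<partial>M \<partial>N)"
proof -
  interpret M: prob_space M by fact
  interpret N: prob_space N by fact
  interpret P: pair_prob_space M N ..
  show ?thesis
    using assms by (intro P.Fubini_integral[symmetric] P.P.integrable_const_bound[of _ B]) auto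
qed

lemma prob_integral_bounded:
  fixes f :: "'a \<Rightarrow> real"
  assumes "prob_space M" "f \<in> borel_measurable M" "\<And>x. \<bar>f x\<bar> \<le> B"
  shows "\<bar>\<integral>x. f x \<partial>M\<bar> \<le> B"
proof -
  interpret prob_space M by fact
  have i: "integrable M f" using assms by (intro integrable_const_bound[of _ B]) auto
  have "\<bar>\<integral>x. f x \<partial>M\<bar> \<le> (\<integral>x. \<bar>f x\<bar> \<partial>M)" by (rule integral_abs_bound)
  also have "\<dots> \<le> (\<integral>x. B \<partial>M)" using i assms(3) by (intro integral_mono) auto
  finally show ?thesis by (simp add: prob_space)
qed

text \<open>A rotation by \<open>pi / k\<close> preserves the integral but flips the sign of the
  integrand.\<close>

lemma integral_cos_mode:
  fixes k :: int
  assumes "k \<noteq> 0"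
  shows "(\<integral>u. cos (of_int k * u + c) \<partial>circ) = 0"
proof -
  have per: "cos (of_int k * (u + 2*pi) + c) = cos (of_int k * u + c)" for u
  proof -
    have "of_int k * (u + 2*pi) + c = (of_int k * u + c) + of_int k * (2*pi)" by (simp add: algebra_simps)
    then show ?thesis by (simp only: periodic_shift_int[where h = cos, OF cos_periodic])
  qed
  have "(\<integral>u. cos (of_int k * u + c) \<partial>circ) = (\<integral>u. cos (of_int k * (u + pi / of_int k) + c) \<partial>circ)"
    by (rule integral_circ_shift[where f = "\<lambda>u. cos (of_int k * u + c)", symmetric]) (use per in auto)
  also have "\<dots> = (\<integral>u. - cos (of_int k * u + c) \<partial>circ)"
  proof (rule Bochner_Integration.integral_cong[OF refl])
    fix u
    have "of_int k * (u + pi / of_int k) + c = (of_int k * u + c) + pi"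
      using assms by (simp add: field_simps)
    then show "cos (of_int k * (u + pi / of_int k) + c) = - cos (of_int k * u + c)"
      by (simp only: cos_periodic_pi)
  qed
  also have "\<dots> = - (\<integral>u. cos (of_int k * u + c) \<partial>circ)" by simp
  finally show ?thesis by simp
qed

text \<open>The offset \<open>c\<close> lets one family supply both the cosine
  (\<open>c = 0\<close>) and the sine (\<open>c = - pi/2\<close>) of a frequency.\<close>

definition mode :: "int \<times> int \<Rightarrow> real \<Rightarrow> real \<Rightarrow> real \<Rightarrow> real" where
  "mode k c u v = cos (of_int (fst k) * u + of_int (snd k) * v + c)"

lemma mode_torus_function: "torus_function (mode k c) 1"
proof
  show "(\<lambda>(u, v). mode k c u v) \<in> borel_measurable (borel \<Otimes>\<^sub>M borel)"
    unfolding mode_def by measurable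
  fix u v
  have "cos (x + of_int m * (2*pi)) = cos x" for x m
    by (rule periodic_shift_int) simp
  from this[of "of_int (fst k) * u + of_int (snd k) * v + c" "fst k"]
    this[of "of_int (fst k) * u + of_int (snd k) * v + c" "snd k"]
  show "mode k c (u + 2*pi) v = mode k c u v" "mode k c u (v + 2*pi) = mode k c u v"
    by (simp_all add: mode_def algebra_simps)
qed (simp add: mode_def)

lemma integral_mode:
  assumes "k \<noteq> (0, 0)"
  shows "(\<integral>v. \<integral>u. mode k c u v \<partial>circ \<partial>circ) = 0"
proof (cases "fst k = 0")
  case True
  with assms have "snd k \<noteq> 0" by (auto simp: prod_eq_iff)
  with True show ?thesis
    by (simp add: mode_def integral_cos_mode circ.prob_space[simplified])
next
  case False
  then show ?thesis by (simp add: mode_def add.assoc integral_cos_mode)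
qed

lemma energy_mode_le: "energy (mode k c) \<le> 1"
proof -
  interpret torus_function "mode k c" 1 by (rule mode_torus_function)
  note [measurable] = meas2
  have "\<bar>\<integral>v. \<integral>u. (mode k c u v)\<^sup>2 \<partial>circ \<partial>circ\<bar> \<le> 1\<^sup>2"
    by (rule circ_integral_bounded[OF _ circ_integral_bounded[OF _ sq_bdd]]) measurable
  then show ?thesis by (simp add: energy_def)
qed

lemma energy_step_avg_power_le:
  assumes gap: "\<And>g B. torus_function g B \<Longrightarrow> (\<integral>v. \<integral>u. g u v \<partial>circ \<partial>circ) = 0 \<Longrightarrow> energy (step_avg \<tau> g) \<le> r * energy g"
    and "0 \<le> r" and h: "torus_function h B" "(\<integral>v. \<integral>u. h u v \<partial>circ \<partial>circ) = 0"
  shows "energy ((step_avg \<tau> ^^ n) h) \<le> r ^ n * energy h"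
    and "(\<integral>v. \<integral>u. (step_avg \<tau> ^^ n) h u v \<partial>circ \<partial>circ) = 0"
proof (induction n)
  case (Suc n)
  note tf = step_avg_power_torus_function[OF h(1), where \<tau> = \<tau> and n = n]
  case 1
  have "energy (step_avg \<tau> ((step_avg \<tau> ^^ n) h)) \<le> r * energy ((step_avg \<tau> ^^ n) h)"
    by (rule gap[OF tf Suc(2)])
  also have "\<dots> \<le> r * (r ^ n * energy h)"
    using Suc(1) \<open>0 \<le> r\<close> by (rule mult_left_mono)
  finally show ?case by simp
  case 2
  show ?case using torus_function.integral_step_avg[OF tf, of \<tau>] Suc(2) by simp
qed (use h in auto)

lemma (in torus_function) integral_abs_translate_le:
  "(\<integral>x. \<bar>h (fst x - a) (snd x - b)\<bar> \<partial>torus_prob) \<le> sqrt (energy h)"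
proof -
  note [measurable] = meas2
  have [measurable]: "(\<lambda>x. h (fst x - a) (snd x - b)) \<in> borel_measurable borel"
    by measurable
  have i: "integrable torus_prob (\<lambda>x. \<bar>h (fst x - a) (snd x - b)\<bar>\<^sup>2)"
    using sq_bdd by (intro torus_integrable[of _ "B\<^sup>2"]) auto
  have "(\<integral>x. \<bar>h (fst x - a) (snd x - b)\<bar> \<partial>torus_prob)\<^sup>2 \<le> (\<integral>x. \<bar>h (fst x - a) (snd x - b)\<bar>\<^sup>2 \<partial>torus_prob)"
    using Cauchy_Schwarz_integral(2)[of "\<lambda>x. \<bar>h (fst x - a) (snd x - b)\<bar>" torus_prob "\<lambda>_. 1", OF _ _ i]
    by (simp add: torus_prob.prob_space[simplified])
  also have "\<dots> = (\<integral>v. \<integral>u. (h (u - a) (v - b))\<^sup>2 \<partial>circ \<partial>circ)"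
    using sq_bdd by (subst torus_prob_iterated(2)[where B = "B\<^sup>2"]) auto
  also have "\<dots> = (\<integral>v. \<integral>u. (h u (v - b))\<^sup>2 \<partial>circ \<partial>circ)"
  proof (rule Bochner_Integration.integral_cong[OF refl])
    fix v
    show "(\<integral>u. (h (u - a) (v - b))\<^sup>2 \<partial>circ) = (\<integral>u. (h u (v - b))\<^sup>2 \<partial>circ)"
      using integral_circ_shift[where f = "\<lambda>u. (h u (v - b))\<^sup>2" and a = "- a"] per1 by simp
  qed
  also have "\<dots> = energy h"
    unfolding energy_def
    using integral_circ_shift[where f = "\<lambda>v. \<integral>u. (h u v)\<^sup>2 \<partial>circ" and a = "- b"] per2 by simp
  finally have "sqrt ((\<integral>x. \<bar>h (fst x - a) (snd x - b)\<bar> \<partial>torus_prob)\<^sup>2) \<le> sqrt (energy h)"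
    by (rule real_sqrt_le_mono)
  then show ?thesis by simp
qed

text \<open>Squaring introduces an independent second starting point; this is where the two-point
  motion enters.\<close>

lemma cmod_integral_cis_sq:
  assumes [measurable]: "\<theta> \<in> borel_measurable borel"
  shows "(cmod (\<integral>x. cis (\<theta> x) \<partial>torus_prob))\<^sup>2 = (\<integral>x. \<integral>y. cos (\<theta> x - \<theta> y) \<partial>torus_prob \<partial>torus_prob)"
proof -
  have [measurable]: "(\<lambda>x. cis (\<theta> x)) \<in> borel_measurable borel"
    by (rule measurable_compose[OF assms], intro borel_measurable_continuous_onI continuous_intros)
  have i: "integrable torus_prob (\<lambda>x. cis (\<theta> x))" by (rule torus_integrable[of _ 1]) auto
  have ic: "integrable torus_prob (\<lambda>x. cos (\<theta> x))" "integrable torus_prob (\<lambda>x. sin (\<theta> x))"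
    by (auto intro!: torus_integrable[of _ 1])
  have "(cmod (\<integral>x. cis (\<theta> x) \<partial>torus_prob))\<^sup>2 = (\<integral>x. cos (\<theta> x) \<partial>torus_prob)\<^sup>2 + (\<integral>x. sin (\<theta> x) \<partial>torus_prob)\<^sup>2"
    unfolding cmod_power2 using integral_Re[OF i] integral_Im[OF i] by simp
  also have "\<dots> = (\<integral>x. cos (\<theta> x) * (\<integral>y. cos (\<theta> y) \<partial>torus_prob) + sin (\<theta> x) * (\<integral>y. sin (\<theta> y) \<partial>torus_prob) \<partial>torus_prob)"
    using ic by (simp add: power2_eq_square)
  also have "\<dots> = (\<integral>x. \<integral>y. cos (\<theta> x - \<theta> y) \<partial>torus_prob \<partial>torus_prob)"
    unfolding cos_diff using ic by simp
  finally show ?thesis .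
qed

lemma correlation_depends:
  assumes "\<And>i. 1 \<le> i \<Longrightarrow> i \<le> n \<Longrightarrow> \<omega> i = \<omega>' i"
  shows "correlation \<tau> \<omega> n l k = correlation \<tau> \<omega>' n l k"
  unfolding correlation_def using lift_flow_depends[OF assms] by simp

lemma correlation_measurable:
  assumes "{1..n} \<subseteq> J"
  shows "(\<lambda>\<omega>. correlation \<tau> \<omega> n l k) \<in> borel_measurable (PiM J (\<lambda>_. phase_measure))"
proof -
  note [measurable] = lift_flow_measurable[OF assms]
  show ?thesis unfolding correlation_def by measurable
qed

lemma norm_correlation_le: "norm (correlation \<tau> \<omega> n l k) \<le> 1"
proof -
  have "norm (correlation \<tau> \<omega> n l k) \<le> (\<integral>x. norm (trig l x * trig k (lift_flow \<tau> \<omega> n x)) \<partial>torus_prob)"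
    unfolding correlation_def by (rule integral_norm_bound)
  then show ?thesis by (simp add: norm_mult torus_prob.prob_space[simplified])
qed

lemma lift_flow_borel [measurable]: "lift_flow \<tau> \<omega> n \<in> borel_measurable borel"
proof (induction n)
  case (Suc n)
  note [measurable] = Suc
  have "lift_flow \<tau> \<omega> (Suc n) = (\<lambda>x. lift_map \<tau> (\<omega> (Suc n)) (lift_flow \<tau> \<omega> n x))" by auto
  then show ?case by simp
next
  case 0
  have "lift_flow \<tau> \<omega> 0 = (\<lambda>x. x)" by auto
  then show ?case by simp
qed

text \<open>The second moment is a double integral over starting points \<open>x\<close>,
  \<open>y\<close> of the expected cosine of a phase difference. The expectation is the iterated
  transition operator applied to a mode and evaluated at \<open>x - y\<close>, and its L1 norm over
  \<open>x\<close> is bounded by the L2 norm, which decays like \<open>sqrt r ^ n\<close>. Cosine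
  and sine together give the factor 2.\<close>

lemma second_moment_correlation:
  assumes gap: "\<And>g B. torus_function g B \<Longrightarrow> (\<integral>v. \<integral>u. g u v \<partial>circ \<partial>circ) = 0 \<Longrightarrow> energy (step_avg \<tau> g) \<le> r * energy g"
    and "0 \<le> r" and k: "k \<noteq> (0, 0)"
  shows "(\<integral>\<omega>. (norm (correlation \<tau> \<omega> n l k))\<^sup>2 \<partial>phase_seq_measure) \<le> 2 * sqrt r ^ n"
proof -
  let ?M = "PiM {1..n} (\<lambda>_. phase_measure)"
  \<comment> \<open>Keeps the index sets in the form \<open>{1..n}\<close> instead of
    \<open>{Suc 0..n}\<close>.\<close>
  note [simp del] = One_nat_def
  interpret n: product_prob_space "\<lambda>_. phase_measure" "{1..n}"
    by (intro product_prob_spaceI prob_space_phase_measure)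
  interpret inf: product_prob_space "\<lambda>_. phase_measure" "{1::nat..}"
    by (intro product_prob_spaceI prob_space_phase_measure)
  note [measurable] = lift_flow_measurable[OF order_refl, of n]
  define \<theta> where "\<theta> \<omega> x = (of_int (fst l) * fst x + of_int (snd l) * snd x)
    + (of_int (fst k) * fst (lift_flow \<tau> \<omega> n x) + of_int (snd k) * snd (lift_flow \<tau> \<omega> n x))" for \<omega> x
  have \<theta>1 [measurable]: "\<theta> \<omega> \<in> borel_measurable borel" for \<omega>
    unfolding \<theta>_def by measurable
  have [measurable]: "(\<lambda>p::_ \<times> (real \<times> real). fst (snd p)) \<in> borel_measurable (?M \<Otimes>\<^sub>M borel)"
    by (rule fst_snd_measurable(1), rule measurable_snd)
  have [measurable]: "(\<lambda>p::_ \<times> (real \<times> real). snd (snd p)) \<in> borel_measurable (?M \<Otimes>\<^sub>M borel)"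
    by (rule fst_snd_measurable(2), rule measurable_snd)
  have "(\<lambda>p. lift_flow \<tau> (fst p) n (snd p)) \<in> borel_measurable (?M \<Otimes>\<^sub>M borel)"
    using lift_flow_measurable[OF order_refl, of \<tau> n] by (simp add: case_prod_beta)
  note [measurable] = fst_snd_measurable[OF this]
  have \<theta>2 [measurable]: "(\<lambda>(\<omega>, x). \<theta> \<omega> x) \<in> borel_measurable (?M \<Otimes>\<^sub>M borel)"
    unfolding \<theta>_def case_prod_beta by measurable
  have \<theta>3 [measurable]: "(\<lambda>\<omega>. \<theta> \<omega> p) \<in> borel_measurable ?M" for p
    using measurable_compose[OF _ \<theta>2, of "\<lambda>\<omega>. (\<omega>, p)"] by simp
  define h where "h c = (step_avg \<tau> ^^ n) (mode k c)" for c
  have h: "torus_function (h c) 1" for c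
    unfolding h_def by (rule step_avg_power_torus_function[OF mode_torus_function])
  note [measurable] = torus_function.meas2[OF h]
  have hE: "sqrt (energy (h c)) \<le> sqrt r ^ n" for c
  proof -
    have "energy (h c) \<le> r ^ n * energy (mode k c)"
      unfolding h_def by (rule energy_step_avg_power_le(1)[OF gap \<open>0 \<le> r\<close> mode_torus_function integral_mode[OF k]])
    also have "\<dots> \<le> r ^ n * 1"
      using \<open>0 \<le> r\<close> energy_mode_le by (intro mult_left_mono) auto
    finally show ?thesis using real_sqrt_le_mono by (fastforce simp: real_sqrt_power)
  qed
  have inner: "(\<integral>\<omega>. cos (\<theta> \<omega> x - \<theta> \<omega> y) \<partial>?M)
    \<le> \<bar>h 0 (fst x - fst y) (snd x - snd y)\<bar> + \<bar>h (- (pi/2)) (fst x - fst y) (snd x - snd y)\<bar>" for x y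
  proof -
    define z where "z = of_int (fst l) * (fst x - fst y) + of_int (snd l) * (snd x - snd y)"
    let ?m = "\<lambda>c \<omega>. mode k c (fst (lift_flow \<tau> \<omega> n x) - fst (lift_flow \<tau> \<omega> n y)) (snd (lift_flow \<tau> \<omega> n x) - snd (lift_flow \<tau> \<omega> n y))"
    \<comment> \<open>The addition formula separates the deterministic contribution \<open>z\<close>
      of frequency \<open>l\<close> from the random one of frequency \<open>k\<close>.\<close>
    have eq: "cos (\<theta> \<omega> x - \<theta> \<omega> y) = cos z * ?m 0 \<omega> - sin z * ?m (- (pi/2)) \<omega>" for \<omega>
    proof -
      define t where "t = of_int (fst k) * (fst (lift_flow \<tau> \<omega> n x) - fst (lift_flow \<tau> \<omega> n y)) + of_int (snd k) * (snd (lift_flow \<tau> \<omega> n x) - snd (lift_flow \<tau> \<omega> n y))"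
      have 1: "\<theta> \<omega> x - \<theta> \<omega> y = z + t" by (simp add: \<theta>_def z_def t_def algebra_simps)
      have 2: "?m 0 \<omega> = cos t" "?m (- (pi/2)) \<omega> = sin t"
        by (simp_all add: mode_def t_def[symmetric] cos_diff)
      show ?thesis unfolding 1 2 by (rule cos_add)
    qed
    have m: "(\<lambda>\<omega>. lift_flow \<tau> \<omega> n p) \<in> borel_measurable ?M" for p
      using measurable_compose[OF _ lift_flow_measurable[OF order_refl], of "\<lambda>\<omega>. (\<omega>, p)"] by simp
    have mm: "(\<lambda>\<omega>. mode k c (fst (p \<omega>) - fst (q \<omega>)) (snd (p \<omega>) - snd (q \<omega>))) \<in> borel_measurable M"
      if [measurable]: "p \<in> borel_measurable M" "q \<in> borel_measurable M" for c p q and M :: "'z measure"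
      unfolding mode_def by measurable
    have im: "integrable ?M (?m c)" for c
      by (rule n.P.integrable_const_bound[of _ 1, OF _ mm[OF m m]]) (simp add: mode_def)
    have "(\<integral>\<omega>. cos (\<theta> \<omega> x - \<theta> \<omega> y) \<partial>?M) = cos z * (\<integral>\<omega>. ?m 0 \<omega> \<partial>?M) - sin z * (\<integral>\<omega>. ?m (- (pi/2)) \<omega> \<partial>?M)"
      unfolding eq by (simp only: Bochner_Integration.integral_diff[OF integrable_mult_right[OF im] integrable_mult_right[OF im]] integral_mult_right_zero)
    also have "\<dots> = cos z * h 0 (fst x - fst y) (snd x - snd y) - sin z * h (- (pi/2)) (fst x - fst y) (snd x - snd y)"
      unfolding h_def integral_flow_difference[OF mode_torus_function] ..
    also have "\<dots> \<le> \<bar>cos z\<bar> * \<bar>h 0 (fst x - fst y) (snd x - snd y)\<bar> + \<bar>sin z\<bar> * \<bar>h (- (pi/2)) (fst x - fst y) (snd x - snd y)\<bar>"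
      unfolding abs_mult[symmetric] by linarith
    also have "\<dots> \<le> 1 * \<bar>h 0 (fst x - fst y) (snd x - snd y)\<bar> + 1 * \<bar>h (- (pi/2)) (fst x - fst y) (snd x - snd y)\<bar>"
      by (intro add_mono mult_right_mono) auto
    finally show ?thesis by simp
  qed
  have bd: "\<bar>\<integral>\<omega>. cos (\<theta> \<omega> x - \<theta> \<omega> y) \<partial>?M\<bar> \<le> 1" for x y
    by (rule prob_integral_bounded[OF n.P.prob_space_axioms]) auto
  \<comment> \<open>Only the first \<open>n\<close> phases matter, so the infinite product is
    projected to the finite one.\<close>
  have "(\<integral>\<omega>. (norm (correlation \<tau> \<omega> n l k))\<^sup>2 \<partial>phase_seq_measure)
    = (\<integral>\<omega>. (norm (correlation \<tau> (restrict \<omega> {1..n}) n l k))\<^sup>2 \<partial>phase_seq_measure)"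
    by (intro Bochner_Integration.integral_cong refl arg_cong[where f = "\<lambda>z. (norm z)\<^sup>2"] correlation_depends) auto
  also have "\<dots> = (\<integral>\<omega>. (norm (correlation \<tau> \<omega> n l k))\<^sup>2 \<partial>distr phase_seq_measure ?M (\<lambda>\<omega>. restrict \<omega> {1..n}))"
    using correlation_measurable[OF order_refl] unfolding phase_seq_measure_def
    by (subst integral_distr) (auto intro!: measurable_restrict_subset)
  also have "distr phase_seq_measure ?M (\<lambda>\<omega>. restrict \<omega> {1..n}) = ?M"
    unfolding phase_seq_measure_def by (rule inf.distr_PiM_restrict_finite) auto
  also have "(\<integral>\<omega>. (norm (correlation \<tau> \<omega> n l k))\<^sup>2 \<partial>?M) = (\<integral>\<omega>. \<integral>x. \<integral>y. cos (\<theta> \<omega> x - \<theta> \<omega> y) \<partial>torus_prob \<partial>torus_prob \<partial>?M)"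
    unfolding correlation_def trig_def cis_mult \<theta>_def[symmetric] by (simp add: cmod_integral_cis_sq)
  also have "\<dots> = (\<integral>x. \<integral>\<omega>. \<integral>y. cos (\<theta> \<omega> x - \<theta> \<omega> y) \<partial>torus_prob \<partial>?M \<partial>torus_prob)"
  proof (rule prob_Fubini_bounded[where B = 1])
    show "\<bar>\<integral>y. cos (\<theta> \<omega> x - \<theta> \<omega> y) \<partial>torus_prob\<bar> \<le> 1" for \<omega> x
      by (rule prob_integral_bounded[OF torus_prob.prob_space_axioms]) auto
  qed (unfold_locales, measurable)
  also have "\<dots> = (\<integral>x. \<integral>y. \<integral>\<omega>. cos (\<theta> \<omega> x - \<theta> \<omega> y) \<partial>?M \<partial>torus_prob \<partial>torus_prob)"
    by (intro Bochner_Integration.integral_cong refl prob_Fubini_bounded[where B = 1])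
       (unfold_locales, measurable)
  \<comment> \<open>With \<open>y\<close> outermost the inner integral runs over a translate of
    \<open>h c\<close>, for which there is a bound independent of \<open>y\<close>.\<close>
  also have "\<dots> = (\<integral>y. \<integral>x. \<integral>\<omega>. cos (\<theta> \<omega> x - \<theta> \<omega> y) \<partial>?M \<partial>torus_prob \<partial>torus_prob)"
  proof (rule prob_Fubini_bounded[where B = 1])
    show "\<bar>\<integral>\<omega>. cos (\<theta> \<omega> x - \<theta> \<omega> y) \<partial>?M\<bar> \<le> 1" for x y by (rule bd)
  qed (unfold_locales, measurable)
  also have "\<dots> \<le> (\<integral>y. 2 * sqrt r ^ n \<partial>torus_prob)"
  proof (rule integral_mono)
    fix y
    have ih: "integrable torus_prob (\<lambda>x. \<bar>h c (fst x - fst y) (snd x - snd y)\<bar>)" for c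
      using torus_function.bdd2[OF h] by (intro torus_integrable[of _ 1]) auto
    have "(\<integral>x. \<integral>\<omega>. cos (\<theta> \<omega> x - \<theta> \<omega> y) \<partial>?M \<partial>torus_prob)
      \<le> (\<integral>x. \<bar>h 0 (fst x - fst y) (snd x - snd y)\<bar> + \<bar>h (- (pi/2)) (fst x - fst y) (snd x - snd y)\<bar> \<partial>torus_prob)"
      by (rule integral_mono'[OF Bochner_Integration.integrable_add[OF ih ih] inner]) auto
    also have "\<dots> \<le> sqrt r ^ n + sqrt r ^ n"
      unfolding Bochner_Integration.integral_add[OF ih ih]
      by (intro add_mono order_trans[OF torus_function.integral_abs_translate_le[OF h] hE])
    finally show "(\<integral>x. \<integral>\<omega>. cos (\<theta> \<omega> x - \<theta> \<omega> y) \<partial>?M \<partial>torus_prob) \<le> 2 * sqrt r ^ n" by simp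
  next
    show "integrable torus_prob (\<lambda>y. \<integral>x. \<integral>\<omega>. cos (\<theta> \<omega> x - \<theta> \<omega> y) \<partial>?M \<partial>torus_prob)"
    proof (rule torus_integrable)
      show "norm (\<integral>x. \<integral>\<omega>. cos (\<theta> \<omega> x - \<theta> \<omega> y) \<partial>?M \<partial>torus_prob) \<le> 1" for y
        unfolding real_norm_def
        by (rule prob_integral_bounded[OF torus_prob.prob_space_axioms _ bd]) measurable
    qed measurable
  qed simp
  finally show ?thesis by (simp add: torus_prob.prob_space[simplified])
qed

section \<open>Density of trigonometric polynomials\<close>

inductive trig_poly :: "(real \<times> real \<Rightarrow> complex) \<Rightarrow> bool" where
  monomial: "trig_poly (\<lambda>x. c * trig k x)"
| add: "trig_poly p \<Longrightarrow> trig_poly q \<Longrightarrow> trig_poly (\<lambda>x. p x + q x)"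

lemma trig_mult: "trig k x * trig l x = trig (k + l) x"
  by (simp add: trig_def cis_mult algebra_simps)

lemma trig_0 [simp]: "trig 0 x = 1" "trig (0, 0) x = 1"
  by (simp_all add: trig_def)

lemma cnj_trig: "cnj (trig k x) = trig (- k) x"
  by (simp add: trig_def cis_cnj)

lemma trig_poly_mult:
  assumes "trig_poly p" "trig_poly q"
  shows "trig_poly (\<lambda>x. p x * q x)"
  using assms
proof (induction p)
  case (monomial c k)
  then show ?case
  proof (induction q)
    case (monomial d l)
    have "trig_poly (\<lambda>x. (c * d) * trig (k + l) x)" by (rule trig_poly.monomial)
    then show ?case by (simp add: trig_mult[symmetric] mult_ac)
  next
    case (add p q)
    then show ?case by (simp add: distrib_left trig_poly.add)
  qed
next
  case (add p q)
  then show ?case by (simp add: distrib_right trig_poly.add)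
qed

lemma trig_poly_const: "trig_poly (\<lambda>x. c)"
  using trig_poly.monomial[of c 0] by simp

lemma trig_poly_scale: "trig_poly p \<Longrightarrow> trig_poly (\<lambda>x. c * p x)"
  by (rule trig_poly_mult[OF trig_poly_const])

lemma trig_poly_sum_form:
  assumes "trig_poly p"
  obtains K c where "finite K" "p = (\<lambda>x. \<Sum>k\<in>K. c k * trig k x)"
proof -
  have "\<exists>K c. finite K \<and> p = (\<lambda>x. \<Sum>k\<in>K. c k * trig k x)"
    using assms
  proof induction
    case (monomial c k)
    show ?case by (rule exI[of _ "{k}"], rule exI[of _ "\<lambda>_. c"]) simp
  next
    case (add p q)
    then obtain K c L d where *: "finite K" "p = (\<lambda>x. \<Sum>k\<in>K. c k * trig k x)"
      "finite L" "q = (\<lambda>x. \<Sum>k\<in>L. d k * trig k x)" by blast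
    define e where "e k = (if k \<in> K then c k else 0) + (if k \<in> L then d k else 0)" for k
    have "(\<Sum>k\<in>K. c k * trig k x) = (\<Sum>k\<in>K \<union> L. (if k \<in> K then c k else 0) * trig k x)" for x
      using * by (intro sum.mono_neutral_cong_left) auto
    moreover have "(\<Sum>k\<in>L. d k * trig k x) = (\<Sum>k\<in>K \<union> L. (if k \<in> L then d k else 0) * trig k x)" for x
      using * by (intro sum.mono_neutral_cong_left) auto
    ultimately have "(\<lambda>x. p x + q x) = (\<lambda>x. \<Sum>k\<in>K \<union> L. e k * trig k x)"
      unfolding * e_def distrib_right sum.distrib by simp
    with * show ?case by blast
  qed
  then show thesis using that by blast
qed

lemma trig_poly_measurable: "trig_poly p \<Longrightarrow> p \<in> borel_measurable borel"
  by (induction rule: trig_poly.induct) auto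

lemma trig_poly_bounded: "trig_poly p \<Longrightarrow> \<exists>B. \<forall>x. norm (p x) \<le> B"
proof (induction rule: trig_poly.induct)
  case (monomial c k)
  show ?case by (rule exI[of _ "norm c"]) (simp add: norm_mult)
next
  case (add p q)
  then obtain B C where "\<And>x. norm (p x) \<le> B" "\<And>x. norm (q x) \<le> C" by blast
  then have "\<And>x. norm (p x + q x) \<le> B + C" by (meson add_mono norm_triangle_ineq order_trans)
  then show ?case by blast
qed

definition square_integrable :: "(real \<times> real \<Rightarrow> complex) \<Rightarrow> bool" where
  "square_integrable f \<longleftrightarrow> f \<in> borel_measurable borel \<and> integrable torus_prob (\<lambda>x. (norm (f x))\<^sup>2)"

lemma square_integrable_bounded:
  assumes "f \<in> borel_measurable borel" "\<And>x. norm (f x) \<le> B"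
  shows "square_integrable f"
proof -
  have "norm ((norm (f x))\<^sup>2) \<le> B\<^sup>2" for x
    using assms(2)[of x] by (simp add: power_mono)
  then show ?thesis
    using assms(1) unfolding square_integrable_def by (auto intro!: torus_integrable[of _ "B\<^sup>2"])
qed

lemma trig_poly_square_integrable: "trig_poly p \<Longrightarrow> square_integrable p"
  using trig_poly_bounded[of p] trig_poly_measurable[of p] square_integrable_bounded[of p] by blast

lemma norm_add_sq_le: "(norm (a + b :: complex))\<^sup>2 \<le> 2 * (norm a)\<^sup>2 + 2 * (norm b)\<^sup>2"
proof -
  have "(norm (a + b))\<^sup>2 \<le> (norm a + norm b)\<^sup>2"
    by (intro power_mono norm_triangle_ineq) auto
  also have "\<dots> \<le> 2 * (norm a)\<^sup>2 + 2 * (norm b)\<^sup>2" by (rule sq_add_le)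
  finally show ?thesis .
qed

lemma square_integrable_add:
  assumes f: "square_integrable f" and g: "square_integrable g"
  shows "square_integrable (\<lambda>x. f x + g x)"
    and "(\<integral>x. (norm (f x + g x))\<^sup>2 \<partial>torus_prob)
      \<le> 2 * (\<integral>x. (norm (f x))\<^sup>2 \<partial>torus_prob) + 2 * (\<integral>x. (norm (g x))\<^sup>2 \<partial>torus_prob)"
proof -
  have [measurable]: "f \<in> borel_measurable borel" "g \<in> borel_measurable borel"
    using f g by (auto simp: square_integrable_def)
  have if': "integrable torus_prob (\<lambda>x. (norm (f x))\<^sup>2)" and ig: "integrable torus_prob (\<lambda>x. (norm (g x))\<^sup>2)"
    using f g by (auto simp: square_integrable_def)
  have i: "integrable torus_prob (\<lambda>x. 2 * (norm (f x))\<^sup>2 + 2 * (norm (g x))\<^sup>2)"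
    using if' ig by auto
  have i': "integrable torus_prob (\<lambda>x. (norm (f x + g x))\<^sup>2)"
    by (rule Bochner_Integration.integrable_bound[OF i]) (auto intro!: order_trans[OF norm_add_sq_le])
  show "square_integrable (\<lambda>x. f x + g x)"
    unfolding square_integrable_def using i' by auto
  have "(\<integral>x. (norm (f x + g x))\<^sup>2 \<partial>torus_prob) \<le> (\<integral>x. 2 * (norm (f x))\<^sup>2 + 2 * (norm (g x))\<^sup>2 \<partial>torus_prob)"
    by (rule integral_mono[OF i' i norm_add_sq_le])
  then show "(\<integral>x. (norm (f x + g x))\<^sup>2 \<partial>torus_prob)
      \<le> 2 * (\<integral>x. (norm (f x))\<^sup>2 \<partial>torus_prob) + 2 * (\<integral>x. (norm (g x))\<^sup>2 \<partial>torus_prob)"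
    using if' ig by simp
qed

lemma square_integrable_scale: "square_integrable f \<Longrightarrow> square_integrable (\<lambda>x. c * f x)"
  by (auto simp: square_integrable_def norm_mult power_mult_distrib)

lemma square_integrable_diff:
  "square_integrable f \<Longrightarrow> square_integrable g \<Longrightarrow> square_integrable (\<lambda>x. f x - g x)"
  using square_integrable_add(1)[of f "\<lambda>x. -1 * g x"] square_integrable_scale[of g "-1"] by simp

text \<open>The L2 closure of the trigonometric polynomials. The class is enlarged in stages:
  continuous functions, indicators of open and then Borel sets, simple functions, and finally all of
  L2.\<close>

definition approximable :: "(real \<times> real \<Rightarrow> complex) \<Rightarrow> bool" where
  "approximable f \<longleftrightarrow> square_integrable f \<and>
    (\<forall>\<epsilon>>0. \<exists>p. trig_poly p \<and> (\<integral>x. (norm (f x - p x))\<^sup>2 \<partial>torus_prob) < \<epsilon>)"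

lemma approximable_trig_poly: "trig_poly p \<Longrightarrow> approximable p"
  unfolding approximable_def using trig_poly_square_integrable[of p] by (auto intro!: exI[of _ p])

lemma approximable_add:
  assumes "approximable f" "approximable g"
  shows "approximable (\<lambda>x. f x + g x)"
  unfolding approximable_def
proof (intro conjI allI impI)
  have si: "square_integrable f" "square_integrable g" using assms by (auto simp: approximable_def)
  then show "square_integrable (\<lambda>x. f x + g x)" by (rule square_integrable_add(1))
  fix \<epsilon> :: real assume "\<epsilon> > 0"
  then have "\<epsilon> / 4 > 0" by simp
  with assms obtain p q where p: "trig_poly p" "(\<integral>x. (norm (f x - p x))\<^sup>2 \<partial>torus_prob) < \<epsilon> / 4"
    and q: "trig_poly q" "(\<integral>x. (norm (g x - q x))\<^sup>2 \<partial>torus_prob) < \<epsilon> / 4"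
    unfolding approximable_def by blast
  have "(\<integral>x. (norm ((f x - p x) + (g x - q x)))\<^sup>2 \<partial>torus_prob) < \<epsilon>"
    using square_integrable_add(2)[OF square_integrable_diff[OF si(1) trig_poly_square_integrable[OF p(1)]]
       square_integrable_diff[OF si(2) trig_poly_square_integrable[OF q(1)]]] p(2) q(2) by linarith
  moreover have "(f x - p x) + (g x - q x) = f x + g x - (p x + q x)" for x by simp
  ultimately show "\<exists>r. trig_poly r \<and> (\<integral>x. (norm (f x + g x - r x))\<^sup>2 \<partial>torus_prob) < \<epsilon>"
    using trig_poly.add[OF p(1) q(1)] by (intro exI[of _ "\<lambda>x. p x + q x"]) simp
qed

lemma approximable_limit:
  assumes f: "square_integrable f"
    and lim: "\<And>\<epsilon>. \<epsilon> > 0 \<Longrightarrow> \<exists>g. approximable g \<and> (\<integral>x. (norm (f x - g x))\<^sup>2 \<partial>torus_prob) < \<epsilon>"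
  shows "approximable f"
  unfolding approximable_def
proof (intro conjI allI impI f)
  fix \<epsilon> :: real assume "\<epsilon> > 0"
  then have e4: "\<epsilon> / 4 > 0" by simp
  from lim[OF this] obtain g where g: "approximable g" "(\<integral>x. (norm (f x - g x))\<^sup>2 \<partial>torus_prob) < \<epsilon> / 4" by blast
  with e4 obtain p where p: "trig_poly p" "(\<integral>x. (norm (g x - p x))\<^sup>2 \<partial>torus_prob) < \<epsilon> / 4"
    unfolding approximable_def by blast
  have sg: "square_integrable g" using g by (simp add: approximable_def)
  have "(\<integral>x. (norm ((f x - g x) + (g x - p x)))\<^sup>2 \<partial>torus_prob) < \<epsilon>"
    using square_integrable_add(2)[OF square_integrable_diff[OF f sg]
       square_integrable_diff[OF sg trig_poly_square_integrable[OF p(1)]]] p(2) g(2) by linarith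
  then show "\<exists>p. trig_poly p \<and> (\<integral>x. (norm (f x - p x))\<^sup>2 \<partial>torus_prob) < \<epsilon>"
    using p(1) by auto
qed

lemma approximable_scale:
  assumes "approximable f"
  shows "approximable (\<lambda>x. c * f x)"
proof (cases "c = 0")
  case False
  have si: "square_integrable f" using assms by (simp add: approximable_def)
  show ?thesis
    unfolding approximable_def
  proof (intro conjI allI impI square_integrable_scale si)
    fix \<epsilon> :: real assume "\<epsilon> > 0"
    then have "\<epsilon> / (norm c)\<^sup>2 > 0" using False by simp
    with assms obtain p where p: "trig_poly p" "(\<integral>x. (norm (f x - p x))\<^sup>2 \<partial>torus_prob) < \<epsilon> / (norm c)\<^sup>2"
      unfolding approximable_def by blast
    have "(\<integral>x. (norm (c * f x - c * p x))\<^sup>2 \<partial>torus_prob) = (norm c)\<^sup>2 * (\<integral>x. (norm (f x - p x))\<^sup>2 \<partial>torus_prob)"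
      by (simp flip: right_diff_distrib add: norm_mult power_mult_distrib)
    also have "\<dots> < \<epsilon>" using p(2) False by (simp add: field_simps)
    finally show "\<exists>q. trig_poly q \<and> (\<integral>x. (norm (c * f x - q x))\<^sup>2 \<partial>torus_prob) < \<epsilon>"
      using trig_poly_scale[OF p(1)] by blast
  qed
qed (use approximable_trig_poly[OF trig_poly_const[of 0]] in simp)

text \<open>Dominated convergence upgrades pointwise limits with a common L2 majorant to L2 limits;
  \<open>4 * (g x)^2\<close> dominates the squared differences.\<close>

lemma approximable_dominated:
  assumes F: "\<And>m::nat. approximable (F m)" and [measurable]: "f \<in> borel_measurable borel"
    and lim: "\<And>x. (\<lambda>m. F m x) \<longlonglongrightarrow> f x"
    and dom: "\<And>m x. norm (F m x) \<le> g x" and g: "integrable torus_prob (\<lambda>x. (g x)\<^sup>2)"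
  shows "approximable f"
proof (rule approximable_limit)
  have Fm [measurable]: "F m \<in> borel_measurable borel" for m
    using F by (simp add: approximable_def square_integrable_def)
  have fg: "norm (f x) \<le> g x" for x
    by (rule tendsto_upperbound[OF tendsto_norm[OF lim]]) (auto simp: dom)
  then have gnn: "0 \<le> g x" for x using norm_ge_zero order_trans by blast
  show "square_integrable f"
    unfolding square_integrable_def
  proof (intro conjI, fact, rule Bochner_Integration.integrable_bound[OF g])
    show "AE x in torus_prob. norm ((norm (f x))\<^sup>2) \<le> norm ((g x)\<^sup>2)"
      using fg by (auto intro!: power_mono)
  qed measurable
  have "(\<lambda>m. \<integral>x. (norm (f x - F m x))\<^sup>2 \<partial>torus_prob) \<longlonglongrightarrow> (\<integral>x. 0 \<partial>torus_prob)"
  proof (rule integral_dominated_convergence[where w = "\<lambda>x. 4 * (g x)\<^sup>2"])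
    show "integrable torus_prob (\<lambda>x. 4 * (g x)\<^sup>2)" using g by simp
    show "AE x in torus_prob. (\<lambda>m. (norm (f x - F m x))\<^sup>2) \<longlonglongrightarrow> 0"
    proof (rule AE_I2)
      fix x
      have "(\<lambda>m. (norm (f x - F m x))\<^sup>2) \<longlonglongrightarrow> (norm (f x - f x))\<^sup>2"
        by (intro tendsto_intros lim)
      then show "(\<lambda>m. (norm (f x - F m x))\<^sup>2) \<longlonglongrightarrow> 0" by simp
    qed
    show "AE x in torus_prob. norm ((norm (f x - F m x))\<^sup>2) \<le> 4 * (g x)\<^sup>2" for m
    proof (rule AE_I2)
      fix x
      have "norm (f x - F m x) \<le> norm (f x) + norm (F m x)" by (rule norm_triangle_ineq4)
      also have "\<dots> \<le> 2 * g x" using fg[of x] dom[of m x] by simp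
      finally have "(norm (f x - F m x))\<^sup>2 \<le> (2 * g x)\<^sup>2" by (intro power_mono) auto
      then show "norm ((norm (f x - F m x))\<^sup>2) \<le> 4 * (g x)\<^sup>2" by (simp add: power_mult_distrib)
    qed
  qed measurable
  then have lim0: "(\<lambda>m. \<integral>x. (norm (f x - F m x))\<^sup>2 \<partial>torus_prob) \<longlonglongrightarrow> 0" by simp
  fix \<epsilon> :: real assume "\<epsilon> > 0"
  then obtain m where "(\<integral>x. (norm (f x - F m x))\<^sup>2 \<partial>torus_prob) < \<epsilon>"
    using order_tendstoD(2)[OF lim0] eventually_happens'[OF sequentially_bot] by blast
  then show "\<exists>g. approximable g \<and> (\<integral>x. (norm (f x - g x))\<^sup>2 \<partial>torus_prob) < \<epsilon>"
    using F by blast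
qed

text \<open>Realises the torus as a compact subset of \<open>C^2\<close>, so that Stone-Weierstrass
  applies without treating the identified edges of the square.\<close>

definition torus_embed :: "real \<times> real \<Rightarrow> complex \<times> complex" where
  "torus_embed x = (cis (fst x), cis (snd x))"

lemma torus_embed_measurable [measurable]: "torus_embed \<in> borel_measurable borel"
  unfolding torus_embed_def cis_conv_exp
  by (intro borel_measurable_continuous_onI continuous_intros)

text \<open>The real and imaginary parts of the two coordinates become trigonometric polynomials on
  the torus and separate the points of the product of circles.\<close>

lemma approximable_continuous:
  fixes f :: "complex \<times> complex \<Rightarrow> real"
  assumes cont: "continuous_on UNIV f"
  shows "approximable (\<lambda>x. of_real (f (torus_embed x)))"
proof -
  define S :: "(complex \<times> complex) set" where "S = sphere 0 1 \<times> sphere 0 1"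
  have S: "compact S" unfolding S_def by (intro compact_Times) auto
  have inS: "torus_embed x \<in> S" for x by (simp add: torus_embed_def S_def)
  define P where "P g \<longleftrightarrow> continuous_on S g \<and> trig_poly (\<lambda>x. of_real (g (torus_embed x)))" for g :: "complex \<times> complex \<Rightarrow> real"
  have Re_cis: "complex_of_real (cos t) = 1/2 * cis t + 1/2 * cis (- t)"
    and Im_cis: "complex_of_real (sin t) = (- \<i>/2) * cis t + \<i>/2 * cis (- t)" for t
    by (auto simp: complex_eq_iff)
  have tp: "trig_poly (\<lambda>x. a * trig k x + b * trig l x)" for a b k l
    by (intro trig_poly.intros)
  have coord: "P (\<lambda>z. Re (fst z))" "P (\<lambda>z. Im (fst z))" "P (\<lambda>z. Re (snd z))" "P (\<lambda>z. Im (snd z))"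
    unfolding P_def torus_embed_def
    using tp[of "1/2" "(1,0)" "1/2" "(-1,0)"] tp[of "-\<i>/2" "(1,0)" "\<i>/2" "(-1,0)"]
      tp[of "1/2" "(0,1)" "1/2" "(0,-1)"] tp[of "-\<i>/2" "(0,1)" "\<i>/2" "(0,-1)"]
    by (auto simp: Re_cis Im_cis trig_def intro!: continuous_intros)
  have bdd: "\<exists>g. P g \<and> (\<forall>z\<in>S. \<bar>f z - g z\<bar> < e)" if "e > 0" for e
  proof (rule Stone_Weierstrass_HOL[OF S, of P])
    show "P (\<lambda>x. c)" for c using trig_poly_const by (simp add: P_def)
    show "continuous_on S g" if "P g" for g using that by (simp add: P_def)
    show "P (\<lambda>x. g x + h x)" if "P g \<and> P h" for g h
      using that by (auto simp: P_def intro!: continuous_intros trig_poly.add)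
    show "P (\<lambda>x. g x * h x)" if "P g \<and> P h" for g h
      using that by (auto simp: P_def intro!: continuous_intros trig_poly_mult)
    show "\<exists>g. P g \<and> g x \<noteq> g y" if "x \<in> S \<and> y \<in> S \<and> x \<noteq> y" for x y
    proof -
      from that have "Re (fst x) \<noteq> Re (fst y) \<or> Im (fst x) \<noteq> Im (fst y) \<or> Re (snd x) \<noteq> Re (snd y) \<or> Im (snd x) \<noteq> Im (snd y)"
        by (auto simp: prod_eq_iff complex_eq_iff)
      then show ?thesis using coord by blast
    qed
    show "continuous_on S f" using cont continuous_on_subset by blast
  qed (use that in auto)
  have fb: "\<exists>B. \<forall>z\<in>S. \<bar>f z\<bar> \<le> B"
    using compact_imp_bounded[OF compact_continuous_image[OF continuous_on_subset[OF cont] S]]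
    by (auto simp: bounded_iff)
  have [measurable]: "f \<in> borel_measurable borel" using cont by (rule borel_measurable_continuous_onI)
  show ?thesis
  proof (rule approximable_limit)
    from fb obtain B where B: "\<And>z. z \<in> S \<Longrightarrow> \<bar>f z\<bar> \<le> B" by blast
    show "square_integrable (\<lambda>x. of_real (f (torus_embed x)))"
      by (rule square_integrable_bounded[of _ B]) (use B inS in auto)
    fix \<epsilon> :: real assume e: "\<epsilon> > 0"
    obtain g where g: "P g" "\<And>z. z \<in> S \<Longrightarrow> \<bar>f z - g z\<bar> < sqrt (\<epsilon>/2)"
      using bdd[of "sqrt (\<epsilon>/2)"] e by auto
    have tg: "trig_poly (\<lambda>x. of_real (g (torus_embed x)))" using g by (simp add: P_def)
    have sq: "(norm (complex_of_real (f (torus_embed x)) - of_real (g (torus_embed x))))\<^sup>2 \<le> \<epsilon>/2" for x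
    proof -
      have "norm (complex_of_real (f (torus_embed x)) - of_real (g (torus_embed x))) \<le> sqrt (\<epsilon>/2)"
        using g(2)[OF inS[of x]] by (simp flip: of_real_diff)
      then have "(norm (complex_of_real (f (torus_embed x)) - of_real (g (torus_embed x))))\<^sup>2 \<le> (sqrt (\<epsilon>/2))\<^sup>2"
        by (intro power_mono) auto
      then show ?thesis using e by simp
    qed
    have "(\<integral>x. (norm (complex_of_real (f (torus_embed x)) - of_real (g (torus_embed x))))\<^sup>2 \<partial>torus_prob) \<le> (\<integral>x. \<epsilon>/2 \<partial>torus_prob)"
      by (rule integral_mono') (use sq e in auto)
    also have "\<dots> < \<epsilon>" using e by (simp add: torus_prob.prob_space[simplified])
    finally show "\<exists>h. approximable h \<and> (\<integral>x. (norm (complex_of_real (f (torus_embed x)) - h x))\<^sup>2 \<partial>torus_prob) < \<epsilon>"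
      using approximable_trig_poly[OF tg] by blast
  qed
qed

text \<open>The functions \<open>min 1 (m * dist (z, - A))\<close> are continuous and increase to
  the indicator of an open set.\<close>

lemma approximable_open_indicator:
  assumes "open A"
  shows "approximable (\<lambda>x. indicator A (torus_embed x))"
\<comment> \<open>\<open>infdist\<close> to the empty set is 0 by convention, so the full space is
  treated separately.\<close>
proof (cases "A = UNIV")
  case True
  then show ?thesis using approximable_trig_poly[OF trig_poly_const[of 1]] by simp
next
  case False
  then have ne: "- A \<noteq> {}" by auto
  have cl: "closed (- A)" using assms by auto
  define F :: "nat \<Rightarrow> complex \<times> complex \<Rightarrow> real" where "F m z = min 1 (real m * infdist z (- A))" for m z
  have [measurable]: "A \<in> sets borel" using assms by auto
  show ?thesis
  proof (rule approximable_dominated[where F = "\<lambda>m x. of_real (F m (torus_embed x))" and g = "\<lambda>_. 1"])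
    show "approximable (\<lambda>x. of_real (F m (torus_embed x)))" for m
      by (rule approximable_continuous) (auto simp: F_def intro!: continuous_intros)
    show "norm (complex_of_real (F m (torus_embed x))) \<le> 1" for m x
      using infdist_nonneg[of "torus_embed x" "- A"] by (simp add: F_def min_def)
    show "(\<lambda>m. complex_of_real (F m (torus_embed x))) \<longlonglongrightarrow> indicator A (torus_embed x)" for x
    proof (cases "torus_embed x \<in> A")
      case True
      then have "infdist (torus_embed x) (- A) > 0"
        using infdist_pos_not_in_closed[OF cl ne] by auto
      then obtain m0 :: nat where m0: "1 / infdist (torus_embed x) (- A) \<le> real m0" "0 < infdist (torus_embed x) (- A)"
        using real_arch_simple by blast
      have "F m (torus_embed x) = 1" if "m \<ge> m0" for m
      proof -
        have "1 \<le> real m0 * infdist (torus_embed x) (- A)" using m0 by (simp add: field_simps)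
        also have "\<dots> \<le> real m * infdist (torus_embed x) (- A)" using that m0 by (intro mult_right_mono) auto
        finally show ?thesis by (simp add: F_def)
      qed
      then have "eventually (\<lambda>m. complex_of_real (F m (torus_embed x)) = indicator A (torus_embed x)) sequentially"
        using True by (auto simp: eventually_sequentially)
      then show ?thesis by (rule tendsto_eventually)
    next
      case False
      then have "F m (torus_embed x) = 0" for m by (simp add: F_def)
      with False show ?thesis by simp
    qed
  qed auto
qed

text \<open>Dynkin's pi-lambda argument: open sets are stable under intersection and generate, and
  the sets with approximable indicator are closed under complements and countable disjoint
  unions.\<close>

lemma approximable_borel_indicator:
  assumes "A \<in> sets borel"
  shows "approximable (\<lambda>x. indicator A (torus_embed x))"
proof -
  have "A \<in> sigma_sets UNIV {S :: (complex \<times> complex) set. open S}"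
    using assms by (simp add: borel_def)
  then show ?thesis
  proof (rule sigma_sets_induct_disjoint[rotated 2])
    show "Int_stable {S :: (complex \<times> complex) set. open S}" by (auto simp: Int_stable_def)
  next
    fix A :: "(complex \<times> complex) set" assume "A \<in> {S. open S}"
    then show "approximable (\<lambda>x. indicator A (torus_embed x))"
      using approximable_open_indicator by simp
  next
    show "approximable (\<lambda>x. indicator {} (torus_embed x))"
      using approximable_trig_poly[OF trig_poly_const[of 0]] by simp
  next
    fix A assume "approximable (\<lambda>x. indicator A (torus_embed x))"
    then have "approximable (\<lambda>x. 1 + (-1) * indicator A (torus_embed x))"
      by (intro approximable_add approximable_scale approximable_trig_poly[OF trig_poly_const])
    moreover have "(\<lambda>x. 1 + (-1) * indicator A (torus_embed x)) = (\<lambda>x. indicator (UNIV - A) (torus_embed x) :: complex)"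
      by (auto split: split_indicator)
    ultimately show "approximable (\<lambda>x. indicator (UNIV - A) (torus_embed x))" by simp
  next
    fix A :: "nat \<Rightarrow> (complex \<times> complex) set"
    assume disj: "disjoint_family A" and A: "range A \<subseteq> sigma_sets UNIV {S. open S}"
      and app: "\<And>i. approximable (\<lambda>x. indicator (A i) (torus_embed x))"
    have [measurable]: "A i \<in> sets borel" for i using A by (auto simp: borel_def)
    have sums: "(\<lambda>i. indicator (A i) z :: complex) sums indicator (\<Union>i. A i) z" for z
    proof (cases "z \<in> (\<Union>i. A i)")
      case True
      then obtain j where j: "z \<in> A j" by blast
      then have "z \<in> A i \<longleftrightarrow> i = j" for i
        using disj by (auto simp: disjoint_family_on_def)
      then have "(\<lambda>i. indicator (A i) z) = (\<lambda>i. if i = j then 1 else 0 :: complex)"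
        by (auto simp: indicator_def)
      moreover have "(\<lambda>i. if i = j then 1 else 0 :: complex) sums 1" by (rule sums_single)
      ultimately show ?thesis using True by simp
    qed auto
    have le1: "norm (\<Sum>i<m. indicator (A i) z :: complex) \<le> 1" for m z
    proof (cases "z \<in> (\<Union>i\<in>{..<m}. A i)")
      case True
      then obtain j where j: "z \<in> A j" "j < m" by blast
      then have "z \<in> A i \<longleftrightarrow> i = j" for i
        using disj by (auto simp: disjoint_family_on_def)
      then have "(\<Sum>i<m. indicator (A i) z :: complex) = (\<Sum>i<m. if i = j then 1 else 0)"
        by (intro sum.cong) (auto simp: indicator_def)
      then show ?thesis using j by simp
    next
      case False
      then have "(\<Sum>i<m. indicator (A i) z :: complex) = 0" by (intro sum.neutral) auto
      then show ?thesis by simp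
    qed
    show "approximable (\<lambda>x. indicator (\<Union> (range A)) (torus_embed x))"
    proof (rule approximable_dominated[where F = "\<lambda>m x. \<Sum>i<m. indicator (A i) (torus_embed x)" and g = "\<lambda>_. 1"])
      show "approximable (\<lambda>x. \<Sum>i<m. indicator (A i) (torus_embed x))" for m
        by (induction m) (use approximable_trig_poly[OF trig_poly_const[of 0]] approximable_add app in auto)
      show "(\<lambda>m. \<Sum>i<m. indicator (A i) (torus_embed x)) \<longlonglongrightarrow> (indicator (\<Union> (range A)) (torus_embed x) :: complex)" for x
        using sums[of "torus_embed x"] by (simp add: sums_def)
      have "\<Union> (range A) \<in> sets borel" by auto
      then show "(\<lambda>x. indicator (\<Union> (range A)) (torus_embed x)) \<in> borel_measurable borel"
        by (intro measurable_compose[OF torus_embed_measurable] borel_measurable_indicator)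
    qed (rule le1, simp)
  qed auto
qed

text \<open>A Borel inverse of \<open>cis\<close> on \<open>[0, 2*pi)\<close>. Clamping the argument
  of \<open>arccos\<close> to [-1, 1] makes the function measurable on the whole plane.\<close>

definition circle_angle :: "complex \<Rightarrow> real" where
  "circle_angle z = (if 0 \<le> Im z then arccos (max (-1) (min 1 (Re z))) else 2*pi - arccos (max (-1) (min 1 (Re z))))"

lemma circle_angle_measurable [measurable]: "circle_angle \<in> borel_measurable borel"
proof -
  have "continuous_on UNIV (\<lambda>x::real. arccos (max (-1) (min 1 x)))"
    by (rule continuous_on_arccos) (auto intro!: continuous_intros)
  from borel_measurable_continuous_onI[OF this]
  have [measurable]: "(\<lambda>x::real. arccos (max (-1) (min 1 x))) \<in> borel_measurable borel" .
  show ?thesis unfolding circle_angle_def by measurable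
qed

lemma circle_angle_cis: "0 \<le> t \<Longrightarrow> t < 2*pi \<Longrightarrow> circle_angle (cis t) = t"
proof -
  assume t: "0 \<le> t" "t < 2*pi"
  have cl: "max (-1) (min 1 (cos t)) = cos t" using cos_le_one[of t] cos_ge_minus_one[of t] by linarith
  show ?thesis
  proof (cases "t \<le> pi")
    case True
    then show ?thesis using t sin_ge_zero[of t] cl by (simp add: circle_angle_def arccos_cos)
  next
    case False
    then have s: "sin t < 0" using t sin_lt_zero by simp
    have "arccos (cos (2*pi - t)) = 2*pi - t" using False t by (intro arccos_cos) auto
    then have "arccos (cos t) = 2*pi - t" by (simp add: cos_diff)
    with s cl show ?thesis by (simp add: circle_angle_def)
  qed
qed

lemma AE_torus_prob_torus: "AE x in torus_prob. x \<in> torus"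
  by (subst AE_torus_prob_iff) (auto simp: Collect_neg_eq)

lemma approximable_cong_AE:
  assumes f: "approximable f" and [measurable]: "g \<in> borel_measurable borel" and ae: "AE x in torus_prob. f x = g x"
  shows "approximable g"
proof -
  have [measurable]: "f \<in> borel_measurable borel" using f by (simp add: approximable_def square_integrable_def)
  have 1: "integrable torus_prob (\<lambda>x. (norm (f x))\<^sup>2) \<longleftrightarrow> integrable torus_prob (\<lambda>x. (norm (g x))\<^sup>2)"
    by (rule integrable_cong_AE) (use ae in auto)
  have 2: "(\<integral>x. (norm (f x - p x))\<^sup>2 \<partial>torus_prob) = (\<integral>x. (norm (g x - p x))\<^sup>2 \<partial>torus_prob)" if "trig_poly p" for p
    by (rule integral_cong_AE) (use ae trig_poly_measurable[OF that] in auto)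
  show ?thesis
    using f unfolding approximable_def square_integrable_def by (simp add: 1) (metis 2)
qed

text \<open>The set is carried into \<open>C^2\<close> by pulling it back along the measurable
  angles; the two indicators agree on the square, which has full measure.\<close>

lemma approximable_indicator:
  assumes [measurable]: "A \<in> sets borel"
  shows "approximable (indicator A)"
proof -
  have M [measurable]: "(\<lambda>z. (circle_angle (fst z), circle_angle (snd z))) \<in> (borel :: (complex \<times> complex) measure) \<rightarrow>\<^sub>M borel"
    by (intro borel_measurable_Pair measurable_compose[OF _ circle_angle_measurable] borel_measurable_continuous_onI continuous_intros)
  define A' where "A' = {z. (circle_angle (fst z), circle_angle (snd z)) \<in> A}"
  have "A' \<in> sets borel"
    using measurable_sets[OF M assms] by (simp add: A'_def vimage_def)
  from approximable_borel_indicator[OF this] show ?thesis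
  proof (rule approximable_cong_AE)
    show "AE x in torus_prob. indicator A' (torus_embed x) = (indicator A x :: complex)"
      using AE_torus_prob_torus
    proof eventually_elim
      case (elim x)
      then have "circle_angle (cis (fst x)) = fst x" "circle_angle (cis (snd x)) = snd x"
        by (auto simp: torus_def circle_angle_cis)
      then show ?case by (simp add: A'_def torus_embed_def indicator_def)
    qed
  qed measurable
qed

lemma square_integrable_approximable:
  assumes "square_integrable f"
  shows "approximable f"
proof -
  have [measurable]: "f \<in> borel_measurable borel" and f: "integrable torus_prob (\<lambda>x. (norm (f x))\<^sup>2)"
    using assms by (auto simp: square_integrable_def)
  obtain F where F: "\<And>i. simple_function borel (F i)" "\<And>x. (\<lambda>i. F i x) \<longlonglongrightarrow> f x"
    "\<And>i x. dist (F i x) 0 \<le> 2 * dist (f x) 0"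
    using borel_measurable_implies_sequence_metric[of f borel 0] by auto
  show ?thesis
  proof (rule approximable_dominated[where F = F and g = "\<lambda>x. 2 * norm (f x)"])
    show "approximable (F i)" for i
    proof -
      have fin: "finite (range (F i))" and meas: "F i -` {y} \<in> sets borel" for y
        using F(1)[of i] borel_measurable_simple_function[OF F(1)[of i]]
        by (auto simp: simple_function_def intro: measurable_sets_borel)
      have "approximable (\<lambda>x. \<Sum>y\<in>Y. y * indicator (F i -` {y}) x)" if "finite Y" for Y
        using that
      proof induction
        case empty
        show ?case using approximable_trig_poly[OF trig_poly_const[of 0]] by simp
      next
        case (insert y Y)
        show ?case
          unfolding sum.insert[OF insert.hyps]
          by (rule approximable_add[OF approximable_scale[OF approximable_indicator[OF meas]] insert.IH])
      qed
      from this[OF fin] have "approximable (\<lambda>x. \<Sum>y\<in>range (F i). y * indicator (F i -` {y}) x)" .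
      also have "(\<lambda>x. \<Sum>y\<in>range (F i). y * indicator (F i -` {y}) x) = F i"
      proof
        fix x
        have "(\<Sum>y\<in>range (F i). y * indicator (F i -` {y}) x) = (\<Sum>y\<in>range (F i). if y = F i x then y else 0)"
          by (intro sum.cong) (auto split: split_indicator)
        then show "(\<Sum>y\<in>range (F i). y * indicator (F i -` {y}) x) = F i x"
          using fin by simp
      qed
      finally show ?thesis .
    qed
    show "integrable torus_prob (\<lambda>x. (2 * norm (f x))\<^sup>2)"
      using f by (simp add: power_mult_distrib)
  qed (use F in \<open>auto simp: dist_norm\<close>)
qed

section \<open>Fourier coefficients\<close>

lemma trig_cnj_mult: "trig k x * cnj (trig l x) = trig (k - l) x"
  by (simp add: cnj_trig trig_mult)

lemma integral_trig: "(\<integral>x. trig k x \<partial>torus_prob) = (if k = 0 then 1 else 0)"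
proof (cases "k = 0")
  case True
  then show ?thesis by (simp add: torus_prob.prob_space[simplified])
next
  case False
  then have k: "k \<noteq> (0, 0)" by (simp add: zero_prod_def)
  have i: "integrable torus_prob (trig k)" by (rule torus_integrable[of _ 1]) auto
  have m: "(\<integral>x. mode k c (fst x) (snd x) \<partial>torus_prob) = 0" for c
  proof -
    have "(\<integral>x. mode k c (fst x) (snd x) \<partial>torus_prob) = (\<integral>v. \<integral>u. mode k c u v \<partial>circ \<partial>circ)"
      by (subst torus_prob_iterated(2)[where B = 1]) (auto simp: mode_def)
    then show ?thesis by (simp add: integral_mode[OF k])
  qed
  have "(\<integral>x. Re (trig k x) \<partial>torus_prob) = 0"
    using m[of 0] by (simp add: trig_def mode_def)
  then have "Re (\<integral>x. trig k x \<partial>torus_prob) = 0"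
    by (simp only: integral_Re[OF i])
  moreover have "(\<integral>x. Im (trig k x) \<partial>torus_prob) = 0"
    using m[of "- (pi/2)"] by (simp add: trig_def mode_def cos_diff)
  then have "Im (\<integral>x. trig k x \<partial>torus_prob) = 0"
    by (simp only: integral_Im[OF i])
  ultimately show ?thesis using False by (simp add: complex_eq_iff)
qed

text \<open>Normalised by the probability measure, so that Parseval carries no constants;
  \<open>fourier_coeff\<close> is \<open>2 * pi\<close> times this.\<close>

definition coef :: "(real \<times> real \<Rightarrow> complex) \<Rightarrow> int \<times> int \<Rightarrow> complex" where
  "coef f k = (\<integral>x. f x * cnj (trig k x) \<partial>torus_prob)"

definition l2_sq :: "(real \<times> real \<Rightarrow> complex) \<Rightarrow> real" where
  "l2_sq f = (\<integral>x. (norm (f x))\<^sup>2 \<partial>torus_prob)"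

lemma l2_sq_nonneg [simp]: "0 \<le> l2_sq f"
  unfolding l2_sq_def by simp

lemma square_integrable_mult:
  assumes "square_integrable f" "square_integrable g"
  shows "integrable torus_prob (\<lambda>x. f x * g x)"
    and "norm (\<integral>x. f x * g x \<partial>torus_prob) \<le> sqrt (l2_sq f) * sqrt (l2_sq g)"
proof -
  have [measurable]: "f \<in> borel_measurable borel" "g \<in> borel_measurable borel"
    and i: "integrable torus_prob (\<lambda>x. (norm (f x))\<^sup>2)" "integrable torus_prob (\<lambda>x. (norm (g x))\<^sup>2)"
    using assms by (auto simp: square_integrable_def)
  have CS: "integrable torus_prob (\<lambda>x. norm (f x) * norm (g x))"
    "(\<integral>x. norm (f x) * norm (g x) \<partial>torus_prob)\<^sup>2 \<le> l2_sq f * l2_sq g"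
    unfolding l2_sq_def by (rule Cauchy_Schwarz_integral; (rule i | measurable))+
  then show fg: "integrable torus_prob (\<lambda>x. f x * g x)"
    by (subst integrable_norm_iff[symmetric]) (auto simp: norm_mult)
  have "norm (\<integral>x. f x * g x \<partial>torus_prob) \<le> (\<integral>x. norm (f x) * norm (g x) \<partial>torus_prob)"
    using integral_norm_bound[of torus_prob "\<lambda>x. f x * g x"] by (simp add: norm_mult)
  also have "\<dots> \<le> sqrt (l2_sq f * l2_sq g)"
    by (rule real_le_rsqrt[OF CS(2)])
  finally show "norm (\<integral>x. f x * g x \<partial>torus_prob) \<le> sqrt (l2_sq f) * sqrt (l2_sq g)"
    by (simp add: real_sqrt_mult)
qed

lemma square_integrable_trig: "square_integrable (trig k)"
  by (rule square_integrable_bounded[of _ 1]) auto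

lemma square_integrable_cnj: "square_integrable f \<Longrightarrow> square_integrable (\<lambda>x. cnj (f x))"
  unfolding square_integrable_def
  using measurable_compose[OF _ borel_measurable_continuous_onI[OF continuous_on_cnj[OF continuous_on_id]]]
  by auto

definition trig_sum :: "(int \<times> int) set \<Rightarrow> (int \<times> int \<Rightarrow> complex) \<Rightarrow> real \<times> real \<Rightarrow> complex" where
  "trig_sum K c x = (\<Sum>k\<in>K. c k * trig k x)"

lemma trig_sum_square_integrable: "square_integrable (trig_sum K c)"
proof (rule square_integrable_bounded)
  show "trig_sum K c \<in> borel_measurable borel" unfolding trig_sum_def by measurable
  show "norm (trig_sum K c x) \<le> (\<Sum>k\<in>K. norm (c k))" for x
    unfolding trig_sum_def by (rule order_trans[OF norm_sum]) (simp add: norm_mult)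
qed

lemma l2_sq_trig_sum:
  assumes "finite K"
  shows "l2_sq (trig_sum K c) = (\<Sum>k\<in>K. (norm (c k))\<^sup>2)"
proof -
  have i: "integrable torus_prob (\<lambda>x. (c k * cnj (c l)) * trig (k - l) x)" for k l
    by (intro integrable_mult_right torus_integrable[of _ 1]) auto
  have eq: "complex_of_real ((norm (trig_sum K c x))\<^sup>2) = (\<Sum>k\<in>K. \<Sum>l\<in>K. (c k * cnj (c l)) * trig (k - l) x)" for x
    unfolding complex_norm_square trig_sum_def cnj_sum sum_product
    by (intro sum.cong refl) (simp add: trig_cnj_mult[symmetric])
  have "complex_of_real (l2_sq (trig_sum K c)) = (\<integral>x. complex_of_real ((norm (trig_sum K c x))\<^sup>2) \<partial>torus_prob)"
    unfolding l2_sq_def by (rule integral_complex_of_real[symmetric])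
  also have "\<dots> = (\<Sum>k\<in>K. \<Sum>l\<in>K. (c k * cnj (c l)) * (\<integral>x. trig (k - l) x \<partial>torus_prob))"
    unfolding eq using i by (simp add: Bochner_Integration.integral_sum)
  also have "\<dots> = (\<Sum>k\<in>K. \<Sum>l\<in>K. if l = k then c k * cnj (c k) else 0)"
    unfolding integral_trig by (intro sum.cong refl) auto
  also have "\<dots> = (\<Sum>k\<in>K. complex_of_real ((norm (c k))\<^sup>2))"
    using assms by (simp add: complex_norm_square[symmetric])
  finally show ?thesis by (simp only: of_real_sum[symmetric] of_real_eq_iff)
qed

text \<open>Completing the square. With \<open>c = coef f\<close> this yields Bessel's inequality
  and the error of a truncation; with arbitrary \<open>c\<close> it shows that any good approximant
  captures the Fourier mass on its frequencies.\<close>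

lemma l2_sq_diff_trig_sum:
  assumes K: "finite K" and f: "square_integrable f"
  shows "l2_sq (\<lambda>x. f x - trig_sum K c x)
    = l2_sq f - (\<Sum>k\<in>K. (norm (coef f k))\<^sup>2) + (\<Sum>k\<in>K. (norm (coef f k - c k))\<^sup>2)"
proof -
  let ?p = "trig_sum K c"
  have p: "square_integrable ?p" by (rule trig_sum_square_integrable)
  have i1: "integrable torus_prob (\<lambda>x. (norm (f x))\<^sup>2)" "integrable torus_prob (\<lambda>x. (norm (?p x))\<^sup>2)"
    using f p by (auto simp: square_integrable_def)
  have i2: "integrable torus_prob (\<lambda>x. f x * cnj (?p x))"
    by (rule square_integrable_mult(1)[OF f square_integrable_cnj[OF p]])
  have i3: "integrable torus_prob (\<lambda>x. f x * cnj (trig k x))" for k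
    by (rule square_integrable_mult(1)[OF f square_integrable_cnj[OF square_integrable_trig]])
  have expand: "(norm (z - w))\<^sup>2 = (norm z)\<^sup>2 - 2 * Re (z * cnj w) + (norm w)\<^sup>2" for z w
    unfolding cmod_power2 by (simp add: power2_eq_square algebra_simps)
  have "(\<integral>x. f x * cnj (?p x) \<partial>torus_prob) = (\<integral>x. (\<Sum>k\<in>K. cnj (c k) * (f x * cnj (trig k x))) \<partial>torus_prob)"
    unfolding trig_sum_def cnj_sum sum_distrib_left
    by (intro Bochner_Integration.integral_cong sum.cong refl) simp
  also have "\<dots> = (\<Sum>k\<in>K. cnj (c k) * coef f k)"
    unfolding coef_def using i3 by (subst Bochner_Integration.integral_sum) auto
  finally have inner: "(\<integral>x. f x * cnj (?p x) \<partial>torus_prob) = (\<Sum>k\<in>K. cnj (c k) * coef f k)" .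
  have "l2_sq (\<lambda>x. f x - ?p x) = (\<integral>x. (norm (f x))\<^sup>2 - 2 * Re (f x * cnj (?p x)) + (norm (?p x))\<^sup>2 \<partial>torus_prob)"
    unfolding l2_sq_def expand ..
  also have "\<dots> = l2_sq f - 2 * Re (\<integral>x. f x * cnj (?p x) \<partial>torus_prob) + l2_sq ?p"
    unfolding l2_sq_def integral_Re[OF i2, symmetric]
    by (simp only: Bochner_Integration.integral_add Bochner_Integration.integral_diff Bochner_Integration.integrable_diff
        integrable_mult_right integral_mult_right_zero integrable_Re[OF i2] i1)
  also have "\<dots> = l2_sq f - (\<Sum>k\<in>K. (norm (coef f k))\<^sup>2) + (\<Sum>k\<in>K. (norm (coef f k))\<^sup>2 - 2 * Re (coef f k * cnj (c k)) + (norm (c k))\<^sup>2)"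
    unfolding inner l2_sq_trig_sum[OF K]
    by (simp add: sum.distrib sum_subtractf sum_distrib_left Re_sum mult.commute)
  finally show ?thesis by (simp add: expand)
qed

lemma Bessel_finite:
  assumes "finite K" "square_integrable f"
  shows "(\<Sum>k\<in>K. (norm (coef f k))\<^sup>2) \<le> l2_sq f"
  using l2_sq_diff_trig_sum[OF assms, of "coef f"] l2_sq_nonneg[of "\<lambda>x. f x - trig_sum K (coef f) x"] by simp

lemma Parseval_finite:
  assumes f: "square_integrable f" and "\<epsilon> > 0"
  obtains K where "finite K" "l2_sq f < (\<Sum>k\<in>K. (norm (coef f k))\<^sup>2) + \<epsilon>"
proof -
  from square_integrable_approximable[OF f] \<open>\<epsilon> > 0\<close>
  obtain p where p: "trig_poly p" "(\<integral>x. (norm (f x - p x))\<^sup>2 \<partial>torus_prob) < \<epsilon>"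
    unfolding approximable_def by blast
  from trig_poly_sum_form[OF p(1)] obtain K c where K: "finite K" "p = (\<lambda>x. \<Sum>k\<in>K. c k * trig k x)" .
  have "l2_sq (\<lambda>x. f x - trig_sum K c x) < \<epsilon>"
    using p(2) by (simp add: l2_sq_def trig_sum_def K(2))
  moreover have "0 \<le> (\<Sum>k\<in>K. (norm (coef f k - c k))\<^sup>2)" by (intro sum_nonneg) auto
  ultimately have "l2_sq f < (\<Sum>k\<in>K. (norm (coef f k))\<^sup>2) + \<epsilon>"
    using l2_sq_diff_trig_sum[OF K(1) f, of c] by linarith
  with K(1) that show thesis by blast
qed

text \<open>A Chebyshev bound on the frequency side: outside \<open>K\<close> each coefficient is
  weighted by at least \<open>W\<close>. Parseval enters through finite sets up to \<epsilon>, hence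
  the slack that is removed first.\<close>

lemma truncation_error_le:
  fixes w :: "int \<times> int \<Rightarrow> real"
  assumes f: "square_integrable f" and K: "finite K" and W: "0 < W" "\<And>k. k \<notin> K \<Longrightarrow> W \<le> w k"
    and w: "\<And>k. 0 \<le> w k" and summ: "(\<lambda>k. w k * (norm (coef f k))\<^sup>2) summable_on UNIV"
  shows "l2_sq (\<lambda>x. f x - trig_sum K (coef f) x) \<le> (\<Sum>\<^sub>\<infinity>k. w k * (norm (coef f k))\<^sup>2) / W"
proof (rule field_le_epsilon)
  fix \<epsilon> :: real assume "\<epsilon> > 0"
  from Parseval_finite[OF f this] obtain L where L: "finite L" "l2_sq f < (\<Sum>k\<in>L. (norm (coef f k))\<^sup>2) + \<epsilon>" .
  have "l2_sq (\<lambda>x. f x - trig_sum K (coef f) x) = l2_sq f - (\<Sum>k\<in>K. (norm (coef f k))\<^sup>2)"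
    using l2_sq_diff_trig_sum[OF K f, of "coef f"] by simp
  also have "\<dots> \<le> (\<Sum>k\<in>L. (norm (coef f k))\<^sup>2) - (\<Sum>k\<in>K. (norm (coef f k))\<^sup>2) + \<epsilon>"
    using L(2) by simp
  also have "(\<Sum>k\<in>L. (norm (coef f k))\<^sup>2) \<le> (\<Sum>k\<in>L \<union> K. (norm (coef f k))\<^sup>2)"
    using L(1) K by (intro sum_mono2) auto
  also have "(\<Sum>k\<in>L \<union> K. (norm (coef f k))\<^sup>2) = (\<Sum>k\<in>L - K. (norm (coef f k))\<^sup>2) + (\<Sum>k\<in>K. (norm (coef f k))\<^sup>2)"
  proof -
    have "L \<union> K = (L - K) \<union> K" by auto
    then show ?thesis using L(1) K by (simp add: sum.union_disjoint[symmetric] Diff_Int_distrib2)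
  qed
  also have "(\<Sum>k\<in>L - K. (norm (coef f k))\<^sup>2) \<le> (\<Sum>k\<in>L - K. (w k * (norm (coef f k))\<^sup>2) / W)"
  proof (rule sum_mono)
    fix k assume "k \<in> L - K"
    then have "W * (norm (coef f k))\<^sup>2 \<le> w k * (norm (coef f k))\<^sup>2" using W(2) by (intro mult_right_mono) auto
    then show "(norm (coef f k))\<^sup>2 \<le> (w k * (norm (coef f k))\<^sup>2) / W"
      using W(1) by (simp add: field_simps)
  qed
  also have "\<dots> = (\<Sum>k\<in>L - K. w k * (norm (coef f k))\<^sup>2) / W" by (simp add: sum_divide_distrib)
  also have "\<dots> \<le> (\<Sum>\<^sub>\<infinity>k. w k * (norm (coef f k))\<^sup>2) / W"
    using W(1) w L(1) by (intro divide_right_mono finite_sum_le_infsum[OF summ]) auto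
  finally show "l2_sq (\<lambda>x. f x - trig_sum K (coef f) x) \<le> (\<Sum>\<^sub>\<infinity>k. w k * (norm (coef f k))\<^sup>2) / W + \<epsilon>" by simp
qed

section \<open>Invariance of Lebesgue measure under the flow\<close>

lemma nn_integral_torus_prob:
  assumes [measurable]: "f \<in> borel_measurable borel"
  shows "(\<integral>\<^sup>+x. f x \<partial>torus_prob) = (\<integral>\<^sup>+v. \<integral>\<^sup>+u. f (u, v) \<partial>circ \<partial>circ)"
    and "(\<integral>\<^sup>+x. f x \<partial>torus_prob) = (\<integral>\<^sup>+u. \<integral>\<^sup>+v. f (u, v) \<partial>circ \<partial>circ)"
proof -
  have "f \<in> borel_measurable torus_prob" by measurable
  then have m: "(\<lambda>(u, v). f (u, v)) \<in> borel_measurable (circ \<Otimes>\<^sub>M circ)"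
    by (simp add: torus_prob_def)
  show "(\<integral>\<^sup>+x. f x \<partial>torus_prob) = (\<integral>\<^sup>+v. \<integral>\<^sup>+u. f (u, v) \<partial>circ \<partial>circ)"
    using circ_pair.nn_integral_snd[OF m] by (simp add: torus_prob_def)
  show "(\<integral>\<^sup>+x. f x \<partial>torus_prob) = (\<integral>\<^sup>+u. \<integral>\<^sup>+v. f (u, v) \<partial>circ \<partial>circ)"
    using circ.nn_integral_fst[OF m] by (simp add: torus_prob_def)
qed

lemma nn_integral_circ_rotate:
  assumes [measurable]: "f \<in> borel_measurable borel"
  shows "(\<integral>\<^sup>+u. f ((u + a) rmod (2*pi)) \<partial>circ) = (\<integral>\<^sup>+u. f u \<partial>circ)"
proof -
  have "(\<integral>\<^sup>+u. f u \<partial>distr circ borel (\<lambda>x. (x + a) rmod (2*pi))) = (\<integral>\<^sup>+u. f ((u + a) rmod (2*pi)) \<partial>circ)"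
    by (rule nn_integral_distr) auto
  then show ?thesis by (simp add: distr_circ_rotate)
qed

lemma fH_measurable [measurable]: "fH \<tau> \<beta> \<in> borel_measurable borel"
  and fV_measurable [measurable]: "fV \<tau> \<beta> \<in> borel_measurable borel"
proof -
  have "(\<lambda>x. (fst x + \<tau> * sin (snd x - \<beta>)) rmod (2*pi)) \<in> borel_measurable borel"
    "(\<lambda>x. (snd x + \<tau> * sin (fst x - \<beta>)) rmod (2*pi)) \<in> borel_measurable borel"
    by (rule measurable_compose[OF _ rmod_measurable], measurable)+
  then show "fH \<tau> \<beta> \<in> borel_measurable borel" "fV \<tau> \<beta> \<in> borel_measurable borel"
    unfolding fH_def[abs_def] fV_def[abs_def] by (auto intro!: borel_measurable_Pair)
qed

text \<open>By Fubini: with the second coordinate fixed, the map is a rotation of the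
  circle.\<close>

lemma distr_fH: "distr torus_prob borel (fH \<tau> \<beta>) = torus_prob"
proof (rule measure_eqI)
  fix A assume "A \<in> sets (distr torus_prob borel (fH \<tau> \<beta>))"
  then have [measurable]: "A \<in> sets borel" by simp
  have [measurable]: "(\<lambda>u. indicator A (u, v) :: ennreal) \<in> borel_measurable borel" for v :: real
    by (rule measurable_compose[OF _ borel_measurable_indicator]) (auto intro: borel_measurable_Pair)
  have "emeasure (distr torus_prob borel (fH \<tau> \<beta>)) A = (\<integral>\<^sup>+x. indicator A x \<partial>distr torus_prob borel (fH \<tau> \<beta>))"
    by simp
  also have "\<dots> = (\<integral>\<^sup>+x. indicator A (fH \<tau> \<beta> x) \<partial>torus_prob)"
    by (rule nn_integral_distr) auto
  also have "\<dots> = (\<integral>\<^sup>+v. \<integral>\<^sup>+u. indicator A ((u + \<tau> * sin (v - \<beta>)) rmod (2*pi), v) \<partial>circ \<partial>circ)"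
    by (subst nn_integral_torus_prob(1)) (auto simp: fH_def)
  also have "\<dots> = (\<integral>\<^sup>+v. \<integral>\<^sup>+u. indicator A (u, v) \<partial>circ \<partial>circ)"
    by (rule nn_integral_cong) (rule nn_integral_circ_rotate[where f = "\<lambda>u. indicator A (u, _)"], measurable)
  also have "\<dots> = (\<integral>\<^sup>+x. indicator A x \<partial>torus_prob)"
    by (rule nn_integral_torus_prob(1)[symmetric]) auto
  finally show "emeasure (distr torus_prob borel (fH \<tau> \<beta>)) A = emeasure torus_prob A" by simp
qed simp

lemma distr_fV: "distr torus_prob borel (fV \<tau> \<beta>) = torus_prob"
proof (rule measure_eqI)
  fix A assume "A \<in> sets (distr torus_prob borel (fV \<tau> \<beta>))"
  then have [measurable]: "A \<in> sets borel" by simp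
  have [measurable]: "(\<lambda>v. indicator A (u, v) :: ennreal) \<in> borel_measurable borel" for u :: real
    by (rule measurable_compose[OF _ borel_measurable_indicator]) (auto intro: borel_measurable_Pair)
  have "emeasure (distr torus_prob borel (fV \<tau> \<beta>)) A = (\<integral>\<^sup>+x. indicator A x \<partial>distr torus_prob borel (fV \<tau> \<beta>))"
    by simp
  also have "\<dots> = (\<integral>\<^sup>+x. indicator A (fV \<tau> \<beta> x) \<partial>torus_prob)"
    by (rule nn_integral_distr) auto
  also have "\<dots> = (\<integral>\<^sup>+u. \<integral>\<^sup>+v. indicator A (u, (v + \<tau> * sin (u - \<beta>)) rmod (2*pi)) \<partial>circ \<partial>circ)"
    by (subst nn_integral_torus_prob(2)) (auto simp: fV_def)
  also have "\<dots> = (\<integral>\<^sup>+u. \<integral>\<^sup>+v. indicator A (u, v) \<partial>circ \<partial>circ)"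
    by (rule nn_integral_cong) (rule nn_integral_circ_rotate[where f = "\<lambda>v. indicator A (_, v)"], measurable)
  also have "\<dots> = (\<integral>\<^sup>+x. indicator A x \<partial>torus_prob)"
    by (rule nn_integral_torus_prob(2)[symmetric]) auto
  finally show "emeasure (distr torus_prob borel (fV \<tau> \<beta>)) A = emeasure torus_prob A" by simp
qed simp

lemma flow_measurable [measurable]: "pierrehumbert_flow \<tau> \<omega> n \<in> borel_measurable borel"
  by (induction n)
     (auto simp: id_def pierrehumbert_map_def intro!: measurable_comp[where N = borel])

lemma distr_flow: "distr torus_prob borel (pierrehumbert_flow \<tau> \<omega> n) = torus_prob"
proof (induction n)
  case 0
  show ?case by (rule measure_eqI) (simp_all add: emeasure_distr)
next
  case (Suc n)
  let ?w = "\<omega> (Suc n)"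
  have "distr torus_prob borel (pierrehumbert_flow \<tau> \<omega> (Suc n))
    = distr (distr (distr torus_prob borel (pierrehumbert_flow \<tau> \<omega> n)) borel (fH \<tau> (fst ?w))) borel (fV \<tau> (snd ?w))"
    by (subst distr_distr, measurable, subst distr_distr) (auto simp: pierrehumbert_map_def comp_assoc)
  then show ?case by (simp only: Suc distr_fH distr_fV)
qed

lemma square_integrable_flow:
  assumes "square_integrable f"
  shows "square_integrable (\<lambda>x. f (pierrehumbert_flow \<tau> \<omega> n x))"
    and "l2_sq (\<lambda>x. f (pierrehumbert_flow \<tau> \<omega> n x)) = l2_sq f"
proof -
  have [measurable]: "f \<in> borel_measurable borel" and i: "integrable torus_prob (\<lambda>x. (norm (f x))\<^sup>2)"
    using assms by (auto simp: square_integrable_def)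
  have "integrable (distr torus_prob borel (pierrehumbert_flow \<tau> \<omega> n)) (\<lambda>x. (norm (f x))\<^sup>2)"
    using i by (simp add: distr_flow)
  then have "integrable torus_prob (\<lambda>x. (norm (f (pierrehumbert_flow \<tau> \<omega> n x)))\<^sup>2)"
    by (rule integrable_distr[rotated]) measurable
  then show "square_integrable (\<lambda>x. f (pierrehumbert_flow \<tau> \<omega> n x))"
    by (simp add: square_integrable_def)
  have "(\<integral>x. (norm (f x))\<^sup>2 \<partial>distr torus_prob borel (pierrehumbert_flow \<tau> \<omega> n)) = l2_sq (\<lambda>x. f (pierrehumbert_flow \<tau> \<omega> n x))"
    unfolding l2_sq_def by (rule integral_distr) measurable
  then show "l2_sq (\<lambda>x. f (pierrehumbert_flow \<tau> \<omega> n x)) = l2_sq f"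
    by (simp add: distr_flow l2_sq_def)
qed

lemma trig_cong:
  assumes "torus_cong x y"
  shows "trig k x = trig k y"
proof -
  from assms obtain m n where "fst y = fst x + of_int m * (2*pi)" "snd y = snd x + of_int n * (2*pi)"
    unfolding torus_cong_def rcong_altdef by blast
  then have "of_int (fst k) * fst y + of_int (snd k) * snd y
     = (of_int (fst k) * fst x + of_int (snd k) * snd x) + of_int (fst k * m + snd k * n) * (2*pi)"
    by (simp add: algebra_simps)
  then have "trig k y = cis ((of_int (fst k) * fst x + of_int (snd k) * snd x) + of_int (fst k * m + snd k * n) * (2*pi))"
    unfolding trig_def by simp
  also have "\<dots> = trig k x"
    unfolding trig_def by (rule periodic_shift_int[where h = cis]) (simp add: cis_mult[symmetric])
  finally show ?thesis by simp
qed

lemma correlation_flow: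
  "correlation \<tau> \<omega> n l k = (\<integral>x. trig l x * trig k (pierrehumbert_flow \<tau> \<omega> n x) \<partial>torus_prob)"
  unfolding correlation_def using trig_cong[OF pierrehumbert_flow_cong] by simp

section \<open>Frequency boxes and Sobolev weights\<close>

definition freq_box :: "nat \<Rightarrow> (int \<times> int) set" where
  "freq_box N = {- int N..int N} \<times> {- int N..int N}"

lemma freq_box: "finite (freq_box N)" "card (freq_box N) = (2 * N + 1)\<^sup>2"
proof -
  have "card {- int N..int N} = 2 * N + 1" by simp
  then show "finite (freq_box N)" "card (freq_box N) = (2 * N + 1)\<^sup>2"
    unfolding freq_box_def card_cartesian_product power2_eq_square by auto
qed

definition freq_weight :: "real \<Rightarrow> int \<times> int \<Rightarrow> real" where
  "freq_weight s k = (1 + (of_int (fst k))\<^sup>2 + (of_int (snd k))\<^sup>2) powr s"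

lemma freq_weight_ge1: "0 \<le> s \<Longrightarrow> 1 \<le> freq_weight s k"
  unfolding freq_weight_def by (rule ge_one_powr_ge_zero) (auto intro: add_nonneg_nonneg)

lemma freq_weight_outside:
  assumes "k \<notin> freq_box N" "0 \<le> s" "1 \<le> N"
  shows "real N powr (2 * s) \<le> freq_weight s k"
proof -
  have "int N \<le> \<bar>fst k\<bar> \<or> int N \<le> \<bar>snd k\<bar>"
    using assms(1) by (cases k) (auto simp: freq_box_def)
  then have "real N \<le> \<bar>of_int (fst k)\<bar> \<or> real N \<le> \<bar>of_int (snd k)\<bar>"
    by (metis of_int_abs of_int_le_iff of_int_of_nat_eq)
  then have "(real N)\<^sup>2 \<le> (of_int (fst k))\<^sup>2 \<or> (real N)\<^sup>2 \<le> (of_int (snd k))\<^sup>2"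
    by (metis abs_le_square_iff abs_of_nat)
  then have "(real N)\<^sup>2 \<le> 1 + (of_int (fst k))\<^sup>2 + (of_int (snd k))\<^sup>2"
    by (smt (verit) zero_le_power2)
  then have "((real N)\<^sup>2) powr s \<le> freq_weight s k"
    unfolding freq_weight_def using assms(2) by (intro powr_mono2) auto
  moreover have "((real N)\<^sup>2) powr s = real N powr (2 * s)"
    using assms(3) by (simp add: powr_powr flip: powr_numeral)
  ultimately show ?thesis by simp
qed

section \<open>From mode correlations to Sobolev functions\<close>

definition sob_sq :: "real \<Rightarrow> (real \<times> real \<Rightarrow> complex) \<Rightarrow> real" where
  "sob_sq s f = (\<Sum>\<^sub>\<infinity>k. freq_weight s k * (norm (coef f k))\<^sup>2)"

text \<open>Both functions are truncated at \<open>N\<close> of order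
  \<open>exp (\<gamma> n / 16)\<close>. The tails cost \<open>N powr (- s)\<close>, at most
  \<open>exp (- s \<gamma> n / 16)\<close>. The low part has about \<open>N^4\<close> pairs of
  modes, each bounded with a loss of order \<open>N^3\<close>; the total \<open>N^7\<close> is at
  most of order \<open>exp (\<gamma> n / 2)\<close> and uses up half of the decay.\<close>

lemma mixing_from_correlations:
  assumes s: "0 < s" and \<gamma>: "0 < \<gamma>" and D: "1 \<le> D"
    and corr: "\<And>n N l k. l \<in> freq_box N \<Longrightarrow> k \<in> freq_box N \<Longrightarrow> k \<noteq> 0 \<Longrightarrow>
       norm (correlation \<tau> \<omega> n l k) \<le> D * exp (- \<gamma> * real n) * (real N + 1) ^ 3"
    and f: "square_integrable f" and g: "square_integrable g" and g0: "coef g 0 = 0"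
    and sf: "(\<lambda>k. freq_weight s k * (norm (coef f k))\<^sup>2) summable_on UNIV"
    and sg: "(\<lambda>k. freq_weight s k * (norm (coef g k))\<^sup>2) summable_on UNIV"
  defines "\<alpha> \<equiv> min (s * \<gamma> / 16) (\<gamma> / 2)"
  shows "norm (\<integral>x. f x * g (pierrehumbert_flow \<tau> \<omega> n x) \<partial>torus_prob)
    \<le> (170000 * D) * exp (- \<alpha> * real n) * sqrt (sob_sq s f) * sqrt (sob_sq s g)"
proof -
  define R where "R = exp (\<gamma> * real n / 16)"
  define N where "N = nat \<lceil>R\<rceil>"
  have R1: "1 \<le> R" using \<gamma> by (simp add: R_def)
  have NR: "R \<le> real N" "real N \<le> 2 * R" "1 \<le> N"
    using R1 unfolding N_def by linarith+
  let ?K = "freq_box N" and ?T = "pierrehumbert_flow \<tau> \<omega> n"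
  define a b where "a = sqrt (sob_sq s f)" and "b = sqrt (sob_sq s g)"
  have ab: "0 \<le> a" "0 \<le> b"
    unfolding a_def b_def sob_sq_def
    by (intro real_sqrt_ge_zero infsum_nonneg mult_nonneg_nonneg; simp add: freq_weight_def)+
  have w0: "0 \<le> freq_weight s k" for k by (simp add: freq_weight_def)
  have tail: "sqrt (l2_sq (\<lambda>x. h x - trig_sum ?K (coef h) x)) \<le> sqrt (sob_sq s h) * real N powr (- s)"
    if h: "square_integrable h" and sh: "(\<lambda>k. freq_weight s k * (norm (coef h k))\<^sup>2) summable_on UNIV" for h
  proof -
    have "l2_sq (\<lambda>x. h x - trig_sum ?K (coef h) x) \<le> sob_sq s h / real N powr (2 * s)"
      unfolding sob_sq_def using NR s
      by (intro truncation_error_le h sh freq_box freq_weight_outside w0) auto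
    also have "\<dots> = sob_sq s h * (real N powr (- s))\<^sup>2"
      by (simp add: powr_minus field_simps power2_eq_square flip: powr_add)
    finally show ?thesis
      by (metis abs_of_nonneg powr_ge_zero real_sqrt_abs real_sqrt_le_mono real_sqrt_mult)
  qed
  have full: "sqrt (l2_sq h) \<le> sqrt (sob_sq s h)"
    if h: "square_integrable h" and sh: "(\<lambda>k. freq_weight s k * (norm (coef h k))\<^sup>2) summable_on UNIV" for h
  proof -
    \<comment> \<open>Truncation to no frequencies at all, with \<open>W = 1\<close>, compares the
      L2 norm with the Sobolev norm.\<close>
    have "l2_sq (\<lambda>x. h x - trig_sum {} (coef h) x) \<le> sob_sq s h / 1"
      unfolding sob_sq_def using s
      by (intro truncation_error_le h sh w0 freq_weight_ge1) auto
    then show ?thesis by (simp add: trig_sum_def)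
  qed
  define p q where "p = trig_sum ?K (coef f)" and "q = trig_sum ?K (coef g)"
  have p: "square_integrable p" and q: "square_integrable q"
    unfolding p_def q_def by (rule trig_sum_square_integrable)+
  have fp: "square_integrable (\<lambda>x. f x - p x)" and gq: "square_integrable (\<lambda>x. g x - q x)"
    using f g p q by (auto intro: square_integrable_diff)
  note flow = square_integrable_flow[of _ \<tau> \<omega> n]
  have bq: "sqrt (l2_sq q) \<le> b"
  proof -
    have "l2_sq q \<le> l2_sq g"
      unfolding q_def l2_sq_trig_sum[OF freq_box(1)] by (rule Bessel_finite[OF freq_box(1) g])
    then show ?thesis using full[OF g sg] real_sqrt_le_mono unfolding b_def by (meson order_trans)
  qed
  have i: "integrable torus_prob (\<lambda>x. f x * (g (?T x) - q (?T x)))"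
      "integrable torus_prob (\<lambda>x. (f x - p x) * q (?T x))" "integrable torus_prob (\<lambda>x. p x * q (?T x))"
    by (rule square_integrable_mult(1)[OF f flow(1)[OF gq]] square_integrable_mult(1)[OF fp flow(1)[OF q]]
         square_integrable_mult(1)[OF p flow(1)[OF q]])+
  \<comment> \<open>The two tails are removed one after the other; invariance of the measure makes
    the tail of \<open>g\<close> along the flow as small as the tail itself.\<close>
  have "(\<integral>x. f x * g (?T x) \<partial>torus_prob)
    = (\<integral>x. f x * (g (?T x) - q (?T x)) + ((f x - p x) * q (?T x) + p x * q (?T x)) \<partial>torus_prob)"
    by (intro Bochner_Integration.integral_cong refl) (simp add: algebra_simps)
  also have "\<dots> = (\<integral>x. f x * (g (?T x) - q (?T x)) \<partial>torus_prob) + ((\<integral>x. (f x - p x) * q (?T x) \<partial>torus_prob)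
      + (\<integral>x. p x * q (?T x) \<partial>torus_prob))"
    using i by simp
  finally have split: "norm (\<integral>x. f x * g (?T x) \<partial>torus_prob)
    \<le> norm (\<integral>x. f x * (g (?T x) - q (?T x)) \<partial>torus_prob) + (norm (\<integral>x. (f x - p x) * q (?T x) \<partial>torus_prob)
      + norm (\<integral>x. p x * q (?T x) \<partial>torus_prob))"
    using norm_triangle_ineq[of "\<integral>x. f x * (g (?T x) - q (?T x)) \<partial>torus_prob"
      "(\<integral>x. (f x - p x) * q (?T x) \<partial>torus_prob) + (\<integral>x. p x * q (?T x) \<partial>torus_prob)"]
      norm_triangle_ineq[of "\<integral>x. (f x - p x) * q (?T x) \<partial>torus_prob" "\<integral>x. p x * q (?T x) \<partial>torus_prob"]
    by simp
  have t1: "norm (\<integral>x. f x * (g (?T x) - q (?T x)) \<partial>torus_prob) \<le> a * (b * real N powr (- s))"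
  proof -
    have "norm (\<integral>x. f x * (g (?T x) - q (?T x)) \<partial>torus_prob) \<le> sqrt (l2_sq f) * sqrt (l2_sq (\<lambda>x. g x - q x))"
      using square_integrable_mult(2)[OF f flow(1)[OF gq]] flow(2)[OF gq] by simp
    also have "\<dots> \<le> a * (b * real N powr (- s))"
      unfolding a_def b_def q_def using full[OF f sf] tail[OF g sg] ab
      by (intro mult_mono) (auto simp: a_def)
    finally show ?thesis .
  qed
  have t2: "norm (\<integral>x. (f x - p x) * q (?T x) \<partial>torus_prob) \<le> (a * real N powr (- s)) * b"
  proof -
    have "norm (\<integral>x. (f x - p x) * q (?T x) \<partial>torus_prob) \<le> sqrt (l2_sq (\<lambda>x. f x - p x)) * sqrt (l2_sq q)"
      using square_integrable_mult(2)[OF fp flow(1)[OF q]] flow(2)[OF q] by simp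
    also have "\<dots> \<le> (a * real N powr (- s)) * b"
      using tail[OF f sf] bq ab unfolding p_def a_def
      by (intro mult_mono) (auto simp: a_def)
    finally show ?thesis .
  qed
  define M where "M = D * exp (- \<gamma> * real n) * (real N + 1) ^ 3"
  have M0: "0 \<le> M" using D by (simp add: M_def)
  have coef_le: "norm (coef h k) \<le> sqrt (sob_sq s h)"
    if h: "square_integrable h" and sh: "(\<lambda>k. freq_weight s k * (norm (coef h k))\<^sup>2) summable_on UNIV" for h k
  proof -
    have "(norm (coef h k))\<^sup>2 \<le> l2_sq h" using Bessel_finite[of "{k}", OF _ h] by simp
    then have "norm (coef h k) \<le> sqrt (l2_sq h)" by (rule real_le_rsqrt)
    then show ?thesis using full[OF h sh] by (rule order_trans)
  qed
  have t3: "norm (\<integral>x. p x * q (?T x) \<partial>torus_prob) \<le> (real (card ?K))\<^sup>2 * M * a * b"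
  proof -
    have ilk: "integrable torus_prob (\<lambda>x. (coef f l * coef g k) * (trig l x * trig k (?T x)))" for l k
      by (intro integrable_mult_right square_integrable_mult(1) square_integrable_trig flow(1)[OF square_integrable_trig])
    have "(\<integral>x. p x * q (?T x) \<partial>torus_prob) = (\<integral>x. (\<Sum>l\<in>?K. \<Sum>k\<in>?K. (coef f l * coef g k) * (trig l x * trig k (?T x))) \<partial>torus_prob)"
      unfolding p_def q_def trig_sum_def sum_product
      by (intro Bochner_Integration.integral_cong sum.cong refl) (simp add: mult_ac)
    also have "\<dots> = (\<Sum>l\<in>?K. \<Sum>k\<in>?K. (coef f l * coef g k) * correlation \<tau> \<omega> n l k)"
      unfolding correlation_flow using ilk by (simp add: Bochner_Integration.integral_sum)
    also have "norm \<dots> \<le> (\<Sum>l\<in>?K. \<Sum>k\<in>?K. a * b * M)"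
    proof (intro sum_norm_le)
      fix l k assume lk: "l \<in> ?K" "k \<in> ?K"
      show "norm (coef f l * coef g k * correlation \<tau> \<omega> n l k) \<le> a * b * M"
      \<comment> \<open>The constant mode does not decay and drops out because the mean of
        \<open>g\<close> vanishes.\<close>
      proof (cases "k = 0")
        case True
        then show ?thesis using g0 ab M0 by simp
      next
        case False
        then have "norm (correlation \<tau> \<omega> n l k) \<le> M" unfolding M_def using lk by (intro corr) auto
        then show ?thesis
          unfolding norm_mult a_def b_def using coef_le[OF f sf, of l] coef_le[OF g sg, of k] ab
          by (intro mult_mono) (auto simp: a_def b_def)
      qed
    qed
    also have "\<dots> = (real (card ?K))\<^sup>2 * M * a * b" by (simp add: power2_eq_square mult_ac)
    finally show ?thesis .
  qed
  have N0: "0 < real N" using NR by simp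
  have pow: "R ^ 16 = exp (\<gamma> * real n)" unfolding R_def by (simp flip: exp_of_nat_mult)
  have e1: "real N powr (- s) \<le> exp (- \<alpha> * real n)"
  proof -
    have "real N powr (- s) \<le> R powr (- s)" using NR R1 s by (intro powr_mono2') auto
    also have "\<dots> = exp (- (s * \<gamma> / 16) * real n)" by (simp add: R_def powr_def)
    also have "\<dots> \<le> exp (- \<alpha> * real n)"
      unfolding exp_le_cancel_iff by (intro mult_right_mono) (auto simp: \<alpha>_def)
    finally show ?thesis .
  qed
  \<comment> \<open>The constant is \<open>3^4 * 2^3 * 2^8 = 165888\<close>, from
    \<open>2N + 1 \<le> 3N\<close>, \<open>N + 1 \<le> 2N\<close> and \<open>N \<le> 2R\<close>; the
    two tails add 2, and 170000 rounds up.\<close>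
  have e2: "(real (card ?K))\<^sup>2 * M \<le> 165888 * D * exp (- \<alpha> * real n)"
  proof -
    have "(real (card ?K))\<^sup>2 * M = (2 * real N + 1) ^ 4 * ((real N + 1) ^ 3) * (D * exp (- \<gamma> * real n))"
      by (simp add: freq_box M_def mult_ac add.commute flip: power_mult)
    also have "\<dots> \<le> (3 * real N) ^ 4 * ((2 * real N) ^ 3) * (D * exp (- \<gamma> * real n))"
      using NR D by (intro mult_right_mono mult_mono power_mono) auto
    also have "\<dots> = 648 * real N ^ 7 * (D * exp (- \<gamma> * real n))" by (simp add: power_mult_distrib flip: power_add)
    also have "\<dots> \<le> 648 * (256 * R ^ 8) * (D * exp (- \<gamma> * real n))"
    proof -
      have "real N ^ 7 \<le> real N ^ 8" using NR by (intro power_increasing) auto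
      also have "\<dots> \<le> (2 * R) ^ 8" using NR by (intro power_mono) auto
      finally show ?thesis using D by (intro mult_right_mono) (auto simp: power_mult_distrib)
    qed
    also have "R ^ 8 = exp (\<gamma> / 2 * real n)" unfolding R_def by (simp flip: exp_of_nat_mult)
    also have "648 * (256 * exp (\<gamma> / 2 * real n)) * (D * exp (- \<gamma> * real n)) = 165888 * D * exp (- (\<gamma> / 2) * real n)"
      by (simp add: field_simps flip: exp_add)
    also have "\<dots> \<le> 165888 * D * exp (- \<alpha> * real n)"
    proof -
      have "exp (- (\<gamma> / 2) * real n) \<le> exp (- \<alpha> * real n)"
        unfolding exp_le_cancel_iff by (intro mult_right_mono) (auto simp: \<alpha>_def)
      then show ?thesis using D by (intro mult_left_mono) auto
    qed
    finally show ?thesis .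
  qed
  have "norm (\<integral>x. f x * g (?T x) \<partial>torus_prob) \<le> 2 * real N powr (- s) * (a * b) + (real (card ?K))\<^sup>2 * M * (a * b)"
    using split t1 t2 t3 by (simp add: mult_ac)
  also have "\<dots> \<le> 2 * exp (- \<alpha> * real n) * (a * b) + 165888 * D * exp (- \<alpha> * real n) * (a * b)"
    using e1 e2 ab by (intro add_mono mult_right_mono) auto
  also have "\<dots> = (2 + 165888 * D) * (exp (- \<alpha> * real n) * (a * b))" by (simp add: algebra_simps)
  also have "\<dots> \<le> (170000 * D) * (exp (- \<alpha> * real n) * (a * b))"
    using D ab by (intro mult_right_mono) auto
  finally show ?thesis by (simp add: a_def b_def mult_ac)
qed

section \<open>Passage between completed and Borel measurable functions\<close>

lemma torus_measure_complete_AE: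
  assumes "{x. \<not> P x} \<in> sets borel"
  shows "(AE x in torus_measure. P x) \<longleftrightarrow> (AE x in torus_prob. P x)"
proof -
  have "(AE x in torus_measure. P x) \<longleftrightarrow> (AE x in lebesgue. x \<in> torus \<longrightarrow> P x)"
    unfolding torus_measure_def by (subst AE_restrict_space_iff) auto
  also have "\<dots> \<longleftrightarrow> (AE x in lborel. x \<in> torus \<longrightarrow> P x)"
    by (rule AE_completion_iff)
  also have "\<dots> \<longleftrightarrow> (AE x in torus_prob. P x)"
    using assms by (rule AE_torus_prob_iff[symmetric])
  finally show ?thesis .
qed

lemma borel_torus_measurable:
  "f \<in> borel_measurable borel \<Longrightarrow> f \<in> borel_measurable torus_measure"
  unfolding torus_measure_def by (intro measurable_restrict_space1 borel_measurable_if_D measurable_completion) simp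

lemma integrable_torus_measure:
  fixes f :: "real \<times> real \<Rightarrow> real"
  assumes [measurable]: "f \<in> borel_measurable borel" and "integrable torus_measure f"
  shows "integrable torus_prob f"
proof -
  have "integrable (completion lborel) (\<lambda>x. indicator torus x *\<^sub>R f x)"
    using assms(2) unfolding torus_measure_def by (subst (asm) integrable_restrict_space) auto
  then have "integrable lborel (\<lambda>x. indicator torus x *\<^sub>R f x)"
    by (subst (asm) integrable_completion) auto
  then have "integrable lborel (\<lambda>x. (1 / (4 * pi\<^sup>2)) *\<^sub>R (indicator torus x *\<^sub>R f x))"
    by (rule integrable_scaleR_right)
  then have "integrable lborel (\<lambda>x. (indicator torus x / (4 * pi\<^sup>2)) *\<^sub>R f x)"
    by simp
  then show ?thesis
    unfolding torus_prob_density by (subst integrable_density) auto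
qed

lemma borel_version_real:
  fixes f :: "real \<times> real \<Rightarrow> real"
  assumes "f \<in> borel_measurable torus_measure"
  obtains g where "g \<in> borel_measurable borel" "AE x in torus_measure. f x = g x"
proof -
  have "(\<lambda>x. if x \<in> torus then f x else 0) \<in> borel_measurable lebesgue"
    using assms unfolding torus_measure_def by (subst (asm) borel_measurable_if[symmetric]) auto
  from completion_ex_borel_measurable_real[OF this]
  obtain g where g: "g \<in> borel_measurable lborel" "AE x in lborel. (if x \<in> torus then f x else 0) = g x" by auto
  have "AE x in lebesgue. x \<in> torus \<longrightarrow> f x = g x"
    using AE_completion[OF g(2)] by eventually_elim auto
  then have "AE x in torus_measure. f x = g x"
    unfolding torus_measure_def by (subst AE_restrict_space_iff) auto
  with g(1) that show thesis by simp
qed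

lemma borel_version:
  fixes f :: "real \<times> real \<Rightarrow> complex"
  assumes "f \<in> borel_measurable torus_measure"
  obtains g where "g \<in> borel_measurable borel" "AE x in torus_measure. f x = g x"
proof -
  have "(\<lambda>x. Re (f x)) \<in> borel_measurable torus_measure" "(\<lambda>x. Im (f x)) \<in> borel_measurable torus_measure"
    using assms by auto
  from borel_version_real[OF this(1)] borel_version_real[OF this(2)]
  obtain u v where uv: "u \<in> borel_measurable borel" "AE x in torus_measure. Re (f x) = u x"
    "v \<in> borel_measurable borel" "AE x in torus_measure. Im (f x) = v x" .
  note [measurable] = uv(1,3)
  have "(\<lambda>x. of_real (u x) + \<i> * of_real (v x)) \<in> borel_measurable borel"
    by measurable
  moreover have "AE x in torus_measure. f x = of_real (u x) + \<i> * of_real (v x)"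
    using uv(2,4) by eventually_elim (simp add: complex_eq_iff)
  ultimately show thesis by (rule that)
qed

text \<open>Elements of \<open>sobolev_space\<close> are merely Lebesgue measurable, while the
  preceding analysis is Borel. Changing the function on a null set preserves all Fourier
  coefficients, hence the norm and the mean.\<close>

lemma sobolev_space_borel_version:
  assumes "\<phi> \<in> sobolev_space s"
  obtains f where "square_integrable f" "AE x in torus_measure. \<phi> x = f x"
    "(\<lambda>k. freq_weight s k * (norm (coef f k))\<^sup>2) summable_on UNIV"
    "sobolev_norm s \<phi> = 2 * pi * sqrt (sob_sq s f)"
    "mean_free \<phi> \<longleftrightarrow> coef f 0 = 0"
proof -
  from assms have \<phi>: "\<phi> \<in> borel_measurable torus_measure"
    and i: "integrable torus_measure (\<lambda>x. (cmod (\<phi> x))\<^sup>2)"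
    and summ: "sobolev_term s \<phi> summable_on UNIV" by (auto simp: sobolev_space_def)
  from borel_version[OF \<phi>] obtain f where f [measurable]: "f \<in> borel_measurable borel" and ae: "AE x in torus_measure. \<phi> x = f x" .
  note [measurable] = \<phi> borel_torus_measurable[OF f]
  have "integrable torus_measure (\<lambda>x. (cmod (f x))\<^sup>2)"
    using i by (rule Bochner_Integration.integrable_cong_AE[THEN iffD1, rotated -1]) (use ae in auto)
  then have si: "square_integrable f"
    unfolding square_integrable_def using f integrable_torus_measure[of "\<lambda>x. (cmod (f x))\<^sup>2"] by auto
  have fc: "fourier_coeff \<phi> k = 2 * pi * coef f k" for k
  proof -
    have t: "cis (- (of_int (fst k) * fst x + of_int (snd k) * snd x)) = cnj (trig k x)" for x
      by (simp add: trig_def cis_cnj)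
    have m: "(\<lambda>x. cnj (trig k x)) \<in> borel_measurable borel"
      unfolding cnj_trig by measurable
    note [measurable] = m borel_torus_measurable[OF m]
    have "(LINT x|torus_measure. \<phi> x * cnj (trig k x)) = (LINT x|torus_measure. f x * cnj (trig k x))"
      by (rule integral_cong_AE) (use ae in auto)
    also have "\<dots> = 4 * pi\<^sup>2 * coef f k"
      unfolding coef_def by (rule integral_torus_measure) measurable
    finally show ?thesis unfolding fourier_coeff_def t by (simp add: power2_eq_square)
  qed
  have tm: "sobolev_term s \<phi> k = (4 * pi\<^sup>2) * (freq_weight s k * (norm (coef f k))\<^sup>2)" for k
    unfolding sobolev_term_def fc freq_weight_def by (simp add: norm_mult power_mult_distrib)
  have sm: "(\<lambda>k. freq_weight s k * (norm (coef f k))\<^sup>2) summable_on UNIV"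
    using summ unfolding tm by (simp add: summable_on_cmult_right')
  have "sobolev_norm s \<phi> = sqrt ((4 * pi\<^sup>2) * sob_sq s f)"
    unfolding sobolev_norm_def tm sob_sq_def by (simp add: infsum_cmult_right')
  also have "\<dots> = 2 * pi * sqrt (sob_sq s f)" by (simp add: real_sqrt_mult)
  finally have sn: "sobolev_norm s \<phi> = 2 * pi * sqrt (sob_sq s f)" .
  have "mean_free \<phi> \<longleftrightarrow> fourier_coeff \<phi> 0 = 0"
    by (simp add: mean_free_def fourier_coeff_def)
  then have mf: "mean_free \<phi> \<longleftrightarrow> coef f 0 = 0" by (simp add: fc)
  show thesis by (rule that[OF si ae sm sn mf])
qed

text \<open>A Lebesgue null set need not be Borel, so it is enclosed in a Borel null set
  \<open>Z\<close>, whose preimage under the flow is null by invariance.\<close>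

lemma AE_flow:
  assumes "AE x in torus_measure. f x = g x"
  shows "AE x in torus_measure. f (pierrehumbert_flow \<tau> \<omega> n x) = g (pierrehumbert_flow \<tau> \<omega> n x)"
proof -
  have "AE x in lebesgue. x \<in> torus \<longrightarrow> f x = g x"
    using assms unfolding torus_measure_def by (subst (asm) AE_restrict_space_iff) auto
  then have "AE x in lborel. x \<in> torus \<longrightarrow> f x = g x" by (simp add: AE_completion_iff)
  then obtain Z where Z: "{x. \<not> (x \<in> torus \<longrightarrow> f x = g x)} \<subseteq> Z" "Z \<in> sets borel" "emeasure lborel Z = 0"
    by (auto elim!: AE_E)
  have "AE x in lborel. x \<notin> Z" using Z by (intro AE_not_in) (auto simp: null_sets_def)
  then have "AE x in torus_prob. x \<notin> Z"
    using Z(2) by (subst AE_torus_prob_iff) auto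
  then have "AE x in distr torus_prob borel (pierrehumbert_flow \<tau> \<omega> n). x \<notin> Z" unfolding distr_flow .
  then have "AE x in torus_prob. pierrehumbert_flow \<tau> \<omega> n x \<notin> Z"
    using Z(2) by (subst (asm) AE_distr_iff) auto
  then have *: "AE x in torus_measure. pierrehumbert_flow \<tau> \<omega> n x \<notin> Z"
    using measurable_sets[OF flow_measurable Z(2)] by (subst torus_measure_complete_AE) (auto simp: vimage_def)
  have tor: "pierrehumbert_flow \<tau> \<omega> n x \<in> torus" if "x \<in> torus" for x
    using that by (induction n) (auto simp: torus_def pierrehumbert_map_def fH_def fV_def rmod_less rmod_nonneg)
  have "AE x in torus_measure. x \<in> torus"
    unfolding torus_measure_def by (rule AE_I2) (simp add: space_restrict_space)
  with * show ?thesis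
    by eventually_elim (use Z(1) tor in blast)
qed

lemma mixing_sobolev:
  assumes s: "0 < s" and \<gamma>: "0 < \<gamma>" and D: "1 \<le> D"
    and corr: "\<And>n N l k. l \<in> freq_box N \<Longrightarrow> k \<in> freq_box N \<Longrightarrow> k \<noteq> 0 \<Longrightarrow>
       norm (correlation \<tau> \<omega> n l k) \<le> D * exp (- \<gamma> * real n) * (real N + 1) ^ 3"
    and \<phi>: "\<phi> \<in> sobolev_space s" and \<psi>: "\<psi> \<in> sobolev_space s" and mf: "mean_free \<psi>"
  shows "cmod (LINT x|torus_measure. \<phi> x * \<psi> (pierrehumbert_flow \<tau> \<omega> n x))
    \<le> (170000 * D) * exp (- min (s * \<gamma> / 16) (\<gamma> / 2) * real n) * sobolev_norm s \<phi> * sobolev_norm s \<psi>"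
proof -
  from sobolev_space_borel_version[OF \<phi>] obtain f where f: "square_integrable f" "AE x in torus_measure. \<phi> x = f x"
    "(\<lambda>k. freq_weight s k * (norm (coef f k))\<^sup>2) summable_on UNIV" "sobolev_norm s \<phi> = 2 * pi * sqrt (sob_sq s f)"
    "mean_free \<phi> \<longleftrightarrow> coef f 0 = 0" .
  from sobolev_space_borel_version[OF \<psi>] obtain g where g: "square_integrable g" "AE x in torus_measure. \<psi> x = g x"
    "(\<lambda>k. freq_weight s k * (norm (coef g k))\<^sup>2) summable_on UNIV" "sobolev_norm s \<psi> = 2 * pi * sqrt (sob_sq s g)"
    "mean_free \<psi> \<longleftrightarrow> coef g 0 = 0" .
  have g0: "coef g 0 = 0" using mf g(5) by simp
  let ?T = "pierrehumbert_flow \<tau> \<omega> n"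
  have [measurable]: "f \<in> borel_measurable borel" "g \<in> borel_measurable borel"
    using f g by (auto simp: square_integrable_def)
  have m: "(\<lambda>x. f x * g (?T x)) \<in> borel_measurable borel" by measurable
  have ae: "AE x in torus_measure. \<phi> x * \<psi> (?T x) = f x * g (?T x)"
    using f(2) AE_flow[OF g(2), of \<tau> \<omega> n] by eventually_elim simp
  have main: "cmod (\<integral>x. f x * g (?T x) \<partial>torus_prob)
    \<le> (170000 * D) * exp (- min (s * \<gamma> / 16) (\<gamma> / 2) * real n) * sqrt (sob_sq s f) * sqrt (sob_sq s g)"
    by (rule mixing_from_correlations[OF s \<gamma> D corr f(1) g(1) g0 f(3) g(3)])
  have "cmod (LINT x|torus_measure. \<phi> x * \<psi> (?T x)) \<le> 4 * pi\<^sup>2 * cmod (\<integral>x. f x * g (?T x) \<partial>torus_prob)"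
  proof (cases "(\<lambda>x. \<phi> x * \<psi> (?T x)) \<in> borel_measurable torus_measure")
    case True
    have "(LINT x|torus_measure. \<phi> x * \<psi> (?T x)) = (LINT x|torus_measure. f x * g (?T x))"
      by (rule integral_cong_AE[OF True borel_torus_measurable[OF m] ae])
    then show ?thesis by (simp add: integral_torus_measure[OF m] norm_mult norm_power)
  next
    \<comment> \<open>The integral of a non-integrable function is 0 by convention; this spares a
      proof that composing a Lebesgue measurable \<psi> with the flow stays measurable.\<close>
    case False
    then have "(LINT x|torus_measure. \<phi> x * \<psi> (?T x)) = 0"
      by (intro not_integrable_integral_eq) auto
    then show ?thesis by simp
  qed
  also have "\<dots> \<le> 4 * pi\<^sup>2 * ((170000 * D) * exp (- min (s * \<gamma> / 16) (\<gamma> / 2) * real n) * sqrt (sob_sq s f) * sqrt (sob_sq s g))"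
    by (intro mult_left_mono main) simp
  \<comment> \<open>The factor \<open>4 * pi^2\<close> from the unnormalised measure is exactly
    absorbed by the two factors \<open>2 * pi\<close> in the Sobolev norms.\<close>
  also have "\<dots> = (170000 * D) * exp (- min (s * \<gamma> / 16) (\<gamma> / 2) * real n) * sobolev_norm s \<phi> * sobolev_norm s \<psi>"
    unfolding f(4) g(4) by (simp add: power2_eq_square)
  finally show ?thesis .
qed

section \<open>Exponential mixing\<close>

text \<open>A union bound in L^p form: a weighted sum \<open>Z\<close> of the p-th powers of all
  mode correlations has finite expectation, and each single term is at most \<open>Z\<close>.
  Solving for the correlation and taking p-th roots gives the bound with \<open>D\<close> comparable
  to \<open>Z powr (1/p)\<close>.\<close>

lemma correlation_bound_random:
  assumes "0 < \<tau>" and p: "2 \<le> p"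
  obtains D :: "(nat \<Rightarrow> real \<times> real) \<Rightarrow> real" and \<gamma> where "0 < \<gamma>" "\<And>\<omega>. 1 \<le> D \<omega>"
    "D \<in> borel_measurable phase_seq_measure" "integrable phase_seq_measure (\<lambda>\<omega>. D \<omega> powr p)"
    "AE \<omega> in phase_seq_measure. \<forall>n N. \<forall>l\<in>freq_box N. \<forall>k\<in>freq_box N. k \<noteq> 0 \<longrightarrow>
      norm (correlation \<tau> \<omega> n l k) \<le> D \<omega> * exp (- \<gamma> * real n) * (real N + 1) ^ 3"
proof -
  interpret product_prob_space "\<lambda>_. phase_measure" "{1::nat..}"
    by (intro product_prob_spaceI prob_space_phase_measure)
  interpret \<Omega>: prob_space phase_seq_measure
    unfolding phase_seq_measure_def by (rule P.prob_space_axioms)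
  from energy_step_avg_le[OF \<open>0 < \<tau>\<close>] obtain r where r: "0 < r" "r < 1"
    and gap: "\<And>g B. torus_function g B \<Longrightarrow> (\<integral>v. \<integral>u. g u v \<partial>circ \<partial>circ) = 0 \<Longrightarrow> energy (step_avg \<tau> g) \<le> r * energy g"
    by blast
  \<comment> \<open>A fourth root, so that the moment bound \<open>2 * sqrt r ^ n\<close> is
    \<open>2 * \<mu>^(2n)\<close>: one factor \<open>\<mu>^n\<close> makes the sum over
    \<open>n\<close> converge, the other becomes the decay.\<close>
  define \<mu> where "\<mu> = sqrt (sqrt r)"
  have \<mu>: "0 < \<mu>" "\<mu> < 1" using r by (auto simp: \<mu>_def)
  have \<mu>2: "sqrt r = \<mu>\<^sup>2" using r by (simp add: \<mu>_def)
  let ?C = "\<lambda>\<omega> n l k. correlation \<tau> \<omega> n l k"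
  have C [measurable]: "(\<lambda>\<omega>. ?C \<omega> n l k) \<in> borel_measurable phase_seq_measure" for n l k
    unfolding phase_seq_measure_def by (rule correlation_measurable) auto
  have moment: "(\<integral>\<^sup>+\<omega>. ennreal (norm (?C \<omega> n l k) powr p) \<partial>phase_seq_measure) \<le> ennreal (2 * \<mu> ^ (2 * n))"
    if "k \<noteq> 0" for n l k
  proof -
    have "(\<integral>\<^sup>+\<omega>. ennreal (norm (?C \<omega> n l k) powr p) \<partial>phase_seq_measure)
      \<le> (\<integral>\<^sup>+\<omega>. ennreal ((norm (?C \<omega> n l k))\<^sup>2) \<partial>phase_seq_measure)"
    proof (intro nn_integral_mono ennreal_leI)
      fix \<omega>
      \<comment> \<open>Correlations are at most 1, so raising the exponent from 2 to
        \<open>p\<close> only lowers the power.\<close>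
      have "norm (?C \<omega> n l k) powr p \<le> norm (?C \<omega> n l k) powr 2"
        using p norm_correlation_le[of \<tau> \<omega> n l k] by (intro powr_mono') auto
      then show "norm (?C \<omega> n l k) powr p \<le> (norm (?C \<omega> n l k))\<^sup>2" by simp
    qed
    also have "\<dots> = ennreal (\<integral>\<omega>. (norm (?C \<omega> n l k))\<^sup>2 \<partial>phase_seq_measure)"
    proof (rule nn_integral_eq_integral)
      show "integrable phase_seq_measure (\<lambda>\<omega>. (norm (?C \<omega> n l k))\<^sup>2)"
        by (intro \<Omega>.integrable_const_bound[of _ 1] AE_I2) (simp_all add: power_le_one norm_correlation_le)
    qed simp
    also have "\<dots> \<le> ennreal (2 * sqrt r ^ n)"
      using that r by (intro ennreal_leI second_moment_correlation gap) (auto simp: zero_prod_def)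
    finally show ?thesis by (simp add: \<mu>2 power_mult)
  qed
  \<comment> \<open>The decay \<open>\<mu>\<^sup>2\<^sup>n\<close> of the moments and the at most \<open>16 (N + 1)\<^sup>4\<close> pairs of modes leave a summable
      \<open>\<mu>\<^sup>n (N + 1)\<^sup>-\<^sup>2\<close>.\<close>
  define c where "c n N = (1 / \<mu>) ^ n / (real N + 1) ^ 6" for n N :: nat
  have c0: "0 \<le> c n N" for n N using \<mu> by (simp add: c_def)
  define W where "W n N \<omega> = (\<Sum>l\<in>freq_box N. \<Sum>k\<in>freq_box N - {0}. ennreal (norm (?C \<omega> n l k) powr p))" for n N \<omega>
  define Z where "Z \<omega> = (\<Sum>n. \<Sum>N. ennreal (c n N) * W n N \<omega>)" for \<omega>
  have [measurable]: "W n N \<in> borel_measurable phase_seq_measure" for n N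
    unfolding W_def by measurable
  have [measurable]: "Z \<in> borel_measurable phase_seq_measure"
    unfolding Z_def by measurable
  have W: "(\<integral>\<^sup>+\<omega>. ennreal (c n N) * W n N \<omega> \<partial>phase_seq_measure) \<le> ennreal (32 * \<mu> ^ n * (1 / (real N + 1)\<^sup>2))" for n N
  proof -
    have "(\<integral>\<^sup>+\<omega>. W n N \<omega> \<partial>phase_seq_measure)
      = (\<Sum>l\<in>freq_box N. \<Sum>k\<in>freq_box N - {0}. (\<integral>\<^sup>+\<omega>. ennreal (norm (?C \<omega> n l k) powr p) \<partial>phase_seq_measure))"
      unfolding W_def by (subst nn_integral_sum, measurable, subst nn_integral_sum, measurable)
    also have "\<dots> \<le> (\<Sum>l\<in>freq_box N. \<Sum>k\<in>freq_box N - {0}. ennreal (2 * \<mu> ^ (2 * n)))"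
      by (intro sum_mono moment) auto
    also have "\<dots> \<le> (\<Sum>l\<in>freq_box N. \<Sum>k\<in>freq_box N. ennreal (2 * \<mu> ^ (2 * n)))"
      by (intro sum_mono sum_mono2 freq_box) auto
    also have "\<dots> = ennreal ((real (card (freq_box N)))\<^sup>2 * (2 * \<mu> ^ (2 * n)))"
      using \<mu> by (simp add: ennreal_of_nat_eq_real_of_nat ennreal_mult[symmetric] power2_eq_square mult.assoc)
    also have "\<dots> \<le> ennreal (16 * (real N + 1) ^ 4 * (2 * \<mu> ^ (2 * n)))"
    proof (intro ennreal_leI mult_right_mono)
      have "(real (card (freq_box N)))\<^sup>2 = (2 * real N + 1) ^ 4"
        by (simp add: freq_box add.commute flip: power_mult)
      also have "\<dots> \<le> (2 * (real N + 1)) ^ 4" by (intro power_mono) auto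
      also have "\<dots> = 16 * (real N + 1) ^ 4" by (simp only: power_mult_distrib) simp
      finally show "(real (card (freq_box N)))\<^sup>2 \<le> 16 * (real N + 1) ^ 4" .
    qed (use \<mu> in auto)
    finally have "ennreal (c n N) * (\<integral>\<^sup>+\<omega>. W n N \<omega> \<partial>phase_seq_measure)
      \<le> ennreal (c n N) * ennreal (16 * (real N + 1) ^ 4 * (2 * \<mu> ^ (2 * n)))" by (rule mult_left_mono) simp
    also have "\<dots> = ennreal (c n N * (16 * (real N + 1) ^ 4 * (2 * \<mu> ^ (2 * n))))"
      using c0 \<mu> by (intro ennreal_mult[symmetric]) auto
    also have "c n N * (16 * (real N + 1) ^ 4 * (2 * \<mu> ^ (2 * n))) = 32 * \<mu> ^ n * (1 / (real N + 1)\<^sup>2)"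
    proof -
      have "(1 / \<mu>) ^ n * \<mu> ^ (2 * n) = \<mu> ^ n"
        using \<mu> by (simp add: power_mult power2_eq_square power_mult_distrib power_divide mult_2 power_add)
      moreover have "(real N + 1) ^ 4 / (real N + 1) ^ 6 = 1 / (real N + 1)\<^sup>2"
      proof -
        have "y ^ 4 / y ^ 6 = 1 / y\<^sup>2" if "y \<noteq> 0" for y :: real
          using that by (simp add: field_simps flip: power_add)
        then show ?thesis by simp
      qed
      moreover have "c n N * (16 * (real N + 1) ^ 4 * (2 * \<mu> ^ (2 * n)))
          = 32 * ((1 / \<mu>) ^ n * \<mu> ^ (2 * n)) * ((real N + 1) ^ 4 / (real N + 1) ^ 6)"
        unfolding c_def times_divide_eq_left times_divide_eq_right by (simp only: mult_ac) simp
      ultimately show ?thesis by simp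
    qed
    finally show ?thesis by (simp add: nn_integral_cmult)
  qed
  have Zfin: "(\<integral>\<^sup>+\<omega>. Z \<omega> \<partial>phase_seq_measure) < \<infinity>"
  proof -
    have s2: "summable (\<lambda>N. 1 / (real N + 1)\<^sup>2)"
      using inverse_power_summable[of 2, where 'a = real] summable_Suc_iff[of "\<lambda>n. inverse (real n ^ 2)"]
      by (simp add: inverse_eq_divide add.commute)
    define S where "S = (\<Sum>N. 1 / (real N + 1)\<^sup>2)"
    have S0: "0 \<le> S" unfolding S_def by (rule suminf_nonneg[OF s2]) auto
    have "(\<integral>\<^sup>+\<omega>. Z \<omega> \<partial>phase_seq_measure) = (\<Sum>n. \<Sum>N. (\<integral>\<^sup>+\<omega>. ennreal (c n N) * W n N \<omega> \<partial>phase_seq_measure))"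
      unfolding Z_def by (subst nn_integral_suminf, measurable, subst nn_integral_suminf, measurable)
    also have "\<dots> \<le> (\<Sum>n. \<Sum>N. ennreal (32 * \<mu> ^ n * (1 / (real N + 1)\<^sup>2)))"
      by (intro suminf_le W) auto
    also have "\<dots> = (\<Sum>n. ennreal (32 * \<mu> ^ n * S))"
    proof (intro suminf_cong)
      fix n
      have "(\<Sum>N. ennreal (32 * \<mu> ^ n * (1 / (real N + 1)\<^sup>2))) = ennreal (\<Sum>N. 32 * \<mu> ^ n * (1 / (real N + 1)\<^sup>2))"
        using \<mu> s2 by (intro suminf_ennreal2 summable_mult) auto
      also have "(\<Sum>N. 32 * \<mu> ^ n * (1 / (real N + 1)\<^sup>2)) = 32 * \<mu> ^ n * S"
        unfolding S_def by (rule suminf_mult[OF s2])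
      finally show "(\<Sum>N. ennreal (32 * \<mu> ^ n * (1 / (real N + 1)\<^sup>2))) = ennreal (32 * \<mu> ^ n * S)" .
    qed
    also have "\<dots> = ennreal (\<Sum>n. 32 * \<mu> ^ n * S)"
      using \<mu> S0 by (intro suminf_ennreal2 summable_mult summable_mult2 summable_geometric) auto
    finally show ?thesis by (rule le_less_trans) simp
  qed
  \<comment> \<open>\<open>enn2real\<close> sends \<infinity> to 0, so \<open>D\<close> is finite
    and at least 1 everywhere; the bound itself is claimed only where \<open>Z\<close> is
    finite.\<close>
  define D where "D \<omega> = (1 + enn2real (Z \<omega>)) powr (1 / p)" for \<omega>
  define \<gamma> where "\<gamma> = - ln \<mu> / p"
  have \<gamma>: "0 < \<gamma>" using \<mu> p by (simp add: \<gamma>_def ln_less_zero divide_neg_pos)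
  have D1: "1 \<le> D \<omega>" for \<omega>
    unfolding D_def using p by (intro ge_one_powr_ge_zero) (auto simp: enn2real_nonneg)
  have Dp: "D \<omega> powr p = 1 + enn2real (Z \<omega>)" for \<omega>
    unfolding D_def using p enn2real_nonneg[of "Z \<omega>"] by (simp add: powr_powr)
  have Dm: "D \<in> borel_measurable phase_seq_measure" unfolding D_def by measurable
  have Di: "integrable phase_seq_measure (\<lambda>\<omega>. D \<omega> powr p)"
    unfolding Dp
  proof (intro Bochner_Integration.integrable_add \<Omega>.integrable_const integrableI_bounded)
    have "(\<integral>\<^sup>+\<omega>. ennreal (norm (enn2real (Z \<omega>))) \<partial>phase_seq_measure) \<le> (\<integral>\<^sup>+\<omega>. Z \<omega> \<partial>phase_seq_measure)"
      by (intro nn_integral_mono) (simp add: enn2real_nonneg ennreal_enn2real_if)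
    then show "(\<integral>\<^sup>+\<omega>. ennreal (norm (enn2real (Z \<omega>))) \<partial>phase_seq_measure) < \<infinity>"
      using Zfin by (rule le_less_trans)
  qed measurable
  have "AE \<omega> in phase_seq_measure. Z \<omega> \<noteq> \<infinity>"
    using Zfin by (intro nn_integral_PInf_AE) auto
  then have bound: "AE \<omega> in phase_seq_measure. \<forall>n N. \<forall>l\<in>freq_box N. \<forall>k\<in>freq_box N. k \<noteq> 0 \<longrightarrow>
      norm (?C \<omega> n l k) \<le> D \<omega> * exp (- \<gamma> * real n) * (real N + 1) ^ 3"
  proof eventually_elim
    case (elim \<omega>)
    show ?case
    proof (intro allI ballI impI)
      fix n N l k assume lk: "l \<in> freq_box N" "k \<in> freq_box N" "k \<noteq> 0"
      let ?x = "norm (?C \<omega> n l k)"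
      have "ennreal (?x powr p) \<le> (\<Sum>k\<in>freq_box N - {0}. ennreal (norm (?C \<omega> n l k) powr p))"
        using lk by (intro member_le_sum) (auto simp: freq_box)
      also have "\<dots> \<le> W n N \<omega>"
        unfolding W_def using lk by (intro member_le_sum[of l]) (auto simp: freq_box)
      finally have "ennreal (c n N) * ennreal (?x powr p) \<le> ennreal (c n N) * W n N \<omega>"
        by (rule mult_left_mono) simp
      also have "\<dots> \<le> (\<Sum>N. ennreal (c n N) * W n N \<omega>)"
        using sum_le_suminf[of "\<lambda>N. ennreal (c n N) * W n N \<omega>" "{N}"] by simp
      also have "\<dots> \<le> Z \<omega>"
        unfolding Z_def using sum_le_suminf[of "\<lambda>n. \<Sum>N. ennreal (c n N) * W n N \<omega>" "{n}"] by simp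
      also have "\<dots> = ennreal (enn2real (Z \<omega>))" using elim by (simp add: ennreal_enn2real_if)
      finally have "c n N * ?x powr p \<le> enn2real (Z \<omega>)"
        using c0 by (simp add: ennreal_mult[symmetric] enn2real_nonneg)
      also have "\<dots> \<le> D \<omega> powr p" unfolding Dp by simp
      finally have "?x powr p \<le> D \<omega> powr p * (\<mu> ^ n * (real N + 1) ^ 6)"
        using \<mu> by (simp add: c_def field_simps power_divide)
      then have "(?x powr p) powr (1 / p) \<le> (D \<omega> powr p * (\<mu> ^ n * (real N + 1) ^ 6)) powr (1 / p)"
        using p by (intro powr_mono2) auto
      also have "(?x powr p) powr (1 / p) = ?x" using p by (simp add: powr_powr)
      also have "(D \<omega> powr p * (\<mu> ^ n * (real N + 1) ^ 6)) powr (1 / p)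
        = D \<omega> * ((\<mu> ^ n) powr (1 / p) * ((real N + 1) ^ 6) powr (1 / p))"
        using p \<mu> D1[of \<omega>] by (simp add: powr_mult powr_powr)
      also have "(\<mu> ^ n) powr (1 / p) = exp (- \<gamma> * real n)"
        using \<mu> by (simp add: powr_def \<gamma>_def ln_realpow)
      \<comment> \<open>Here \<open>p \<ge> 2\<close> enters again: the exponent
        \<open>6 / p\<close> is at most 3, which fixes the polynomial loss independently of
        \<open>p\<close>.\<close>
      also have "((real N + 1) ^ 6) powr (1 / p) \<le> (real N + 1) ^ 3"
      proof -
        have "((real N + 1) ^ 6) powr (1 / p) = (real N + 1) powr (6 / p)"
          by (simp add: powr_powr flip: powr_numeral)
        also have "\<dots> \<le> (real N + 1) powr 3" using p by (intro powr_mono) (auto simp: field_simps)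
        finally show ?thesis by simp
      qed
      finally show "?x \<le> D \<omega> * exp (- \<gamma> * real n) * (real N + 1) ^ 3"
        using D1[of \<omega>] by (simp add: mult.assoc mult_left_mono)
    qed
  qed
  show thesis by (rule that[OF \<gamma> D1 Dm Di bound])
qed

theorem theorem1p1:
  fixes \<tau> q s :: real
  assumes "\<tau> > 0" and "q > 0" and "s > 0"
  shows "\<exists>(D :: (nat \<Rightarrow> real \<times> real) \<Rightarrow> real) (\<alpha> :: real).
      \<alpha> > 0 \<and>
      (\<forall>\<omega>\<in>space phase_seq_measure. D \<omega> \<ge> 1) \<and>
      integrable phase_seq_measure (\<lambda>\<omega>. \<bar>D \<omega>\<bar> powr q) \<and>
      (\<forall>\<phi>\<in>sobolev_space s. \<forall>\<psi>\<in>sobolev_space s. mean_free \<phi> \<longrightarrow> mean_free \<psi> \<longrightarrow>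
        (AE \<omega> in phase_seq_measure. \<forall>n.
          cmod (LINT x|torus_measure. \<phi> x * \<psi> (pierrehumbert_flow \<tau> \<omega> n x))
            \<le> D \<omega> * exp (- \<alpha> * real n) * sobolev_norm s \<phi> * sobolev_norm s \<psi>))"
proof -
  \<comment> \<open>The moment comparison requires an exponent of at least 2; since
    \<open>D \<ge> 1\<close>, the moment of order \<open>q\<close> is then dominated by that of
    order \<open>p\<close>.\<close>
  define p where "p = max 2 q"
  have p: "2 \<le> p" "q \<le> p" by (auto simp: p_def)
  obtain D \<gamma> where \<gamma>: "0 < \<gamma>" and D1: "\<And>\<omega>. 1 \<le> D \<omega>" and Dm [measurable]: "D \<in> borel_measurable phase_seq_measure"
    and Di: "integrable phase_seq_measure (\<lambda>\<omega>. D \<omega> powr p)"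
    and corr: "AE \<omega> in phase_seq_measure. \<forall>n N. \<forall>l\<in>freq_box N. \<forall>k\<in>freq_box N. k \<noteq> 0 \<longrightarrow>
      norm (correlation \<tau> \<omega> n l k) \<le> D \<omega> * exp (- \<gamma> * real n) * (real N + 1) ^ 3"
    using correlation_bound_random[OF assms(1) p(1)] by blast
  have "integrable phase_seq_measure (\<lambda>\<omega>. \<bar>170000 * D \<omega>\<bar> powr q)"
  proof (rule Bochner_Integration.integrable_bound)
    show "integrable phase_seq_measure (\<lambda>\<omega>. 170000 powr q * D \<omega> powr p)"
      by (intro integrable_mult_right Di)
    show "AE \<omega> in phase_seq_measure. norm (\<bar>170000 * D \<omega>\<bar> powr q) \<le> norm (170000 powr q * D \<omega> powr p)"
    proof (rule AE_I2)
      fix \<omega>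
      have "\<bar>170000 * D \<omega>\<bar> powr q = 170000 powr q * D \<omega> powr q"
        using D1[of \<omega>] by (simp add: powr_mult)
      also have "\<dots> \<le> 170000 powr q * D \<omega> powr p"
        using D1[of \<omega>] p by (intro mult_left_mono powr_mono) auto
      finally show "norm (\<bar>170000 * D \<omega>\<bar> powr q) \<le> norm (170000 powr q * D \<omega> powr p)" by simp
    qed
  qed measurable
  moreover have "1 \<le> 170000 * D \<omega>" for \<omega> using D1[of \<omega>] by simp
  moreover have "0 < min (s * \<gamma> / 16) (\<gamma> / 2)" using \<gamma> assms(3) by simp
  moreover have "AE \<omega> in phase_seq_measure. \<forall>n.
      cmod (LINT x|torus_measure. \<phi> x * \<psi> (pierrehumbert_flow \<tau> \<omega> n x))
        \<le> (170000 * D \<omega>) * exp (- min (s * \<gamma> / 16) (\<gamma> / 2) * real n) * sobolev_norm s \<phi> * sobolev_norm s \<psi>"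
    if "\<phi> \<in> sobolev_space s" "\<psi> \<in> sobolev_space s" "mean_free \<psi>" for \<phi> \<psi>
    \<comment> \<open>The exceptional null set is the one for the mode correlations, hence the same
      for all \<phi> and \<psi>.\<close>
    using corr
  proof eventually_elim
    case (elim \<omega>)
    show ?case
      by (intro allI mixing_sobolev[OF assms(3) \<gamma> D1 _ that]) (use elim in blast)
  qed
  ultimately show ?thesis
    by (intro exI[of _ "\<lambda>\<omega>. 170000 * D \<omega>"] exI[of _ "min (s * \<gamma> / 16) (\<gamma> / 2)"]) blast
qed

end
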